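(* Let $G$ be a $6$-regular $(4,1)$-graph. Then no $6$-edge-cut of $G$ has a shore of size $a$ with $9\le a\le 14$.
   Context: All graphs are finite and simple. A $(4,1)$-graph is a graph $G$ with $\chi(G)=4$, $\chi(G-v)=3$ for every vertex $v$, and $\chi(G-e)=4$ for every edge $e$. For a partition $V(G)=A\sqcup B$ with $A,B$ nonempty, the edge cut is the set $E(A,B)$ of edges with one end in $A$ and one in $B$; it is a $6$-edge-cut if $|E(A,B)|=6$, and $A$ and $B$ are its shores. *)

theory Defs
  imports Main
begin

record 'a graph =
  verts :: "'a set"
  edges :: "'a set set"

definition finite_simple_graph :: "'a graph \<Rightarrow> bool" where
  "finite_simple_graph G \<longleftrightarrow>
     finite (verts G) \<and> (\<forall>e\<in>edges G. e \<subseteq> verts G \<and> card e = 2)"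

definition degree :: "'a graph \<Rightarrow> 'a \<Rightarrow> nat" where
  "degree G v = card {e \<in> edges G. v \<in> e}"

definition regular :: "nat \<Rightarrow> 'a graph \<Rightarrow> bool" where
  "regular r G \<longleftrightarrow> (\<forall>v\<in>verts G. degree G v = r)"

definition delete_vertex :: "'a graph \<Rightarrow> 'a \<Rightarrow> 'a graph" where
  "delete_vertex G v = \<lparr>verts = verts G - {v}, edges = {e \<in> edges G. v \<notin> e}\<rparr>"

definition delete_edge :: "'a graph \<Rightarrow> 'a set \<Rightarrow> 'a graph" where
  "delete_edge G e = \<lparr>verts = verts G, edges = edges G - {e}\<rparr>"

definition proper_colouring :: "'a graph \<Rightarrow> nat \<Rightarrow> ('a \<Rightarrow> nat) \<Rightarrow> bool" where
  "proper_colouring G k c \<longleftrightarrow>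
     (\<forall>v\<in>verts G. c v < k) \<and>
     (\<forall>u\<in>verts G. \<forall>v\<in>verts G. {u, v} \<in> edges G \<longrightarrow> c u \<noteq> c v)"

definition chromatic_number :: "'a graph \<Rightarrow> nat" where
  "chromatic_number G = (LEAST k. \<exists>c. proper_colouring G k c)"

text \<open>The least number above is attained for every finite simple graph.\<close>

lemma proper_colouring_chromatic_number:
  assumes "finite_simple_graph G"
  shows "\<exists>c. proper_colouring G (chromatic_number G) c"
proof -
  obtain c :: "'a \<Rightarrow> nat" where c: "bij_betw c (verts G) {..<card (verts G)}"
    using assms ex_bij_betw_finite_nat[of "verts G"]
    by (auto simp: finite_simple_graph_def atLeast0LessThan)
  have "proper_colouring G (card (verts G)) c"
    unfolding proper_colouring_def
  proof (intro conjI ballI impI)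
    fix v assume "v \<in> verts G"
    then show "c v < card (verts G)" using bij_betwE[OF c] by auto
  next
    fix u v assume uv: "u \<in> verts G" "v \<in> verts G" "{u, v} \<in> edges G"
    then have "u \<noteq> v" using assms by (auto simp: finite_simple_graph_def)
    then show "c u \<noteq> c v" using c uv by (auto simp: bij_betw_def inj_on_def)
  qed
  then show ?thesis
    unfolding chromatic_number_def
    by (intro LeastI[of "\<lambda>k. \<exists>c. proper_colouring G k c"]) blast
qed

definition graph_4_1 :: "'a graph \<Rightarrow> bool" where
  "graph_4_1 G \<longleftrightarrow>
     finite_simple_graph G \<and>
     chromatic_number G = 4 \<and>
     (\<forall>v\<in>verts G. chromatic_number (delete_vertex G v) = 3) \<and>
     (\<forall>e\<in>edges G. chromatic_number (delete_edge G e) = 4)"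

definition edges_between :: "'a graph \<Rightarrow> 'a set \<Rightarrow> 'a set \<Rightarrow> 'a set set" where
  "edges_between G A B = {e \<in> edges G. \<exists>a\<in>A. \<exists>b\<in>B. e = {a, b}}"

definition vertex_bipartition :: "'a graph \<Rightarrow> 'a set \<Rightarrow> 'a set \<Rightarrow> bool" where
  "vertex_bipartition G A B \<longleftrightarrow>
     A \<union> B = verts G \<and> A \<inter> B = {} \<and> A \<noteq> {} \<and> B \<noteq> {}"

text \<open>The edge cut \<open>edges_between G A B\<close> is represented by the pair \<open>A\<close>, \<open>B\<close> of its shores.\<close>

definition k_edge_cut :: "nat \<Rightarrow> 'a graph \<Rightarrow> 'a set \<Rightarrow> 'a set \<Rightarrow> bool" where
  "k_edge_cut k G A B \<longleftrightarrow> vertex_bipartition G A B \<and> card (edges_between G A B) = k"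

end

theory Submission
  imports Defs
begin

text \<open>
  No edge of \<open>G\<close> is critical, so every map from the vertices to three colours has at least two
  monochromatic edges. Hence a 3-colouring of \<open>G - p\<close> uses each colour exactly twice on the
  neighbours of \<open>p\<close>. If two 3-colourings of the shores of a cut are combined under the six
  permutations of the colours, each combination has at least two conflicts; a cut of size 6 leaves no
  slack, and so the numbers of cut edges at the three colour classes of a shore agree modulo 3.

  Take a shore \<open>A\<close> of a 6-edge-cut with \<open>2 \<le> |A| \<le> 14\<close> of least size. Every vertex of \<open>A\<close> is on at most
  two cut edges, as it could be moved across the cut otherwise. Let \<open>I\<close> be a colour class of \<open>A\<close>, let
  \<open>R = A - I\<close>, and let \<open>T(p)\<close> be the set of non-neighbours of \<open>p \<in> I\<close> in \<open>R\<close>. A 3-colouring of \<open>G - p\<close>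
  partitions \<open>R\<close> into three independent parts (the view of \<open>p\<close>) with at most two neighbours of \<open>p\<close> each,
  such that every \<open>T(q)\<close> with \<open>q \<in> I - {p}\<close> contains one of the parts, namely the part of the colour of \<open>q\<close>.
  The interplay of the views of all \<open>p \<in> I\<close> bounds \<open>|I|\<close> in terms of \<open>|A|\<close> and the number of cut edges at \<open>I\<close>.
  The bounds for the three classes add up to less than \<open>|A|\<close>, except for \<open>|A| = 14\<close> and classes of sizes
  5, 5, 4 or 6, 4, 4 with a class of size 4 that meets no cut edge. These two configurations, and one
  of the bounds, are excluded by a finite search over all set systems \<open>T\<close> up to isomorphism.
\<close>

section \<open>View systems\<close>

text \<open>Any two colours, one for each end of a cut edge, are identified by two of the six
  permutations, so the conflicts over all permutations add up to twice the cut size. Two conflicts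
  each make 6 the least cut size, and equality makes the table of colour pairs on the cut rigid. The
  shores start at size 2 because minimality is applied to a shore with one vertex removed: all
  smaller shores have to be excluded already, except single vertices, whose cuts do have size 6. A
  view keeps only the restriction to \<open>R\<close> of a colouring of \<open>G - p\<close>, as
  nothing is retained of the graph beyond the shore. Contradictions then have two sources. One is
  the size of sets: \<open>T q\<close> contains a part of the view of \<open>p\<close>, with at
  least \<open>2 - t p\<close> neighbours of \<open>p\<close>, so \<open>T q\<close> is neither
  small nor nearly contained in \<open>T p\<close>. The other is the number of edges: 6-regularity
  fixes how many edges lie inside \<open>R\<close>, while the views make large subsets of
  \<open>R\<close> independent.\<close>

text \<open>\<open>t p\<close> is the number of cut edges at \<open>p\<close>, so that \<open>p\<close> has \<open>6 - t p\<close> neighbours in the shore; \<open>E\<close> is adjacency.\<close>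

locale view_system =
  fixes I R :: "'a set" and T :: "'a \<Rightarrow> 'a set" and t :: "'a \<Rightarrow> nat" and E :: "'a \<Rightarrow> 'a \<Rightarrow> bool"
  assumes finI: "finite I" and finR: "finite R"
    and T_sub: "p \<in> I \<Longrightarrow> T p \<subseteq> R"
    and T_card: "p \<in> I \<Longrightarrow> card R + t p = card (T p) + 6"
    and E_sym: "E x y \<Longrightarrow> E y x"
    and t_le: "p \<in> I \<union> R \<Longrightarrow> t p \<le> 2"
    and view: "p \<in> I \<Longrightarrow> \<exists>c :: 'a \<Rightarrow> nat. (\<forall>x\<in>R. c x < 3) \<and> (\<forall>x\<in>R. \<forall>y\<in>R. E x y \<longrightarrow> c x \<noteq> c y) \<and>
      (\<forall>j<3. card {x\<in>R - T p. c x = j} \<le> 2) \<and>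
      (\<forall>q\<in>I - {p}. \<exists>j<3. \<forall>x\<in>R. c x = j \<longrightarrow> x \<in> T q)"
    and deg: "x \<in> R \<Longrightarrow> card {y\<in>R. E x y} + card I + t x = 6 + card {p\<in>I. x \<in> T p}"
    and tot: "sum t I + sum t R = 6"
begin

definition indep :: "'a set \<Rightarrow> bool" where
  "indep X \<longleftrightarrow> (\<forall>x\<in>X. \<forall>y\<in>X. \<not> E x y)"

text \<open>A view without the names of its colours. The condition is symmetric in the three parts,
  which is what permits the choices without loss of generality below. The set \<open>A - T p\<close>
  consists of the neighbours of \<open>p\<close> in the part \<open>A\<close>.\<close>

definition parts :: "'a \<Rightarrow> 'a set \<Rightarrow> 'a set \<Rightarrow> 'a set \<Rightarrow> bool" where
  "parts p A B C \<longleftrightarrow> A \<union> B \<union> C = R \<and> A \<inter> B = {} \<and> A \<inter> C = {} \<and> B \<inter> C = {} \<and>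
     card (A - T p) \<le> 2 \<and> card (B - T p) \<le> 2 \<and> card (C - T p) \<le> 2 \<and>
     indep A \<and> indep B \<and> indep C \<and>
     (\<forall>q\<in>I - {p}. A \<subseteq> T q \<or> B \<subseteq> T q \<or> C \<subseteq> T q)"

lemma parts_12: "parts p A B C \<Longrightarrow> parts p B A C"
  unfolding parts_def by blast

lemma parts_23: "parts p A B C \<Longrightarrow> parts p A C B"
  unfolding parts_def by blast

lemma parts_13: "parts p A B C \<Longrightarrow> parts p C B A"
  unfolding parts_def by blast

lemma parts_exist:
  assumes "p \<in> I" obtains A B C where "parts p A B C"
proof -
  obtain c :: "'a \<Rightarrow> nat" where c: "\<forall>x\<in>R. c x < 3" "\<forall>x\<in>R. \<forall>y\<in>R. E x y \<longrightarrow> c x \<noteq> c y"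
    "\<forall>j<3. card {x\<in>R - T p. c x = j} \<le> 2" "\<forall>q\<in>I - {p}. \<exists>j<3. \<forall>x\<in>R. c x = j \<longrightarrow> x \<in> T q"
    using view[OF assms] by blast
  define Q where "Q j = {x\<in>R. c x = j}" for j
  have less3: "j < 3 \<longleftrightarrow> j = 0 \<or> j = 1 \<or> j = 2" for j :: nat by auto
  have d: "Q j - T p = {x\<in>R - T p. c x = j}" for j by (auto simp: Q_def)
  have "parts p (Q 0) (Q 1) (Q 2)"
    unfolding parts_def
  proof (intro conjI ballI)
    show "Q 0 \<union> Q 1 \<union> Q 2 = R" using c(1) by (auto simp: Q_def less3)
    show "Q 0 \<inter> Q 1 = {}" "Q 0 \<inter> Q 2 = {}" "Q 1 \<inter> Q 2 = {}" by (auto simp: Q_def)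
    show "card (Q 0 - T p) \<le> 2" "card (Q 1 - T p) \<le> 2" "card (Q 2 - T p) \<le> 2"
      using c(3) by (simp_all add: d)
    show "indep (Q 0)" "indep (Q 1)" "indep (Q 2)"
      using c(2) by (simp_all add: indep_def Q_def) (metis+)
    fix q assume "q \<in> I - {p}"
    then obtain j where "j < 3" "Q j \<subseteq> T q" using c(4) by (fastforce simp: Q_def)
    then show "Q 0 \<subseteq> T q \<or> Q 1 \<subseteq> T q \<or> Q 2 \<subseteq> T q" by (auto simp: less3)
  qed
  then show ?thesis using that by blast
qed

lemma finT: "p \<in> I \<Longrightarrow> finite (T p)"
  using T_sub finR finite_subset by blast

lemma parts_fin:
  assumes "parts p A B C" shows "finite A" "finite B" "finite C"
  using assms finR finite_subset[of _ R] unfolding parts_def by auto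

lemma parts_sub:
  assumes "parts p A B C" shows "A \<subseteq> R" "B \<subseteq> R" "C \<subseteq> R"
  using assms unfolding parts_def by auto

lemma parts_card:
  assumes "parts p A B C" shows "card A + card B + card C = card R"
proof -
  note f = parts_fin[OF assms]
  have "R = A \<union> B \<union> C" "(A \<union> B) \<inter> C = {}" "A \<inter> B = {}" using assms unfolding parts_def by auto
  then show ?thesis using f by (simp add: card_Un_disjoint)
qed

lemma parts_K:
  assumes "parts p A B C" "p \<in> I"
  shows "card (A - T p) + card (B - T p) + card (C - T p) + t p = 6"
proof -
  note f = parts_fin[OF assms(1)]
  have "R - T p = (A - T p) \<union> (B - T p) \<union> (C - T p)" "((A - T p) \<union> (B - T p)) \<inter> (C - T p) = {}"
    "(A - T p) \<inter> (B - T p) = {}" using assms(1) unfolding parts_def by auto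
  then have "card (R - T p) = card (A - T p) + card (B - T p) + card (C - T p)"
    using f by (simp add: card_Un_disjoint)
  moreover have "card (R - T p) = card R - card (T p)" "card (T p) \<le> card R"
    using T_sub[OF assms(2)] finR finT[OF assms(2)] by (auto simp: card_Diff_subset card_mono)
  ultimately show ?thesis using T_card[OF assms(2)] by linarith
qed

text \<open>There are \<open>6 - t p\<close> neighbours of \<open>p\<close> in \<open>R\<close>, and
  the other two parts take at most four of them.\<close>

lemma parts_K1:
  assumes "parts p A B C" "p \<in> I"
  shows "2 \<le> card (A - T p) + t p" "card (A - T p) \<le> 2" 
proof -
  show "2 \<le> card (A - T p) + t p" 
    using parts_K[OF assms] assms(1) unfolding parts_def by linarith
  show "card (A - T p) \<le> 2" using assms(1) unfolding parts_def by blast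
qed

lemma parts_in:
  assumes "parts p A B C" "q \<in> I" "q \<noteq> p"
  shows "A \<subseteq> T q \<or> B \<subseteq> T q \<or> C \<subseteq> T q"
  using assms unfolding parts_def by blast

lemma parts_at:
  assumes "p \<in> I" "q \<in> I" "q \<noteq> p"
  obtains A B C where "parts p A B C" "A \<subseteq> T q"
proof -
  obtain A B C where P: "parts p A B C" using parts_exist[OF assms(1)] .
  consider "A \<subseteq> T q" | "B \<subseteq> T q" | "C \<subseteq> T q" using parts_in[OF P assms(2,3)] by blast
  then show ?thesis using that P parts_12 parts_13 by cases blast+
qed

text \<open>In the view of \<open>p\<close>, the set \<open>T q\<close> contains a whole part, and
  by \<open>parts_K1\<close> this part has at least \<open>2 - t p\<close> elements outside
  \<open>T p\<close>.\<close>

lemma diff_card: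
  assumes "p \<in> I" "q \<in> I" "q \<noteq> p"
  shows "2 \<le> card (T q - T p) + t p"
proof -
  obtain A B C where P: "parts p A B C" "A \<subseteq> T q" using parts_at[OF assms] .
  have "card (A - T p) \<le> card (T q - T p)"
    using P(2) finT[OF assms(2)] by (intro card_mono) auto
  then show ?thesis using parts_K1(1)[OF P(1) assms(1)] by linarith
qed

lemma T_neq:
  assumes "p \<in> I" "q \<in> I" "q \<noteq> p" "t p \<le> 1"
  shows "T q \<noteq> T p"
  using diff_card[OF assms(1-3)] assms(4) by auto

lemma part_pos:
  assumes "parts p A B C" "p \<in> I" "t p \<le> 1"
  shows "A - T p \<noteq> {}"
  using parts_K1(1)[OF assms(1,2)] assms(3) by (metis card.empty add_0 le_trans numeral_le_one_iff semiring_norm(69))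

section \<open>Bounds from the sizes of the sets \<open>T p\<close> alone\<close>

text \<open>In the names of the rules, the first number is \<open>card R\<close>, and a second one stands for the numbers of members
  \<open>p\<close> of \<open>I\<close> with \<open>t p = 0\<close> and \<open>t p = 1\<close>.\<close>

lemma rule_7:
  assumes "card R \<le> 7" "u \<in> I" "v \<in> I" "u \<noteq> v" "t u = 0" "t v = 0" shows False
proof -
  have "2 \<le> card (T v - T u)" using diff_card[of u v] assms by simp
  also have "\<dots> \<le> card (T v)" using finT assms by (intro card_mono) auto
  finally show False using T_card[of v] assms by simp
qed

lemma rule_6:
  assumes "card R \<le> 6" "v \<in> I" "p \<in> I" "t v = 0" "t p = 1" shows False
proof -
  have "2 \<le> card (T p - T v)" using diff_card[of v p] assms by (metis add.right_neutral zero_neq_one)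
  also have "\<dots> \<le> card (T p)" using finT assms by (intro card_mono) auto
  finally show False using T_card[of p] assms by simp
qed

text \<open>All three sets \<open>T\<close> have at most one element. In the view of
  \<open>p\<close>, the part inside \<open>T q\<close> is a single neighbour of \<open>p\<close>, so
  the other two parts hold two neighbours each and are too large for \<open>T s\<close>. Hence
  \<open>T s\<close> contains the same part and equals \<open>T q\<close>, against
  \<open>T_neq\<close>.\<close>

lemma rule_6':
  assumes "card R \<le> 6" and I: "p \<in> I" "q \<in> I" "s \<in> I" and ne: "p \<noteq> q" "p \<noteq> s" "q \<noteq> s"
    and t: "t p = 1" "t q = 1" "t s = 1" shows False
proof -
  have c1: "card (T x) \<le> 1" if "x \<in> I" "t x = 1" for x using T_card[OF that(1)] that(2) assms(1) by simp
  obtain A B C where P: "parts p A B C" "A \<subseteq> T q" using parts_at[of p q] I ne by auto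
  have single: "X = T x \<and> card (X - T p) = 1" if "parts p X Y Z" "X \<subseteq> T x" "x \<in> I" "t x = 1" for X Y Z x
  proof -
    have "card X \<le> card (T x)" using that finT card_mono by blast
    moreover have "card (X - T p) \<le> card X" using parts_fin[OF that(1)] by (intro card_mono) auto
    moreover have "1 \<le> card (X - T p)" using parts_K1(1)[OF that(1) I(1)] t by simp
    ultimately have "card X = card (T x)" "card (X - T p) = 1" using c1[OF that(3,4)] by linarith+
    then show ?thesis using card_subset_eq[OF finT[OF that(3)] that(2)] by simp
  qed
  note sA = single[OF P I(2) t(2)]
  have "card (A - T p) + card (B - T p) + card (C - T p) + t p = 6" using parts_K[OF P(1) I(1)] .
  moreover have "card (B - T p) \<le> 2" "card (C - T p) \<le> 2" using P(1) unfolding parts_def by auto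
  ultimately have BC: "card (B - T p) = 2" "card (C - T p) = 2" using sA t by auto
  have "A \<subseteq> T s \<or> B \<subseteq> T s \<or> C \<subseteq> T s" using parts_in[OF P(1) I(3)] ne by auto
  then have "A \<subseteq> T s"
    using single[OF parts_12[OF P(1)], of s] single[OF parts_13[OF P(1)], of s] I t BC by auto
  then have "T s = T q" using single[OF P(1) _ I(3) t(3)] sA by auto
  then show False using T_neq[of q s] I ne t by auto
qed

text \<open>Each part of the view of \<open>v\<close> has at least two elements, and
  \<open>T p\<close>, \<open>T q\<close>, \<open>T s\<close> have exactly two. They are distinct, so
  they are the three parts, which then cover only 6 of the 7 elements.\<close>

lemma rule_7':
  assumes r: "card R = 7" and I: "v \<in> I" "p \<in> I" "q \<in> I" "s \<in> I"
    and ne: "p \<noteq> q" "p \<noteq> s" "q \<noteq> s"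
    and t: "t v = 0" "t p = 1" "t q = 1" "t s = 1" shows False
proof -
  obtain A B C where P: "parts v A B C" "A \<subseteq> T p" using parts_at[OF I(1,2)] t by (metis zero_neq_one)
  have eq: "X = T x" if "parts v X Y Z" "X \<subseteq> T x" "x \<in> I" "t x = 1" for X Y Z x
  proof -
    have "card (X - T v) \<le> card X" using parts_fin[OF that(1)] by (intro card_mono) auto
    moreover have "2 \<le> card (X - T v)" using parts_K1(1)[OF that(1) I(1)] t by simp
    moreover have "card (T x) = 2" using T_card[OF that(3)] that(4) r by simp
    ultimately show ?thesis using card_seteq[OF finT[OF that(3)] that(2)] by linarith
  qed
  have A: "A = T p" using eq[OF P I(2) t(2)] .
  have ne': "T q \<noteq> T p" "T s \<noteq> T p" "T s \<noteq> T q"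
    using T_neq[of p q] T_neq[of p s] T_neq[of q s] I ne t by auto
  have c2: "card (T x) = 2" if "x \<in> I" "t x = 1" for x using T_card[OF that(1)] that(2) r by simp
  have q: "A \<subseteq> T q \<or> B \<subseteq> T q \<or> C \<subseteq> T q" and s: "A \<subseteq> T s \<or> B \<subseteq> T s \<or> C \<subseteq> T s"
    using parts_in[OF P(1) I(3)] parts_in[OF P(1) I(4)] t by (metis zero_neq_one)+
  note eB = eq[OF parts_12[OF P(1)]] and eC = eq[OF parts_13[OF P(1)]]
  have q': "B = T q \<or> C = T q" using q eq[OF P(1) _ I(3) t(3)] eB[OF _ I(3) t(3)] eC[OF _ I(3) t(3)] A ne'(1) by metis
  have s': "B = T s \<or> C = T s" using s eq[OF P(1) _ I(4) t(4)] eB[OF _ I(4) t(4)] eC[OF _ I(4) t(4)] A ne'(2) by metis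
  have "card B = 2 \<and> card C = 2" using q' s' ne'(3) c2 I t by metis
  then show False using parts_card[OF P(1)] r A c2[OF I(2) t(2)] by simp
qed

lemma pairs_sub:
  assumes "parts p A B C" "p \<in> I" "t p \<le> 1" "A \<subseteq> T u" "T u \<inter> T v = {}"
  shows "\<not> A \<subseteq> T v"
  using part_pos[OF assms(1-3)] assms(4,5) by blast

lemma int_disjoint:
  assumes "card R \<le> 8" "u \<in> I" "v \<in> I" "u \<noteq> v" "t u = 0" "t v = 0"
  shows "T u \<inter> T v = {}"
proof (rule ccontr)
  assume "T u \<inter> T v \<noteq> {}"
  then have "card (T v - T u) < card (T v)" using finT[OF assms(3)] by (intro psubset_card_mono) auto
  moreover have "2 \<le> card (T v - T u)" using diff_card[of u v] assms by simp
  ultimately show False using T_card[OF assms(3)] assms by simp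
qed

lemma distinct_parts:
  assumes P: "parts p A B C" and p: "p \<in> I" "t p \<le> 1"
    and I: "u \<in> I" "v \<in> I" "u \<noteq> p" "v \<noteq> p" and dis: "T u \<inter> T v = {}"
  obtains X Y Z where "parts p X Y Z" "X \<subseteq> T u" "Y \<subseteq> T v"
proof -
  obtain X Y Z where Q: "parts p X Y Z" "X \<subseteq> T u" using parts_at[of p u] p I by auto
  have "\<not> X \<subseteq> T v" using pairs_sub[OF Q(1) p Q(2) dis] .
  then consider "Y \<subseteq> T v" | "Z \<subseteq> T v" using parts_in[OF Q(1) I(2,4)] by blast
  then show ?thesis using that Q parts_23 by cases blast+
qed

text \<open>For \<open>t p \<le> 1\<close> every part is nonempty, so two disjoint sets
  \<open>T\<close> cannot contain the same part.\<close>

lemma three_parts: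
  assumes p: "p \<in> I" "t p \<le> 1"
    and I: "u \<in> I" "v \<in> I" "w \<in> I" "u \<noteq> p" "v \<noteq> p" "w \<noteq> p"
    and dis: "T u \<inter> T v = {}" "T u \<inter> T w = {}" "T v \<inter> T w = {}"
  obtains X Y Z where "parts p X Y Z" "X \<subseteq> T u" "Y \<subseteq> T v" "Z \<subseteq> T w"
proof -
  obtain A B C where "parts p A B C" using parts_exist[OF p(1)] .
  then obtain X Y Z where Q: "parts p X Y Z" "X \<subseteq> T u" "Y \<subseteq> T v"
    using distinct_parts p I dis by metis
  have "\<not> X \<subseteq> T w" "\<not> Y \<subseteq> T w"
    using pairs_sub[OF Q(1) p Q(2) dis(2)] pairs_sub[OF parts_12[OF Q(1)] p Q(3) dis(3)] .
  then show ?thesis using that Q parts_in[OF Q(1) I(3,6)] by blast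
qed

text \<open>The sets \<open>T u\<close>, \<open>T v\<close>, \<open>T w\<close> are disjoint pairs
  that contain the three parts of the view of \<open>p\<close>; these have at most 6 elements in
  all, not 8.\<close>

lemma rule_8_3:
  assumes r: "card R = 8" and I: "p \<in> I" "u \<in> I" "v \<in> I" "w \<in> I"
    and ne: "u \<noteq> p" "v \<noteq> p" "w \<noteq> p" "u \<noteq> v" "u \<noteq> w" "v \<noteq> w"
    and t: "t p \<le> 1" "t u = 0" "t v = 0" "t w = 0" shows False
proof -
  have "T u \<inter> T v = {}" "T u \<inter> T w = {}" "T v \<inter> T w = {}"
    using int_disjoint[of u v] int_disjoint[of u w] int_disjoint[of v w] r I ne t by auto
  then obtain X Y Z where Q: "parts p X Y Z" "X \<subseteq> T u" "Y \<subseteq> T v" "Z \<subseteq> T w"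
    using three_parts[of p u v w] I ne t by metis
  have "card X \<le> card (T u)" "card Y \<le> card (T v)" "card Z \<le> card (T w)"
    using Q finT I by (auto intro!: card_mono)
  then show False using T_card[of u] T_card[of v] T_card[of w] parts_card[OF Q(1)] I t r by simp
qed

text \<open>The four sets \<open>T\<close> are triples, any two of which share at most one element,
  whereas a part in the view of a member has at least two. So the parts in each view lie in
  different triples, and by counting they are equal to the three triples of the other members. Thus
  the triples of \<open>u\<close>, \<open>v\<close>, \<open>w\<close> cover \<open>R\<close>, and
  other views make \<open>T p\<close> disjoint from all of them.\<close>

lemma rule_9_4:
  assumes r: "card R = 9" and I: "p \<in> I" "u \<in> I" "v \<in> I" "w \<in> I"
    and ne: "u \<noteq> p" "v \<noteq> p" "w \<noteq> p" "u \<noteq> v" "u \<noteq> w" "v \<noteq> w"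
    and t: "t p = 0" "t u = 0" "t v = 0" "t w = 0" shows False
proof -
  have c3: "card (T x) = 3" if "x \<in> I" "t x = 0" for x using T_card[OF that(1)] that(2) r by simp
  have int1: "card (T x \<inter> T y) \<le> 1" if "x \<in> I" "y \<in> I" "x \<noteq> y" "t x = 0" "t y = 0" for x y
  proof -
    have "2 \<le> card (T y - T x)" using diff_card[OF that(1,2)] that by auto
    moreover have "card (T y) = card (T y - T x) + card (T y \<inter> T x)"
      using finT[OF that(2)] by (metis Diff_Int2 card_Diff_subset_Int card_mono finite_Int le_add_diff_inverse2 Int_lower1)
    ultimately show ?thesis using c3[OF that(2,5)] by (simp add: Int_commute)
  qed
  have part: "R = T x \<union> T y \<union> T z" "T x \<inter> T y = {}"
    if "a \<in> I" "x \<in> I" "y \<in> I" "z \<in> I" "x \<noteq> a" "y \<noteq> a" "z \<noteq> a" "x \<noteq> y" "x \<noteq> z" "y \<noteq> z"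
      "t a = 0" "t x = 0" "t y = 0" "t z = 0" for a x y z
  proof -
    have sep: False if "parts a A B C" "A \<subseteq> T x" "A \<subseteq> T y" "x \<in> I" "y \<in> I" "x \<noteq> y" "t x = 0" "t y = 0" for A B C x y
    proof -
      have "2 \<le> card (A - T a)" using parts_K1(1)[OF that(1) \<open>a \<in> I\<close>] \<open>t a = 0\<close> by simp
      also have "\<dots> \<le> card (T x \<inter> T y)" using that finT by (intro card_mono) auto
      finally show False using int1[of x y] that by simp
    qed
    note at = parts_at[OF that(1,2,5)]
    have mem: "y \<in> I" "y \<noteq> a" "z \<in> I" "z \<noteq> a" using that by auto
    obtain A B C where P: "parts a A B C" "A \<subseteq> T x" by (rule at)
    have "\<not> A \<subseteq> T y" using sep[OF P(1,2)] that by blast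
    then obtain A B C where P: "parts a A B C" "A \<subseteq> T x" "B \<subseteq> T y"
      using parts_in[OF P(1) mem(1,2)] P parts_23 by blast
    have "\<not> A \<subseteq> T z" "\<not> B \<subseteq> T z" using sep[OF P(1,2)] sep[OF parts_12[OF P(1)] P(3)] that by blast+
    then have C: "C \<subseteq> T z" using parts_in[OF P(1) mem(3,4)] by blast
    have "card A \<le> 3" "card B \<le> 3" "card C \<le> 3"
      using card_mono[OF finT P(2)] card_mono[OF finT P(3)] card_mono[OF finT C] c3 that by auto
    then have "card A = 3" "card B = 3" "card C = 3" using parts_card[OF P(1)] r by linarith+
    then have "A = T x" "B = T y" "C = T z"
      using card_subset_eq[OF finT P(2)] card_subset_eq[OF finT P(3)] card_subset_eq[OF finT C] c3 that by auto
    then show "R = T x \<union> T y \<union> T z" "T x \<inter> T y = {}" using P(1) unfolding parts_def by auto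
  qed
  have 1: "R = T u \<union> T v \<union> T w" "T p \<inter> T v = {}" "T p \<inter> T w = {}" "T p \<inter> T u = {}"
    using part(1)[of p u v w] part(2)[of u p v w] part(2)[of u p w v] part(2)[of v p u w] I ne t by auto
  then have "T p = {}" using T_sub[OF I(1)] by blast
  then show False using c3[OF I(1) t(1)] by simp
qed

end

section \<open>Counting the edges inside \<open>R\<close>\<close>

context view_system begin

definition dg :: "'a \<Rightarrow> nat" where "dg x = card {y\<in>R. E x y}"
definition m :: "'a \<Rightarrow> nat" where "m x = card {p\<in>I. x \<in> T p}"

lemma dg_eq: "x \<in> R \<Longrightarrow> dg x + card I + t x = 6 + m x"
  using deg unfolding dg_def m_def .

lemma sum_m: "sum m R + 6 * card I = card I * card R + sum t I"
proof -
  have "sum m R = (\<Sum>x\<in>R. \<Sum>p\<in>I. of_bool (x \<in> T p))"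
    unfolding m_def using finI by (intro sum.cong) (auto simp: sum.If_cases of_bool_def Int_def)
  also have "\<dots> = (\<Sum>p\<in>I. \<Sum>x\<in>R. of_bool (x \<in> T p))" by (rule sum.swap)
  also have "\<dots> = (\<Sum>p\<in>I. card (T p))"
  proof (intro sum.cong refl)
    fix p assume "p \<in> I"
    then have "R \<inter> {x. x \<in> T p} = T p" using T_sub by auto
    then show "(\<Sum>x\<in>R. of_bool (x \<in> T p)) = card (T p)"
      using finR by (simp add: of_bool_def sum.If_cases)
  qed
  finally have "sum m R + 6 * card I = (\<Sum>p\<in>I. card (T p) + 6)" by (simp add: sum.distrib)
  also have "\<dots> = (\<Sum>p\<in>I. card R + t p)" using T_card by (intro sum.cong) auto
  finally show ?thesis by (simp add: sum.distrib)
qed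

text \<open>The number of edges inside \<open>R\<close> depends only on \<open>card R\<close>,
  \<open>card I\<close> and the cut edges at \<open>I\<close>. The edge arguments contradict this
  value by means of \<open>cover_bound\<close>, where a small set meets all edges.\<close>

lemma sum_dg: "sum dg R + 6 * card I + 6 = 6 * card R + 2 * sum t I"
proof -
  have "(\<Sum>x\<in>R. dg x + card I + t x) = (\<Sum>x\<in>R. 6 + m x)" using dg_eq by (intro sum.cong) auto
  then have "sum dg R + card R * card I + sum t R = 6 * card R + sum m R" by (simp add: sum.distrib)
  then show ?thesis using sum_m tot by (simp add: mult.commute)
qed

lemma dg_swap:
  assumes "X \<subseteq> R" "Y \<subseteq> R"
  shows "(\<Sum>x\<in>X. card {y\<in>Y. E x y}) = (\<Sum>y\<in>Y. card {x\<in>X. E y x})"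
proof -
  have fX: "finite X" and fY: "finite Y" using assms finR finite_subset by blast+
  have "(\<Sum>x\<in>X. card {y\<in>Y. E x y}) = (\<Sum>x\<in>X. \<Sum>y\<in>Y. of_bool (E x y))"
    using fY by (intro sum.cong) (auto simp: sum.If_cases of_bool_def Int_def)
  also have "\<dots> = (\<Sum>y\<in>Y. \<Sum>x\<in>X. of_bool (E x y))" by (rule sum.swap)
  also have "\<dots> = (\<Sum>y\<in>Y. card {x\<in>X. E y x})"
    using fX E_sym by (intro sum.cong refl) (auto simp: sum.If_cases of_bool_def Int_def intro!: arg_cong[of _ _ card])
  finally show ?thesis .
qed

lemma cover_bound:
  assumes S: "S \<subseteq> R" and ind: "indep (R - S)"
  shows "sum dg R \<le> 2 * sum dg S"
proof -
  have f: "finite S" using S finR finite_subset by blast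
  have "sum dg (R - S) = (\<Sum>x\<in>R - S. card {y\<in>S. E x y})"
  proof (intro sum.cong refl)
    fix x assume "x \<in> R - S"
    then have "{y\<in>R. E x y} = {y\<in>S. E x y}" using ind S by (auto simp: indep_def)
    then show "dg x = card {y\<in>S. E x y}" by (simp add: dg_def)
  qed
  also have "\<dots> = (\<Sum>y\<in>S. card {x\<in>R - S. E y x})" using S by (intro dg_swap) auto
  also have "\<dots> \<le> sum dg S"
    unfolding dg_def using finR by (intro sum_mono card_mono) auto
  finally have "sum dg (R - S) \<le> sum dg S" .
  moreover have "sum dg R = sum dg S + sum dg (R - S)"
    using sum.subset_diff[OF S finR, of dg] by simp
  ultimately show ?thesis by simp
qed

lemma indep_sub: "indep X \<Longrightarrow> Y \<subseteq> X \<Longrightarrow> indep Y"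
  unfolding indep_def by blast

lemma parts_indep:
  assumes "parts p A B C" shows "indep A" "indep B" "indep C"
  using assms unfolding parts_def by auto

text \<open>By \<open>sum_dg\<close>, the hypothesis \<open>edges\<close> says that
  \<open>sum dg R\<close> exceeds 12. The views of \<open>p\<close> and \<open>q\<close> both leave
  the four elements outside \<open>T u\<close> and \<open>T v\<close> to the third part. Together
  with the view of one of \<open>u\<close>, \<open>v\<close> they make the complement of the pair
  \<open>T v'\<close> independent, where \<open>v'\<close> is the other choice or the same one after
  a swap. Both elements of \<open>T v'\<close> have degree at most 3, so \<open>sum dg R\<close> is
  at most 12.\<close>

lemma rule_8_22:
  assumes r: "card R = 8" and I: "u \<in> I" "v \<in> I" "p \<in> I" "q \<in> I"
    and ne: "u \<noteq> v" "p \<noteq> q"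
    and t: "t u = 0" "t v = 0" "t p = 1" "t q = 1"
    and edges: "3 * card I < 15 + sum t I" shows False
proof -
  have ne': "u \<noteq> p" "u \<noteq> q" "v \<noteq> p" "v \<noteq> q" using t by auto
  have dis: "T u \<inter> T v = {}" using int_disjoint[of u v] r I ne t by simp
  have cT: "card (T u) = 2" "card (T v) = 2" "card (T p) = 3" "card (T q) = 3"
    using T_card I t r by force+
  note fin = finT[OF I(1)] finT[OF I(2)] finT[OF I(3)] finT[OF I(4)]
  define S where "S = R - T u - T v"
  have finS: "finite S" using finR by (simp add: S_def)
  have cS: "card S = 4"
    unfolding S_def using T_sub I fin dis r cT
    by (subst card_Diff_subset; (subst card_Diff_subset)?) (auto simp: Diff_eq)
  have dS: "S \<inter> T u = {}" "S \<inter> T v = {}" by (auto simp: S_def)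
  \<comment> \<open>Every view of a member with \<open>t = 1\<close> separates \<open>T u\<close>, \<open>T v\<close> and puts \<open>S\<close> into the third part.\<close>
  have big: "S \<subseteq> C" "2 \<le> card (S \<inter> T x)" "\<not> C \<subseteq> T y"
    if P: "parts x A B C" "A \<subseteq> T u \<union> T v" "B \<subseteq> T u \<union> T v" and x: "x \<in> {p, q}" "y \<in> {p, q}" for x y A B C
  proof -
    show SC: "S \<subseteq> C" using P unfolding parts_def S_def by blast
    have "card (S - T x) \<le> card (C - T x)" using SC parts_fin[OF P(1)] by (intro card_mono) auto
    also have "\<dots> \<le> 2" using P(1) unfolding parts_def by blast
    finally have "card (S - T x) \<le> 2" .
    moreover have "card S = card (S - T x) + card (S \<inter> T x)"
      using finS by (metis Int_Diff_disjoint Int_Diff_Un card_Un_disjoint finite_Diff finite_Int add.commute)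
    ultimately show "2 \<le> card (S \<inter> T x)" using cS by simp
    show "\<not> C \<subseteq> T y"
    proof
      assume "C \<subseteq> T y"
      then have "card C \<le> 3" using x cT fin card_mono by (metis empty_iff insert_iff)
      then show False using card_mono[OF parts_fin(3)[OF P(1)] SC] cS by simp
    qed
  qed
  have one: "card (A \<inter> T y) \<le> 1" if "A \<subseteq> T u \<union> T v" "y \<in> {p, q}" "2 \<le> card (S \<inter> T y)" for A y
  proof -
    have fy: "finite (T y)" "card (T y) = 3" using that(2) fin cT by auto
    have "card (A \<inter> T y) + card (S \<inter> T y) = card ((A \<inter> T y) \<union> (S \<inter> T y))"
      using fy that(1) dS by (intro card_Un_disjoint[symmetric]) auto
    also have "\<dots> \<le> card (T y)" using fy by (intro card_mono) auto
    finally show ?thesis using that(3) fy by simp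
  qed
  \<comment> \<open>The general step, symmetric under \<open>u \<leftrightarrow> v\<close>.\<close>
  have step: False
    if U: "u' \<in> {u, v}" "v' \<in> {u, v}" "u' \<noteq> v'" and P: "parts p A B C" "A \<subseteq> T u'" "B \<subseteq> T v'" "A \<subseteq> T q" for u' v' A B C
  proof -
    have I': "u' \<in> I" "v' \<in> I" "t u' = 0" "t v' = 0" "u' \<noteq> p" "u' \<noteq> q" "v' \<noteq> p" "v' \<noteq> q" using U I t ne' by auto
    have c': "card (T u') = 2" "card (T v') = 2" "T u' \<inter> T v' = {}" using U cT dis by auto
    have UV: "T u' \<union> T v' = T u \<union> T v" using U by auto
    obtain A' B' C' where P': "parts q A' B' C'" "A' \<subseteq> T u'" "B' \<subseteq> T v'"
    proof -
      obtain X Y Z where "parts q X Y Z" using parts_exist[OF I(4)] .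
      then show ?thesis using distinct_parts[of q X Y Z u' v'] that I(4) t I' c' by auto
    qed
    have Sp: "2 \<le> card (S \<inter> T p)" "S \<subseteq> C" using big(1,2)[OF P(1), of q] P(2,3) UV by auto
    have Sq: "2 \<le> card (S \<inter> T q)" "S \<subseteq> C'" using big(1,2)[OF P'(1), of p] P'(2,3) UV by auto
    have nC': "\<not> C' \<subseteq> T p" using big(3)[OF P'(1), of p] P'(2,3) UV by auto
    have posA: "A - T p \<noteq> {}" "A' - T q \<noteq> {}" "B' - T q \<noteq> {}"
      using part_pos[OF P(1)] part_pos[OF P'(1)] part_pos[OF parts_12[OF P'(1)]] I t by auto
    \<comment> \<open>\<open>T q\<close> has three elements, at least two of them in
      \<open>S\<close>, and \<open>A\<close> avoids \<open>S\<close>.\<close>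
    have "card (A \<inter> T q) \<le> 1" using one[of A q] P(2) UV Sq(1) by auto
    then have cA: "card A \<le> 1" using P(4) by (simp add: Int_absorb2)
    have exact: "Y = T v'" "card (Y - T x) = 2" if Q: "parts x X Y Z" "Y \<subseteq> T v'" "card X \<le> 1" "x \<in> I" "t x = 1" for x X Y Z
    proof -
      have "card (X - T x) \<le> 1" using Q(3) parts_fin[OF Q(1)] card_mono[of X "X - T x"] by auto
      moreover have "card (Y - T x) \<le> 2" "card (Z - T x) \<le> 2" using Q(1) unfolding parts_def by auto
      ultimately show c2: "card (Y - T x) = 2" using parts_K[OF Q(1,4)] Q(5) by linarith
      have "card Y \<ge> 2" using c2 parts_fin[OF Q(1)] card_mono[of Y "Y - T x"] by auto
      then show "Y = T v'" using card_seteq[OF finT[OF I'(2)] Q(2)] c'(2) by simp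
    qed
    have B: "B = T v'" "T v' \<inter> T p = {}"
    proof -
      show B: "B = T v'" using exact(1)[OF P(1,3) cA I(3) t(3)] .
      have "card (T v' - T p) = card (T v')" using exact(2)[OF P(1,3) cA I(3) t(3)] B c' by simp
      then show "T v' \<inter> T p = {}" using finT[OF I'(2)] card_subset_eq[of "T v'" "T v' - T p"] by auto
    qed
    have "\<not> B' \<subseteq> T p" using posA(3) P'(3) B(2) by blast
    then have A'p: "A' \<subseteq> T p" using parts_in[OF P'(1) I(3)] nC' ne by auto
    have AA': "A \<inter> A' = {}" 
    proof -
      have "card A = 1" using cA posA(1) parts_fin[OF P(1)] by (metis One_nat_def Suc_leI card_gt_0_iff le_antisym Diff_empty Diff_mono card_0_eq empty_subsetI finite.emptyI subset_empty Diff_eq_empty_iff)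
      then obtain x where "A = {x}" by (auto simp: card_1_singleton_iff)
      then show ?thesis using posA(1) A'p by auto
    qed
    have "card (A' \<inter> T p) \<le> 1" using one[of A' p] P'(2) UV Sp(1) by auto
    then have cA': "card A' \<le> 1" using A'p by (simp add: Int_absorb2)
    have B': "B' = T v'" using exact(1)[OF P'(1,3) cA' I(4) t(4)] .
    have C: "C = S \<union> (T u' - A)" "C' = S \<union> (T u' - A')"
    proof -
      have R: "R = S \<union> T u' \<union> T v'" using T_sub[OF I(1)] T_sub[OF I(2)] UV by (auto simp: S_def)
      have S: "S \<inter> T u' = {}" "S \<inter> T v' = {}" using dS UV by auto
      have "C = R - A - B" "C' = R - A' - B'" using P(1) P'(1) unfolding parts_def by blast+
      then show "C = S \<union> (T u' - A)" "C' = S \<union> (T u' - A')" using R S B(1) B' c'(3) P(2) P'(2) by blast+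
    qed
    obtain X Y Z where W: "parts v' X Y Z" "X \<subseteq> T u'" using parts_at[OF I'(2,1) U(3)] .
    have "X = T u'"
    proof -
      have "2 \<le> card (X - T v')" using parts_K1(1)[OF W(1) I'(2)] I' by simp
      also have "\<dots> \<le> card X" using parts_fin[OF W(1)] by (intro card_mono) auto
      finally show ?thesis using card_seteq[OF finT[OF I'(1)] W(2)] c'(1) by simp
    qed
    then have iu: "indep (T u')" using parts_indep[OF W(1)] by simp
    \<comment> \<open>The singletons \<open>A\<close> and \<open>A'\<close> are disjoint, so each
      element of \<open>T u'\<close> lies with all of \<open>S\<close> in \<open>C\<close> or in
      \<open>C'\<close>.\<close>
    have "indep (S \<union> T u')"
      using iu parts_indep(3)[OF P(1)] parts_indep(3)[OF P'(1)] AA' P(2) P'(2)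
      unfolding C indep_def by blast
    moreover have "R - T v' = S \<union> T u'"
      using T_sub[OF I(1)] T_sub[OF I(2)] UV c'(3) dS by (auto simp: S_def)
    ultimately have "sum dg R \<le> 2 * sum dg (T v')" using cover_bound[OF T_sub[OF I'(2)]] by simp
    moreover have "dg z \<le> 3" if z: "z \<in> T v'" for z
    proof -
      have "z \<notin> T u'" "z \<notin> T p" using z c'(3) B(2) by auto
      moreover have "z \<notin> T q"
      proof
        assume "z \<in> T q"
        then have "card (insert z A) \<le> 1" using one[of "insert z A" q] P(2,4) UV Sq(1) z by (auto simp: Int_absorb2)
        moreover have "z \<notin> A" using z c'(3) P(2) by auto
        ultimately show False using parts_fin[OF P(1)] posA by auto
      qed
      ultimately have "{x\<in>I. z \<in> T x} \<subseteq> I - {u', p, q}" by auto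
      then have "m z \<le> card (I - {u', p, q})" unfolding m_def using finI by (intro card_mono) auto
      also have "\<dots> = card I - 3" using finI I I' ne by (subst card_Diff_subset) auto
      finally have "m z + 3 \<le> card I"
        using card_mono[OF finI, of "{u', p, q}"] I I' ne by auto
      then show ?thesis using dg_eq[of z] T_sub[OF I'(2)] z by auto
    qed
    ultimately have "sum dg R \<le> 12" using sum_bounded_above[of "T v'" dg 3] c'(2) by auto
    then show False using sum_dg edges r by simp
  qed
  obtain X Y Z where "parts p X Y Z" using parts_exist[OF I(3)] .
  then obtain A B C where P: "parts p A B C" "A \<subseteq> T u" "B \<subseteq> T v"
    using distinct_parts[of p X Y Z u v] I t ne' dis by auto
  have "\<not> C \<subseteq> T q" using big(3)[OF P(1), of q] P by auto
  then have "A \<subseteq> T q \<or> B \<subseteq> T q" using parts_in[OF P(1) I(4)] ne by auto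
  then show False
    using step[of u v A B C] step[of v u B A C] P parts_12[OF P(1)] ne by auto
qed

end

text \<open>A bipartite subgraph of the octahedron, with opposite pairs \<open>a a'\<close>,
  \<open>b b'\<close>, \<open>c c'\<close>, has at most 8 of its 12 edges; the sum counts every edge
  twice.\<close>

lemma octahedron_cut:
  fixes a a' b b' c c' :: bool
  defines "d \<equiv> \<lambda>x y. of_bool (x \<noteq> y) :: nat"
  shows "(d a b + d a b' + d a c + d a c') + (d a' b + d a' b' + d a' c + d a' c')
       + (d b a + d b a' + d b c + d b c') + (d b' a + d b' a' + d b' c + d b' c')
       + (d c a + d c a' + d c b + d c b') + (d c' a + d c' a' + d c' b + d c' b') \<le> 16"
  unfolding d_def by (cases a; cases a'; cases b; cases b'; cases c; cases c') simp_all

lemma card_filter_sum: "finite S \<Longrightarrow> card {y\<in>S. P y} = (\<Sum>y\<in>S. of_bool (P y))"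
  by (simp add: sum.If_cases of_bool_def Int_def)

lemma card_split: "finite X \<Longrightarrow> card X = card (X - Y) + card (X \<inter> Y)"
  by (metis Int_Diff_Un Int_Diff_disjoint add.commute card_Un_disjoint finite_Diff finite_Int)

context view_system begin

lemma exact_part:
  assumes P: "parts p A B C" and I: "p \<in> I" "u \<in> I" and t: "t p = 0" and c: "card (T u) = 2" "A \<subseteq> T u"
  shows "A = T u"
proof -
  have "2 \<le> card (A - T p)" using parts_K1(1)[OF P I(1)] t by simp
  also have "\<dots> \<le> card A" using parts_fin[OF P] by (intro card_mono) auto
  finally show ?thesis using card_seteq[OF finT[OF I(2)] c(2)] c(1) by simp
qed

text \<open>The three sets \<open>T\<close> are disjoint pairs, and the view of each of
  \<open>u\<close>, \<open>v\<close>, \<open>w\<close> has the pairs of the other two as parts. So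
  the complement of any two pairs is independent, and all edges of \<open>R\<close> belong to the
  octahedron on the three pairs. As \<open>R\<close> is bipartite, \<open>octahedron_cut\<close>
  bounds their number.\<close>

lemma rule_8_bip:
  assumes r: "card R = 8" and I: "u \<in> I" "v \<in> I" "w \<in> I" and ne: "u \<noteq> v" "u \<noteq> w" "v \<noteq> w"
    and t: "t u = 0" "t v = 0" "t w = 0" and tI: "sum t I + 6 = 2 * card I"
    and bip: "\<And>x y. x \<in> R \<Longrightarrow> y \<in> R \<Longrightarrow> E x y \<Longrightarrow> f x \<noteq> (f y :: bool)"
  shows False
proof -
  have c2: "card (T x) = 2" if "x \<in> I" "t x = 0" for x using T_card[OF that(1)] that(2) r by simp
  have dis: "T u \<inter> T v = {}" "T u \<inter> T w = {}" "T v \<inter> T w = {}"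
    using int_disjoint[of u v] int_disjoint[of u w] int_disjoint[of v w] r I ne t by auto
  have ind: "indep (R - T y - T z)"
    if h: "x \<in> I" "y \<in> I" "z \<in> I" "x \<noteq> y" "x \<noteq> z" "t x = 0" "t y = 0" "t z = 0" "T y \<inter> T z = {}" for x y z
  proof -
    obtain X Y Z where Q: "parts x X Y Z" using parts_exist[OF h(1)] .
    obtain A B C where P: "parts x A B C" "A \<subseteq> T y" "B \<subseteq> T z"
      using distinct_parts[OF Q h(1) _ h(2,3) _ _ h(9)] h by auto
    have "A = T y" "B = T z"
      using exact_part[OF P(1) h(1,2)] exact_part[OF parts_12[OF P(1)] h(1,3)] P c2 h by auto
    then have "C = R - T y - T z" using P(1) unfolding parts_def by blast
    then show ?thesis using parts_indep(3)[OF P(1)] by simp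
  qed
  have i: "indep (R - T v - T w)" "indep (R - T u - T w)" "indep (R - T u - T v)"
    using ind[of u v w] ind[of v u w] ind[of w u v] I ne t dis by auto
  obtain a1 a2 where U: "T u = {a1, a2}" "a1 \<noteq> a2" using c2[OF I(1) t(1)] by (auto simp: card_2_iff)
  obtain b1 b2 where V: "T v = {b1, b2}" "b1 \<noteq> b2" using c2[OF I(2) t(2)] by (auto simp: card_2_iff)
  obtain d1 d2 where W: "T w = {d1, d2}" "d1 \<noteq> d2" using c2[OF I(3) t(3)] by (auto simp: card_2_iff)
  have sub: "{a1, a2, b1, b2, d1, d2} \<subseteq> R" using T_sub[OF I(1)] T_sub[OF I(2)] T_sub[OF I(3)] U V W by simp
  have dist: "distinct [a1, a2, b1, b2, d1, d2]" using U V W dis by auto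
  have bound: "dg x \<le> of_bool (f x \<noteq> f y1) + of_bool (f x \<noteq> f y2) + of_bool (f x \<noteq> f y3) + of_bool (f x \<noteq> f y4)"
    if "x \<in> R" "{y\<in>R. E x y} \<subseteq> {y1, y2, y3, y4}" "distinct [y1, y2, y3, y4]" "{y1, y2, y3, y4} \<subseteq> R" for x y1 y2 y3 y4
  proof -
    have "{y\<in>R. E x y} \<subseteq> {y\<in>{y1, y2, y3, y4}. f x \<noteq> f y}" using that bip by auto
    then have "dg x \<le> card {y\<in>{y1, y2, y3, y4}. f x \<noteq> f y}" unfolding dg_def by (intro card_mono) auto
    also have "\<dots> = (\<Sum>y\<in>{y1, y2, y3, y4}. of_bool (f x \<noteq> f y))"
      by (rule card_filter_sum) simp
    also have "\<dots> = of_bool (f x \<noteq> f y1) + of_bool (f x \<noteq> f y2) + of_bool (f x \<noteq> f y3) + of_bool (f x \<noteq> f y4)"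
      using that(3) by simp
    finally show ?thesis .
  qed
  have nb: "{y\<in>R. E x y} \<subseteq> T v \<union> T w" if "x \<in> T u" for x using i that dis sub U by (auto simp: indep_def)
  have nb': "{y\<in>R. E x y} \<subseteq> T u \<union> T w" if "x \<in> T v" for x using i that dis sub V by (auto simp: indep_def)
  have nb'': "{y\<in>R. E x y} \<subseteq> T u \<union> T v" if "x \<in> T w" for x using i that dis sub W by (auto simp: indep_def)
  have iso: "dg x = 0" if "x \<in> R - (T u \<union> T v \<union> T w)" for x
  proof -
    have "{y\<in>R. E x y} = {}" using i that dis unfolding indep_def by blast
    then show ?thesis unfolding dg_def by (simp only: card.empty)
  qed
  have "sum dg R = sum dg {a1, a2, b1, b2, d1, d2}"
    using sub iso U V W finR by (intro sum.mono_neutral_right) auto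
  also have "\<dots> = dg a1 + dg a2 + dg b1 + dg b2 + dg d1 + dg d2" using dist by simp
  also have "\<dots> \<le> 16"
  proof -
    have R6: "a1 \<in> R" "a2 \<in> R" "b1 \<in> R" "b2 \<in> R" "d1 \<in> R" "d2 \<in> R" using sub by auto
    have "dg a1 \<le> of_bool (f a1 \<noteq> f b1) + of_bool (f a1 \<noteq> f b2) + of_bool (f a1 \<noteq> f d1) + of_bool (f a1 \<noteq> f d2)"
      using nb[of a1] U V W R6 dist by (intro bound) auto
    moreover have "dg a2 \<le> of_bool (f a2 \<noteq> f b1) + of_bool (f a2 \<noteq> f b2) + of_bool (f a2 \<noteq> f d1) + of_bool (f a2 \<noteq> f d2)"
      using nb[of a2] U V W R6 dist by (intro bound) auto
    moreover have "dg b1 \<le> of_bool (f b1 \<noteq> f a1) + of_bool (f b1 \<noteq> f a2) + of_bool (f b1 \<noteq> f d1) + of_bool (f b1 \<noteq> f d2)"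
      using nb'[of b1] U V W R6 dist by (intro bound) auto
    moreover have "dg b2 \<le> of_bool (f b2 \<noteq> f a1) + of_bool (f b2 \<noteq> f a2) + of_bool (f b2 \<noteq> f d1) + of_bool (f b2 \<noteq> f d2)"
      using nb'[of b2] U V W R6 dist by (intro bound) auto
    moreover have "dg d1 \<le> of_bool (f d1 \<noteq> f a1) + of_bool (f d1 \<noteq> f a2) + of_bool (f d1 \<noteq> f b1) + of_bool (f d1 \<noteq> f b2)"
      using nb''[of d1] U V W R6 dist by (intro bound) auto
    moreover have "dg d2 \<le> of_bool (f d2 \<noteq> f a1) + of_bool (f d2 \<noteq> f a2) + of_bool (f d2 \<noteq> f b1) + of_bool (f d2 \<noteq> f b2)"
      using nb''[of d2] U V W R6 dist by (intro bound) auto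
    ultimately show ?thesis
      using octahedron_cut[where a = "f a1" and a' = "f a2" and b = "f b1" and b' = "f b2" and c = "f d1" and c' = "f d2"]
      by linarith
  qed
  finally have "sum dg R \<le> 16" .
  \<comment> \<open>With \<open>tI\<close>, the count in \<open>sum_dg\<close> becomes
    \<open>sum dg R = 24 - sum t I\<close>, which is at least 18.\<close>
  moreover have "sum t I \<le> 6" using tot by simp
  ultimately show False using sum_dg tI r by linarith
qed

end

section \<open>Eight elements, one member without cut edges and four with one cut edge each\<close>

locale view_8_14 = view_system +
  fixes v
  assumes r8: "card R = 8" and n5: "card I = 5" and vI: "v \<in> I" and tv: "t v = 0"
    and tp: "p \<in> I - {v} \<Longrightarrow> t p = 1"
begin

lemma cv: "card (T v) = 2" using T_card[OF vI] tv r8 by simp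

lemma cp: "p \<in> I - {v} \<Longrightarrow> card (T p) = 3" using T_card[of p] tp[of p] r8 by auto

lemma sum20: "sum dg R = 20"
proof -
  have "sum t I = t v + sum t (I - {v})" using sum.remove[OF finI vI] .
  also have "\<dots> = 4" using tp tv n5 vI finI by simp
  finally show ?thesis using sum_dg r8 n5 by simp
qed

lemma meet_v:
  assumes "p \<in> I - {v}" shows "card (T p \<inter> T v) \<le> 1"
proof -
  have "2 \<le> card (T p - T v)" using diff_card[of v p] assms vI tv by simp
  moreover have "card (T p) = card (T p - T v) + card (T p \<inter> T v)"
    using finT assms card_split by blast
  ultimately show ?thesis using cp[OF assms] by simp
qed

text \<open>Distinct triples \<open>T b\<close>, \<open>T c\<close> share just \<open>A\<close>,
  which lies in \<open>T a\<close>. In the view of \<open>a\<close> every part leaves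
  \<open>T a\<close>, so \<open>b\<close> and \<open>c\<close> have different parts. Each of the two
  holds at most one neighbour of \<open>a\<close>, which leaves at most 4 neighbours in place of
  5.\<close>

lemma no_sunflower:
  assumes I: "a \<in> I - {v}" "b \<in> I - {v}" "c \<in> I - {v}" and ne: "a \<noteq> b" "a \<noteq> c" "b \<noteq> c"
    and A: "A \<subseteq> T a" "A \<subseteq> T b" "A \<subseteq> T c" "2 \<le> card A"
  shows False
proof -
  have fin: "finite (T a)" "finite (T b)" "finite (T c)" using finT I by auto
  have small: "card (T x - T a) \<le> 1" if "x \<in> {b, c}" for x
  proof -
    have "card (T x - T a) \<le> card (T x - A)" using that fin A by (intro card_mono) auto
    also have "\<dots> = card (T x) - card A" using that fin A by (intro card_Diff_subset) (auto intro: finite_subset)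
    finally show ?thesis using that A(4) cp I by auto
  qed
  have bc: "T b \<inter> T c \<subseteq> A"
  proof -
    have "T b \<noteq> T c" using T_neq[of c b] I ne tp by auto
    then have "T b \<inter> T c \<noteq> T b" using card_subset_eq[OF fin(3), of "T b"] cp I by auto
    then have "T b \<inter> T c \<subset> T b" by blast
    then have "card (T b \<inter> T c) < card (T b)" by (rule psubset_card_mono[OF fin(2)])
    then have "card (T b \<inter> T c) < 3" using cp[OF I(2)] by simp
    moreover have "A \<subseteq> T b \<inter> T c" using A by blast
    ultimately have "A = T b \<inter> T c" using card_seteq[of "T b \<inter> T c" A] fin A(4) by simp
    then show ?thesis by simp
  qed
  have aI: "a \<in> I" "t a \<le> 1" "b \<in> I" "b \<noteq> a" "c \<in> I" "c \<noteq> a" using I tp ne by auto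
  obtain X Y Z where P: "parts a X Y Z" "X \<subseteq> T b" using parts_at[OF aI(1,3,4)] .
  have "\<not> X \<subseteq> T c" using P bc A(1) part_pos[OF P(1) aI(1,2)] by blast
  then obtain X Y Z where P: "parts a X Y Z" "X \<subseteq> T b" "Y \<subseteq> T c"
    using parts_in[OF P(1) aI(5,6)] P parts_23 by blast
  have "card (X - T a) \<le> card (T b - T a)" "card (Y - T a) \<le> card (T c - T a)"
    using P fin by (auto intro!: card_mono)
  moreover have "card (Z - T a) \<le> 2" using P(1) unfolding parts_def by blast
  ultimately show False using parts_K[OF P(1) aI(1)] small[of b] small[of c] tp[OF I(1)] by simp
qed

lemma three_others:
  assumes "p \<in> I - {v}"
  obtains q1 q2 q3 where "I = {v, p, q1, q2, q3}" "distinct [v, p, q1, q2, q3]"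
proof -
  have "card (I - {v, p}) = 3" using assms n5 vI finI by (subst card_Diff_subset) auto
  then obtain q1 q2 q3 where q: "I - {v, p} = {q1, q2, q3}" "q1 \<noteq> q2" "q1 \<noteq> q3" "q2 \<noteq> q3"
    by (auto simp: card_3_iff)
  then have "I = {v, p, q1, q2, q3}" "distinct [v, p, q1, q2, q3]" using assms vI by auto
  then show ?thesis using that by blast
qed

text \<open>Suppose that all parts have at least two elements. Then \<open>T v\<close> is a part,
  and no other triple contains it, by \<open>meet_v\<close>. The remaining parts have sizes 2 and 4,
  or 3 and 3, and serve three triples: either the part of size 2 lies in all three, against
  \<open>no_sunflower\<close>, or two triples equal the same part. Given a singleton part, the other
  sizes add up to 7, so they differ.\<close>

lemma singleton_part:
  assumes p: "p \<in> I - {v}"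
  obtains x A B where "parts p {x} A B" "x \<notin> T p" "card (A - T p) = 2" "card (B - T p) = 2" "card A < card B"
proof -
  have pI: "p \<in> I" "t p = 1" "v \<noteq> p" using p tp by auto
  have fin: "parts p X Y Z \<Longrightarrow> finite X" for X Y Z using parts_fin by blast
  have "\<exists>X Y Z. parts p X Y Z \<and> card X = 1"
  proof (rule ccontr)
    assume no: "\<not> ?thesis"
    have ge2: "2 \<le> card X" if "parts p X Y Z" for X Y Z
    proof -
      have "X \<noteq> {}" using part_pos[OF that pI(1)] pI(2) by auto
      then have "card X \<noteq> 0" using fin[OF that] by simp
      then show ?thesis using no that by (metis One_nat_def Suc_1 Suc_leI le_neq_implies_less not_gr_zero)
    qed
    obtain X Y Z where P: "parts p X Y Z" "X \<subseteq> T v" using parts_at[OF pI(1) vI pI(3)] .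
    have cX: "card X = 2" using ge2[OF P(1)] card_mono[OF finT[OF vI] P(2)] cv by simp
    have six: "card Y + card Z = 6" "2 \<le> card Y" "2 \<le> card Z"
      using parts_card[OF P(1)] cX r8 ge2[OF parts_12[OF P(1)]] ge2[OF parts_13[OF P(1)]] by auto
    obtain q1 q2 q3 where q: "I = {v, p, q1, q2, q3}" "distinct [v, p, q1, q2, q3]" using three_others[OF p] .
    have inYZ: "Y \<subseteq> T q \<or> Z \<subseteq> T q" if "q \<in> {q1, q2, q3}" for q
    proof -
      have "q \<in> I - {v}" "q \<noteq> p" using that q by auto
      moreover have "\<not> X \<subseteq> T q"
      proof
        assume "X \<subseteq> T q"
        then have "card X \<le> card (T q \<inter> T v)" using P(2) finT[OF vI] by (intro card_mono) auto
        then show False using meet_v[of q] \<open>q \<in> I - {v}\<close> cX by simp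
      qed
      ultimately show ?thesis using parts_in[OF P(1)] by blast
    qed
    have qI: "q1 \<in> I - {v}" "q2 \<in> I - {v}" "q3 \<in> I - {v}" using q by auto
    have big: "\<not> U \<subseteq> T q" if "4 \<le> card U" "q \<in> I - {v}" for U q
      using that(1) cp[OF that(2)] card_mono[OF finT[of q], of U] that(2) by auto
    have two: False if "3 \<le> card U" "U \<subseteq> T a" "U \<subseteq> T b" "a \<in> I - {v}" "b \<in> I - {v}" "a \<noteq> b" for U a b
    proof -
      have "U = T a" using card_seteq[OF finT that(2)] that cp by auto
      moreover have "U = T b" using card_seteq[OF finT that(3)] that cp by auto
      ultimately have "T a = T b" by simp
      then show False using T_neq[of a b] that tp by auto
    qed
    have main: False if "card U \<le> card U'" "\<And>q. q \<in> {q1, q2, q3} \<Longrightarrow> U \<subseteq> T q \<or> U' \<subseteq> T q" "card U + card U' = 6" "2 \<le> card U" for U U'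
    proof (cases "card U = 2")
      case True
      then have "U \<subseteq> T q1" "U \<subseteq> T q2" "U \<subseteq> T q3" using that(2)[of q1] that(2)[of q2] that(2)[of q3] that(3) big[of U'] qI by auto
      then show False using no_sunflower[OF qI] q(2) that(4) by auto
    next
      case False
      then have "3 \<le> card U" "3 \<le> card U'" using that by auto
      then show False
        using that(2)[of q1] that(2)[of q2] that(2)[of q3] two[of U q1 q2] two[of U q1 q3] two[of U q2 q3]
          two[of U' q1 q2] two[of U' q1 q3] two[of U' q2 q3] qI q(2) by auto
    qed
    show False using main[of Y Z] main[of Z Y] inYZ six by (metis add.commute nat_le_linear)
  qed
  then obtain X Y Z where P: "parts p X Y Z" "card X = 1" by blast
  then obtain x where x: "X = {x}" by (auto simp: card_1_singleton_iff)
  have xT: "x \<notin> T p" using part_pos[OF P(1) pI(1)] pI(2) x by auto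
  have "X - T p = {x}" using x xT by blast
  then have "card (X - T p) = 1" by simp
  moreover have "card (Y - T p) \<le> 2" "card (Z - T p) \<le> 2" using P(1) unfolding parts_def by auto
  ultimately have K: "card (Y - T p) = 2" "card (Z - T p) = 2" using parts_K[OF P(1) pI(1)] pI(2) by auto
  have "card Y + card Z = 7" using parts_card[OF P(1)] P(2) r8 by simp
  then have "card Y < card Z \<or> card Z < card Y" by presburger
  then show ?thesis using that P(1) parts_23[OF P(1)] x xT K by blast
qed

end

context view_8_14 begin

text \<open>A vertex cover of the graph on \<open>R\<close> by three neighbours of
  \<open>p\<close>.\<close>

definition cov :: "'a \<Rightarrow> bool" where
  "cov p \<longleftrightarrow> (\<exists>S\<subseteq>R. card S = 3 \<and> S \<inter> T p = {} \<and> indep (R - S))"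

text \<open>An element of degree at least 4 lies in every vertex cover of size 3. If all four covers
  existed, it would be in no \<open>T p\<close> except possibly \<open>T v\<close>, and then
  \<open>dg_eq\<close> makes its degree at most 2. So all degrees are at most 3, and a cover of size
  3 gives \<open>sum dg R \<le> 18\<close>, against \<open>sum20\<close>.\<close>

lemma not_all_cov: "\<exists>p\<in>I - {v}. \<not> cov p"
proof (rule ccontr)
  assume "\<not> ?thesis"
  then have all: "cov p" if "p \<in> I - {v}" for p using that by blast
  have dg3: "dg x \<le> 3" if x: "x \<in> R" for x
  proof (rule ccontr)
    assume big: "\<not> dg x \<le> 3"
    have "x \<notin> T p" if p: "p \<in> I - {v}" for p
    proof -
      obtain S where S: "S \<subseteq> R" "card S = 3" "S \<inter> T p = {}" "indep (R - S)" using all[OF p] unfolding cov_def by blast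
      have "x \<in> S"
      proof (rule ccontr)
        assume "x \<notin> S"
        then have "{y\<in>R. E x y} \<subseteq> S" using S(4) x unfolding indep_def by blast
        then have "dg x \<le> card S" unfolding dg_def using S(1) finR finite_subset by (intro card_mono) auto
        then show False using big S(2) by simp
      qed
      then show ?thesis using S(3) by blast
    qed
    then have "{p\<in>I. x \<in> T p} \<subseteq> {v}" by blast
    then have "m x \<le> 1" unfolding m_def using card_mono[of "{v}"] by fastforce
    then show False using dg_eq[OF x] n5 big by simp
  qed
  have "card (I - {v}) = 4" using n5 vI finI by simp
  then obtain p where "p \<in> I - {v}" by (metis card.empty equals0I zero_neq_numeral)
  then obtain S where S: "S \<subseteq> R" "card S = 3" "indep (R - S)" using all unfolding cov_def by blast
  have "sum dg S \<le> 9" using sum_bounded_above[of S dg 3] dg3 S(1,2) by auto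
  then show False using cover_bound[OF S(1,3)] sum20 by simp
qed

lemma notin2:
  assumes "p \<in> I - {v}" "T v = {y, y'}" "y \<noteq> y'" "y \<in> T p" shows "y' \<notin> T p"
proof
  assume "y' \<in> T p"
  then have "T p \<inter> T v = {y, y'}" using assms by auto
  then show False using meet_v[OF assms(1)] assms(3) by simp
qed

lemma card_large:
  assumes "parts p {x} A B" "card A < card B" shows "4 \<le> card B" "card A \<le> 3"
  using parts_card[OF assms(1)] assms(2) r8 by auto

lemma not_sub_large:
  assumes "4 \<le> card B" "q \<in> I" shows "\<not> B \<subseteq> T q"
proof
  assume "B \<subseteq> T q"
  then have "card B \<le> card (T q)" using finT[OF assms(2)] by (intro card_mono) auto
  then show False using assms cv cp[of q] by (cases "q = v") auto
qed

text \<open>The part inside \<open>T v\<close> has to be the singleton of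
  \<open>singleton_part\<close>: the largest part is too large, and the middle one would equal
  \<open>T v\<close>, which has only one neighbour of \<open>q\<close>. That singleton is a
  neighbour of \<open>q\<close>, hence not \<open>y\<close>.\<close>

lemma port_view:
  assumes q: "q \<in> I - {v}" and y: "y \<in> T q" "T v = {y, y'}" "y \<noteq> y'"
  obtains A B where "parts q {y'} A B" "card (A - T q) = 2" "card A \<le> 3"
    "\<And>r. r \<in> I - {v} \<Longrightarrow> r \<noteq> q \<Longrightarrow> y' \<notin> T r \<Longrightarrow> A \<subseteq> T r"
proof -
  obtain c A B where P: "parts q {c} A B" "c \<notin> T q" "card (A - T q) = 2" "card (B - T q) = 2" "card A < card B"
    using singleton_part[OF q] .
  note L = card_large[OF P(1,5)]
  have qI: "q \<in> I" "v \<noteq> q" using q by auto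
  have "\<not> A \<subseteq> T v"
  proof
    assume A: "A \<subseteq> T v"
    have "card A \<ge> 2" using P(3) parts_fin(2)[OF P(1)] card_mono[of A "A - T q"] by auto
    then have "A = T v" using card_seteq[OF finT[OF vI] A] cv by simp
    then have "A - T q \<subseteq> {y'}" using y by auto
    then have "card (A - T q) \<le> 1" using card_mono[of "{y'}"] by fastforce
    then show False using P(3) by simp
  qed
  then have "c \<in> T v" using parts_in[OF P(1) vI qI(2)] not_sub_large[OF L(1) vI] by auto
  then have c: "c = y'" using y P(2) by auto
  have "A \<subseteq> T r" if "r \<in> I - {v}" "r \<noteq> q" "y' \<notin> T r" for r
    using parts_in[OF P(1), of r] that c not_sub_large[OF L(1), of r] by auto
  then show ?thesis using that P(1,3) L(2) c by blast
qed

text \<open>The middle part in the view of \<open>a\<close> lies in both \<open>T b\<close> and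
  \<open>T c\<close>, and so does \<open>x\<close>. Whether or not \<open>x\<close> belongs to this
  part, three common elements result, so the two triples coincide.\<close>

lemma not_three:
  assumes I: "a \<in> I - {v}" "b \<in> I - {v}" "c \<in> I - {v}" and ne: "a \<noteq> b" "a \<noteq> c" "b \<noteq> c"
    and x: "T v = {x, x'}" "x \<noteq> x'" "x \<in> T a" "x \<in> T b" "x \<in> T c"
  shows False
proof -
  obtain A B where P: "parts a {x'} A B" "card (A - T a) = 2" "card A \<le> 3"
    "\<And>r. r \<in> I - {v} \<Longrightarrow> r \<noteq> a \<Longrightarrow> x' \<notin> T r \<Longrightarrow> A \<subseteq> T r"
    using port_view[OF I(1) x(3,1,2)] by blast
  have A: "A \<subseteq> T b" "A \<subseteq> T c" using P(4)[OF I(2)] P(4)[OF I(3)] notin2[OF I(2) x(1,2,4)] notin2[OF I(3) x(1,2,5)] ne by auto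
  have finA: "finite A" using parts_fin[OF P(1)] by simp
  have c: "card (T b) = 3" "card (T c) = 3" "finite (T b)" "finite (T c)" using cp I finT by auto
  have "T b = T c"
  proof (cases "x \<in> A")
    case False
    have "card A \<ge> 2" using P(2) finA card_mono[of A "A - T a"] by auto
    then have "card (insert x A) \<ge> 3" using False finA by simp
    moreover have "insert x A \<subseteq> T b" "insert x A \<subseteq> T c" using A x by auto
    ultimately show ?thesis
      using card_seteq[OF c(3), of "insert x A"] card_seteq[OF c(4), of "insert x A"] c(1,2) by metis
  next
    case True
    have "A - T a \<subset> A" using True x by auto
    then have "card A \<ge> 3" using P(2) psubset_card_mono[OF finA, of "A - T a"] by simp
    then have "A = T b" "A = T c" using card_seteq[OF c(3) A(1)] card_seteq[OF c(4) A(2)] c by auto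
    then show ?thesis by simp
  qed
  then show False using T_neq[of c b] I ne tp by auto
qed

text \<open>In the view of \<open>a\<close>, the part \<open>{x'}\<close> comes from
  \<open>port_view\<close>. The middle part lies in \<open>T b\<close> and its two neighbours of
  \<open>a\<close> are all of \<open>T b - {x}\<close>. Everything else except possibly
  \<open>x\<close> is in the third part, which is independent.\<close>

lemma two_pairs:
  assumes I: "a \<in> I - {v}" "b \<in> I - {v}" "a \<noteq> b" and x: "T v = {x, x'}" "x \<noteq> x'" "x \<in> T a" "x \<in> T b"
    and F: "F = R - T v - T a - T b"
  shows "(T a - {x}) \<inter> (T b - {x}) = {}" "card (T a - {x}) = 2" "card (T b - {x}) = 2"
    "indep ((T a - {x}) \<union> F)" "indep (insert x (T b - {x})) \<or> indep (insert x ((T a - {x}) \<union> F))"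
    "\<And>r. r \<in> I - {v} \<Longrightarrow> r \<noteq> a \<Longrightarrow> x' \<notin> T r \<Longrightarrow> T b - {x} \<subseteq> T r"
proof -
  obtain A B where P: "parts a {x'} A B" "card (A - T a) = 2" "card A \<le> 3"
    "\<And>r. r \<in> I - {v} \<Longrightarrow> r \<noteq> a \<Longrightarrow> x' \<notin> T r \<Longrightarrow> A \<subseteq> T r"
    using port_view[OF I(1) x(3,1,2)] by blast
  have x'a: "x' \<notin> T a" "x' \<notin> T b" using notin2[OF I(1) x(1,2,3)] notin2[OF I(2) x(1,2,4)] .
  have A: "A \<subseteq> T b" using P(4)[OF I(2)] x'a I by auto
  have f: "finite (T a)" "finite (T b)" "card (T a) = 3" "card (T b) = 3" using finT cp I by auto
  show c2: "card (T a - {x}) = 2" "card (T b - {x}) = 2" using f x by auto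
  have "A - T a \<subseteq> T b - {x}" using A x by auto
  then have eq: "A - T a = T b - {x}" using card_seteq[of "T b - {x}" "A - T a"] f P(2) c2 by simp
  then show dis: "(T a - {x}) \<inter> (T b - {x}) = {}" by blast
  have B: "(T a - {x}) \<union> F \<subseteq> B" 
  proof
    fix z assume z: "z \<in> (T a - {x}) \<union> F"
    then have "z \<in> R" "z \<noteq> x'" "z \<notin> A" using T_sub[of a] I x'a F x A eq dis by auto
    then show "z \<in> B" using P(1) unfolding parts_def by blast
  qed
  show "indep ((T a - {x}) \<union> F)" using indep_sub[OF parts_indep(3)[OF P(1)] B] .
  have "x \<in> A \<or> x \<in> B" using P(1) x T_sub[OF vI] unfolding parts_def by blast
  then show "indep (insert x (T b - {x})) \<or> indep (insert x ((T a - {x}) \<union> F))"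
    using indep_sub[OF parts_indep(2)[OF P(1)], of "insert x (T b - {x})"]
      indep_sub[OF parts_indep(3)[OF P(1)], of "insert x ((T a - {x}) \<union> F)"] B eq by blast
  show "T b - {x} \<subseteq> T r" if "r \<in> I - {v}" "r \<noteq> a" "x' \<notin> T r" for r
    using P(4)[OF that] eq by blast
qed

text \<open>The triples at \<open>x\<close> are \<open>T a\<close>, \<open>T b\<close>, and those at
  \<open>x'\<close> turn out to be \<open>T p\<close>, \<open>T c\<close>. Without \<open>x\<close>
  or \<open>x'\<close> they form two couples of disjoint pairs in the six-element set
  \<open>R - T v\<close>, and the view of \<open>v\<close> forces the pairs to match. In all cases
  the independent sets of \<open>two_pairs\<close> leave fewer than the ten edges of
  \<open>sum20\<close>.\<close>

lemma core:
  assumes I: "I = {v, p, a, b, c}" and ne: "distinct [v, p, a, b, c]"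
    and x: "T v = {x, x'}" "x \<noteq> x'" "x \<in> T a" "x \<in> T b"
    and P: "parts p {x} (T c) B" "card (T c - T p) = 2"
  shows False
proof -
  have I': "p \<in> I - {v}" "a \<in> I - {v}" "b \<in> I - {v}" "c \<in> I - {v}" using I ne by auto
  define F where "F = R - T v - T a - T b"
  note ab = two_pairs[OF I'(2,3) _ x F_def]
  have F': "F = R - T v - T b - T a" by (auto simp: F_def)
  note ba = two_pairs[OF I'(3,2) _ x(1,2,4,3) F']
  define P1 P2 where "P1 = T a - {x}" and "P2 = T b - {x}"
  have dis: "P1 \<inter> P2 = {}" and c12: "card P1 = 2" "card P2 = 2" and i1: "indep (P1 \<union> F)"
    and x1: "indep (insert x P2) \<or> indep (insert x (P1 \<union> F))"
    using ab(1-5) ne unfolding P1_def P2_def by auto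
  have i2: "indep (P2 \<union> F)" and x2: "indep (insert x P1) \<or> indep (insert x (P2 \<union> F))"
    using ba(4,5) ne unfolding P1_def P2_def by auto
  have fin: "finite P1" "finite P2" "finite F" "finite R" using finT I' finR by (auto simp: P1_def P2_def F_def)
  have x'R: "x' \<in> R" "x \<in> R" using T_sub[OF vI] x by auto
  have x'ab: "x' \<notin> T a" "x' \<notin> T b" using notin2[OF I'(2) x(1,2,3)] notin2[OF I'(3) x(1,2,4)] .
  \<comment> \<open>Otherwise \<open>two_pairs\<close>, used for \<open>a\<close> and for
    \<open>b\<close>, would put the four elements of \<open>P1 \<union> P2\<close> into the triple
    \<open>T r\<close>.\<close>
  have x'in: "x' \<in> T r" if "r \<in> {p, c}" for r
  proof (rule ccontr)
    assume n: "x' \<notin> T r"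
    have r: "r \<in> I - {v}" "r \<noteq> a" "r \<noteq> b" using that I' ne by auto
    have "P1 \<union> P2 \<subseteq> T r" using ab(6)[OF _ r(1,2) n] ba(6)[OF _ r(1,3) n] ne by (auto simp: P1_def P2_def)
    then have "card (P1 \<union> P2) \<le> 3" using card_mono[OF finT[of r]] cp[OF r(1)] r(1) by force
    then show False using card_Un_disjoint[OF fin(1,2) dis] c12 by simp
  qed
  have sw: "T v = {x', x}" "x' \<noteq> x" using x by auto
  have xn: "x \<notin> T p" "x \<notin> T c" using notin2[OF I'(1) sw] notin2[OF I'(4) sw] x'in by auto
  define P3 P4 where "P3 = T p - {x'}" and "P4 = T c - {x'}"
  have sub: "T a \<subseteq> R" "T b \<subseteq> R" "T p \<subseteq> R" "T c \<subseteq> R" using T_sub I' by auto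
  define G where "G = R - T v - T p - T c"
  note cp2 = two_pairs[OF I'(4,1) _ sw _ _ , of "R - T v - T c - T p"]
  note pc2 = two_pairs[OF I'(1,4) _ sw _ _ , of G]
  have c34: "card P3 = 2" "card P4 = 2" "P3 \<inter> P4 = {}"
    using pc2(1-3) ne x'in by (auto simp: P3_def P4_def G_def)
  \<comment> \<open>In the view of \<open>v\<close> the pairs are forced to be three disjoint parts of \<open>R - T v\<close>.\<close>
  have pairs: "Q = P1 \<or> Q = P2 \<or> Q = F" if "r \<in> I - {v}" "Q = T r - {x'}" "card Q = 2" "x \<notin> T r" for r Q
  proof -
    have vab: "a \<noteq> v" "b \<noteq> v" "r \<noteq> v" "a \<in> I" "b \<in> I" "r \<in> I" using I' that by auto
    obtain X Y Z where V: "parts v X Y Z" "X \<subseteq> T a" using parts_at[OF vI vab(4,1)] .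
    have k: "2 \<le> card (U - T v)" if "parts v U V W" for U V W using parts_K1(1)[OF that vI] tv by simp
    have e: "U - T v = S" if "parts v U V W" "U - T v \<subseteq> S" "card S = 2" "finite S" for U V W S
      using card_seteq[OF that(4,2)] k[OF that(1)] that(3) by simp
    have X: "X - T v = P1" using e[OF V(1), of P1] V(2) x fin c12 by (auto simp: P1_def)
    have "\<not> X \<subseteq> T b"
    proof
      assume "X \<subseteq> T b"
      then have "P1 \<subseteq> P2" using X x by (auto simp: P2_def)
      then show False using dis c12(1) by (metis card.empty inf.absorb_iff1 zero_neq_numeral)
    qed
    then obtain X Y Z where V: "parts v X Y Z" "X \<subseteq> T a" "Y \<subseteq> T b"
      using parts_in[OF V(1) vab(5,2)] V parts_23 by blast
    have X: "X - T v = P1" using e[OF V(1), of P1] V(2) x fin c12 by (auto simp: P1_def)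
    have Y: "Y - T v = P2" using e[OF parts_12[OF V(1)], of P2] V(3) x fin c12 by (auto simp: P2_def)
    have "Z - T v \<subseteq> F" 
    proof
      fix z assume z: "z \<in> Z - T v"
      then have "z \<notin> X" "z \<notin> Y" "z \<in> R" using V(1) unfolding parts_def by auto
      then show "z \<in> F" using z X Y x unfolding F_def P1_def P2_def by auto
    qed
    moreover have "X \<union> Y \<union> Z = R" using V(1) unfolding parts_def by (elim conjE)
    then have "F \<subseteq> Z - T v" using V(2,3) unfolding F_def by blast
    ultimately have Z: "Z - T v = F" by blast
    have fQ: "finite Q" using that finT by auto
    have "X - T v \<subseteq> Q \<or> Y - T v \<subseteq> Q \<or> Z - T v \<subseteq> Q"
      using parts_in[OF V(1) vab(6,3)] that(2) x(1) by blast
    moreover have "S = Q" if "S \<subseteq> Q" "2 \<le> card S" for S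
      using card_seteq[OF fQ that(1)] that(2) \<open>card Q = 2\<close> by simp
    ultimately show ?thesis
      using k[OF V(1)] k[OF parts_12[OF V(1)]] k[OF parts_13[OF V(1)]] X Y Z by metis
  qed
  have Q3: "P3 = P1 \<or> P3 = P2 \<or> P3 = F" using pairs[OF I'(1) P3_def c34(1) xn(1)] .
  have Q4: "P4 = P1 \<or> P4 = P2 \<or> P4 = F" using pairs[OF I'(4) P4_def c34(2) xn(2)] .
  have R: "R = {x, x'} \<union> (P1 \<union> P2 \<union> F)" 
  proof -
    have "R = T v \<union> T a \<union> T b \<union> F" using sub(1,2) T_sub[OF vI] unfolding F_def by blast
    also have "\<dots> = {x, x'} \<union> (P1 \<union> P2 \<union> F)" unfolding x(1) P1_def P2_def by blast
    finally show ?thesis .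
  qed
  have xP: "x \<notin> P1 \<union> P2 \<union> F" "x' \<notin> P1 \<union> P2 \<union> F" 
    using x'ab unfolding P1_def P2_def F_def x(1) by auto
  have G': "R - T v - T c - T p = (P1 \<union> P2 \<union> F) - P3 - P4"
    unfolding x(1) P3_def P4_def by (subst R) (use xP in blast)
  have "c \<noteq> p" "x' \<in> T c" "x' \<in> T p" using ne x'in by auto
  note cc = cp2(4,5)[OF this refl, unfolded G', folded P3_def P4_def]
  have Bp: "indep ((P1 \<union> P2 \<union> F) - P4)"
  proof -
    have PR: "{x} \<union> T c \<union> B = R" using P(1) unfolding parts_def by (elim conjE)
    have "(P1 \<union> P2 \<union> F) - P4 \<subseteq> B"
    proof
      fix z assume z: "z \<in> (P1 \<union> P2 \<union> F) - P4"
      then have "z \<in> R" "z \<noteq> x" "z \<noteq> x'" "z \<notin> P4" using xP R by blast+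
      then show "z \<in> B" using PR unfolding P4_def by blast
    qed
    then show ?thesis using indep_sub[OF parts_indep(3)[OF P(1)]] by blast
  qed
  have Ap: "indep (insert x' P4)"
    using parts_indep(2)[OF P(1)] x'in by (auto simp: P4_def insert_absorb)
  have Fdis: "F \<inter> P1 = {}" "F \<inter> P2 = {}" by (auto simp: F_def P1_def P2_def)
  have irr: "\<not> E x x" "\<not> E x' x'" using parts_indep(1)[OF P(1)] Ap by (auto simp: indep_def)
  have mx: "m z \<le> 3" if "z = x \<or> z = x'" for z
  proof -
    have "{r\<in>I. z \<in> T r} \<subseteq> {v, a, b} \<or> {r\<in>I. z \<in> T r} \<subseteq> {v, p, c}" using that I xn x'ab by auto
    moreover have "card {v, a, b} \<le> 3" "card {v, p, c} \<le> 3" by (simp_all add: card_insert_if)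
    ultimately show ?thesis unfolding m_def
      by (metis card_mono finite.emptyI finite.insertI le_trans)
  qed
  have d4: "dg x \<le> 4" "dg x' \<le> 4" using dg_eq[of x] dg_eq[of x'] x'R n5 mx[OF disjI1[OF refl]] mx[OF disjI2[OF refl]] by auto
  show False
  \<comment> \<open>In the first case \<open>P1 \<union> P2 \<union> F\<close> is independent, so
    \<open>{x, x'}\<close> covers all edges, and degrees of at most 4 give a sum of at most 16. In
    the second case the edges within \<open>Y\<close> run only between the pairs \<open>P1\<close>
    and \<open>P2\<close> and contribute at most 8; \<open>x\<close> and \<open>x'\<close> have at
    most two neighbours each in \<open>Y\<close> and degree at most 3, so the sum is at most
    18.\<close>
  proof (cases "P3 = F \<or> P4 = F")
    case True
    have "indep (P1 \<union> P2)"
    proof (cases "P4 = F")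
      case True
      then show ?thesis using indep_sub[OF Bp, of "P1 \<union> P2"] Fdis by blast
    next
      case False
      then have "P3 = F" "P4 = P1 \<or> P4 = P2" using True Q4 by auto
      then show ?thesis using indep_sub[OF cc(1), of "P1 \<union> P2"] Fdis dis by blast
    qed
    then have "indep (P1 \<union> P2 \<union> F)" using i1 i2 unfolding indep_def by blast
    moreover have "R - {x, x'} = P1 \<union> P2 \<union> F" using R xP by blast
    ultimately have "sum dg R \<le> 2 * sum dg {x, x'}" using cover_bound[of "{x, x'}"] x'R by simp
    also have "\<dots> \<le> 16" using x(2) d4 by simp
    finally show False using sum20 by simp
  next
    case False
    then have Q: "P3 = P1 \<and> P4 = P2 \<or> P3 = P2 \<and> P4 = P1" using Q3 Q4 c34 by auto
    define Y where "Y = P1 \<union> P2 \<union> F"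
    have YR: "Y \<subseteq> R" "finite Y" using R fin by (auto simp: Y_def)
    have cF: "card F = 2"
    proof -
      have "card Y = card P1 + card P2 + card F"
        unfolding Y_def using fin dis Fdis by (subst card_Un_disjoint; (subst card_Un_disjoint)?) auto
      moreover have "card R = 2 + card Y" unfolding R Y_def[symmetric] using xP x(2) YR(2) by (simp add: Y_def[symmetric])
      ultimately show ?thesis using c12 r8 by simp
    qed
    have "{y\<in>Y. E x y} \<subseteq> F \<or> {y\<in>Y. E x y} \<subseteq> P1 \<or> {y\<in>Y. E x y} \<subseteq> P2"
      using x1 x2 unfolding Y_def indep_def by blast
    then have nx: "card {y\<in>Y. E x y} \<le> 2" using cF c12 fin card_mono by metis
    have "indep (insert x' P3) \<or> indep (insert x' (P4 \<union> F))"
    proof -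
      have "P4 \<union> F \<subseteq> P4 \<union> (P1 \<union> P2 \<union> F - P3 - P4)" using Q Fdis dis by blast
      then have "insert x' (P4 \<union> F) \<subseteq> insert x' (P4 \<union> (P1 \<union> P2 \<union> F - P3 - P4))" by blast
      then show ?thesis using cc(2) indep_sub by blast
    qed
    then have "{y\<in>Y. E x' y} \<subseteq> F \<or> {y\<in>Y. E x' y} \<subseteq> P1 \<or> {y\<in>Y. E x' y} \<subseteq> P2"
      using Ap Q unfolding Y_def indep_def by blast
    then have nx': "card {y\<in>Y. E x' y} \<le> 2" using cF c12 fin card_mono by metis
    have d3: "dg z \<le> 3" if "z = x \<and> w = x' \<or> z = x' \<and> w = x" "card {y\<in>Y. E z y} \<le> 2" for z w
    proof -
      have "{y\<in>R. E z y} \<subseteq> insert w {y\<in>Y. E z y}" using R irr that(1) by (auto simp: Y_def)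
      then have "dg z \<le> card (insert w {y\<in>Y. E z y})" unfolding dg_def using YR by (intro card_mono) auto
      also have "\<dots> \<le> Suc (card {y\<in>Y. E z y})" by (rule card_insert_le_m1) auto
      finally show ?thesis using that(2) by simp
    qed
    have "sum dg Y = (\<Sum>y\<in>Y. card {z\<in>{x, x'}. E y z} + card {z\<in>Y. E y z})"
    proof (intro sum.cong refl)
      fix y assume "y \<in> Y"
      have "{z\<in>R. E y z} = {z\<in>{x, x'}. E y z} \<union> {z\<in>Y. E y z}" using R by (auto simp: Y_def)
      moreover have "{z\<in>{x, x'}. E y z} \<inter> {z\<in>Y. E y z} = {}" using xP by (auto simp: Y_def)
      ultimately show "dg y = card {z\<in>{x, x'}. E y z} + card {z\<in>Y. E y z}"
        unfolding dg_def using YR by (simp add: card_Un_disjoint)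
    qed
    also have "\<dots> = (\<Sum>z\<in>{x, x'}. card {y\<in>Y. E z y}) + (\<Sum>y\<in>Y. card {z\<in>Y. E y z})"
      using dg_swap[of Y "{x, x'}"] YR x'R by (simp add: sum.distrib)
    also have "(\<Sum>z\<in>{x, x'}. card {y\<in>Y. E z y}) \<le> 4" using nx nx' x(2) by simp
    also have "(\<Sum>y\<in>Y. card {z\<in>Y. E y z}) \<le> (\<Sum>y\<in>Y. if y \<in> F then 0 else 2)"
    proof (intro sum_mono)
      fix y assume y: "y \<in> Y"
      show "card {z\<in>Y. E y z} \<le> (if y \<in> F then 0 else 2)"
      proof (cases "y \<in> F")
        case True
        then have "{z\<in>Y. E y z} = {}" using i1 i2 unfolding Y_def indep_def by blast
        then show ?thesis by (simp only: card.empty)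
      next
        case False
        then have "{z\<in>Y. E y z} \<subseteq> P1 \<or> {z\<in>Y. E y z} \<subseteq> P2" using y i1 i2 unfolding Y_def indep_def by blast
        then have "card {z\<in>Y. E y z} \<le> 2" using c12 fin card_mono by metis
        then show ?thesis using False by simp
      qed
    qed
    also have "\<dots> = 8"
    proof -
      have "(\<Sum>y\<in>Y. if y \<in> F then 0 else 2) = (\<Sum>y\<in>P1 \<union> P2. (2::nat))"
        using fin Fdis unfolding Y_def by (intro sum.mono_neutral_cong_right) auto
      then show ?thesis using card_Un_disjoint[OF fin(1,2) dis] c12 by simp
    qed
    finally have "sum dg Y \<le> 12" by simp
    moreover have "sum dg R = dg x + dg x' + sum dg Y"
      unfolding R Y_def[symmetric] using xP x(2) YR(2) by (simp add: Y_def[symmetric])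
    ultimately show False using d3[of x x'] d3[of x' x] nx nx' sum20 by simp
  qed
qed

text \<open>For \<open>p\<close> without a cover in the sense of \<open>cov\<close>, the middle part
  \<open>A\<close> of its view has three elements, since otherwise \<open>insert x A\<close> would
  be such a cover. So \<open>A\<close> is not inside \<open>T v\<close>, whence
  \<open>x \<in> T v\<close>, and every other triple contains \<open>x\<close> or equals
  \<open>A\<close>. At most one equals \<open>A\<close>, which leaves \<open>not_three\<close> or
  \<open>core\<close>.\<close>

theorem contra: False
proof -
  obtain p where p: "p \<in> I - {v}" "\<not> cov p" using not_all_cov by blast
  obtain x A B where P: "parts p {x} A B" "x \<notin> T p" "card (A - T p) = 2" "card (B - T p) = 2" "card A < card B"
    using singleton_part[OF p(1)] .
  note L = card_large[OF P(1,5)]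
  have finA: "finite A" using parts_fin[OF P(1)] by simp
  have "card A \<ge> 2" using P(3) finA card_mono[of A "A - T p"] by auto
  moreover have "card A \<noteq> 2"
  proof
    assume c: "card A = 2"
    then have "A - T p = A" using P(3) finA by (intro card_subset_eq) auto
    moreover have "x \<notin> A" "insert x A \<subseteq> R" "R - insert x A = B" using P(1) unfolding parts_def by auto
    ultimately have "cov p" unfolding cov_def using P(2) c finA parts_indep(3)[OF P(1)]
      by (intro exI[of _ "insert x A"]) auto
    then show False using p(2) by simp
  qed
  ultimately have A3: "card A = 3" using L by simp
  have "\<not> A \<subseteq> T v" using A3 cv card_mono[OF finT[OF vI], of A] by auto
  then have xv: "x \<in> T v" using parts_in[OF P(1) vI] p(1) not_sub_large[OF L(1) vI] by auto
  obtain x' where x': "T v = {x, x'}" "x \<noteq> x'"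
  proof -
    obtain y z where "T v = {y, z}" "y \<noteq> z" using cv by (auto simp: card_2_iff)
    then show ?thesis using that[of y] that[of z] xv by (auto simp: insert_commute)
  qed
  obtain q1 q2 q3 where q: "I = {v, p, q1, q2, q3}" "distinct [v, p, q1, q2, q3]" using three_others[OF p(1)] .
  have qI: "q1 \<in> I - {v}" "q2 \<in> I - {v}" "q3 \<in> I - {v}" using q by auto
  have alt: "x \<in> T r \<or> T r = A" if "r \<in> I - {v}" "r \<noteq> p" for r
    using parts_in[OF P(1), of r] that not_sub_large[OF L(1), of r] card_subset_eq[OF finT[of r], of A] cp[OF that(1)] A3 by auto
  have neq: "T r \<noteq> T s" if "r \<in> I - {v}" "s \<in> I - {v}" "r \<noteq> s" for r s using T_neq[of s r] that tp by auto
  have main: False if "I = {v, p, a, b, c}" "distinct [v, p, a, b, c]" "x \<in> T a" "x \<in> T b" "T c = A" for a b c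
    using core[OF that(1,2) x' that(3,4)] P(1,3) that(5) by blast
  have d: "q1 \<noteq> q2" "q1 \<noteq> q3" "q2 \<noteq> q3" "q1 \<noteq> p" "q2 \<noteq> p" "q3 \<noteq> p" using q(2) by auto
  have perm: "I = {v, p, q1, q3, q2}" "I = {v, p, q2, q3, q1}" using q(1) by blast+
  have pd: "distinct [v, p, q1, q3, q2]" "distinct [v, p, q2, q3, q1]" using q(2) by auto
  consider "x \<in> T q1 \<and> x \<in> T q2 \<and> x \<in> T q3" | "x \<in> T q1 \<and> x \<in> T q2 \<and> T q3 = A"
    | "x \<in> T q1 \<and> x \<in> T q3 \<and> T q2 = A" | "x \<in> T q2 \<and> x \<in> T q3 \<and> T q1 = A"
    using alt[OF qI(1) d(4)] alt[OF qI(2) d(5)] alt[OF qI(3) d(6)]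
      neq[OF qI(1,2) d(1)] neq[OF qI(1,3) d(2)] neq[OF qI(2,3) d(3)] by metis
  then show False
  proof cases
    case 1 then show ?thesis using not_three[OF qI d(1-3) x'] by blast
  next
    case 2 then show ?thesis using main[OF q] by blast
  next
    case 3 then show ?thesis using main[OF perm(1) pd(1)] by blast
  next
    case 4 then show ?thesis using main[OF perm(2) pd(2)] by blast
  qed
qed

end

section \<open>A finite search for view systems\<close>

text \<open>An element \<open>x\<close> of \<open>R\<close> is encoded by its type, the list of the truth values of \<open>x \<in> T p\<close> for \<open>p\<close> in a list of members
  of \<open>I\<close>, latest member first, and a set system by the list of the types with their multiplicities. Adjacency
  matrices over-approximate \<open>E\<close>: initially they are full or complete bipartite, and the view of each
  member removes the pairs inside a part. A branch dies as soon as the degrees force too large values of \<open>t\<close>.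
  All functions are first-order with unary numbers, because they are evaluated by rewriting.\<close>

datatype part = P0 | P1 | P2

fun andl :: "bool list \<Rightarrow> bool list \<Rightarrow> bool list" where
  "andl (x # xs) (y # ys) = (if x then y else False) # andl xs ys"
| "andl _ _ = []"

fun andm :: "bool list list \<Rightarrow> bool list list \<Rightarrow> bool list list" where
  "andm (x # xs) (y # ys) = andl x y # andm xs ys"
| "andm _ _ = []"

fun cnt :: "bool list \<Rightarrow> nat" where
  "cnt [] = 0"
| "cnt (x # xs) = (if x then Suc (cnt xs) else cnt xs)"

fun many :: "nat \<Rightarrow> bool list \<Rightarrow> bool list \<Rightarrow> bool" where
  "many 0 _ _ = True"
| "many (Suc k) (x # xs) (y # ys) = (if x then if y then many k xs ys else many (Suc k) xs ys else many (Suc k) xs ys)"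
| "many (Suc k) _ _ = False"

fun covered :: "bool list \<Rightarrow> bool list \<Rightarrow> bool list \<Rightarrow> bool" where
  "covered (x # xs) (y # ys) (z # zs) =
     (if x then covered xs ys zs else if y then covered xs ys zs else if z then covered xs ys zs else False)"
| "covered _ _ _ = True"

text \<open>The members are distributed to the parts of a view, where \<open>a\<close>, \<open>b\<close>, \<open>c\<close> are the elements still allowed in each part,
  \<open>N\<close> the neighbours, and \<open>l\<close> the number of parts in use; unused parts are interchangeable.\<close>

fun groups :: "nat \<Rightarrow> nat \<Rightarrow> bool list \<Rightarrow> bool list list \<Rightarrow> bool list \<Rightarrow> bool list \<Rightarrow> bool list \<Rightarrow>
    (bool list \<times> bool list \<times> bool list) list" where
  "groups l k N [] a b c = (if covered a b c then [(a, b, c)] else [])"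
| "groups 0 k N (r # rs) a b c = (if many k N (andl a r) then groups (Suc 0) k N rs (andl a r) b c else [])"
| "groups (Suc 0) k N (r # rs) a b c =
     (if many k N (andl a r) then groups (Suc 0) k N rs (andl a r) b c else []) @
     (if many k N (andl b r) then groups (Suc (Suc 0)) k N rs a (andl b r) c else [])"
| "groups (Suc (Suc l)) k N (r # rs) a b c =
     (if many k N (andl a r) then groups (Suc (Suc l)) k N rs (andl a r) b c else []) @
     (if many k N (andl b r) then groups (Suc (Suc l)) k N rs a (andl b r) c else []) @
     (if many k N (andl c r) then groups (Suc (Suc l)) k N rs a b (andl c r) else [])"

fun consall :: "'b \<Rightarrow> 'b list list \<Rightarrow> 'b list list" where
  "consall x [] = []"
| "consall x (y # ys) = (x # y) # consall x ys"

text \<open>The numbers \<open>i\<close>, \<open>j\<close>, \<open>k\<close> are the neighbours that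
  each part may still receive; a view allows two per part.\<close>

fun colourings :: "bool list \<Rightarrow> bool list \<Rightarrow> bool list \<Rightarrow> bool list \<Rightarrow> nat \<Rightarrow> nat \<Rightarrow> nat \<Rightarrow> part list list" where
  "colourings (n # N) (a # as) (b # bs) (c # cs) i j k =
     (if a then if n then (case i of 0 \<Rightarrow> [] | Suc i' \<Rightarrow> consall P0 (colourings N as bs cs i' j k))
        else consall P0 (colourings N as bs cs i j k) else []) @
     (if b then if n then (case j of 0 \<Rightarrow> [] | Suc j' \<Rightarrow> consall P1 (colourings N as bs cs i j' k))
        else consall P1 (colourings N as bs cs i j k) else []) @
     (if c then if n then (case k of 0 \<Rightarrow> [] | Suc k' \<Rightarrow> consall P2 (colourings N as bs cs i j k'))
        else consall P2 (colourings N as bs cs i j k) else [])"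
| "colourings _ _ _ _ i j k = [[]]"

fun notpart :: "part \<Rightarrow> part list \<Rightarrow> bool list" where
  "notpart x [] = []"
| "notpart P0 (y # ys) = (case y of P0 \<Rightarrow> False | _ \<Rightarrow> True) # notpart P0 ys"
| "notpart P1 (y # ys) = (case y of P1 \<Rightarrow> False | _ \<Rightarrow> True) # notpart P1 ys"
| "notpart P2 (y # ys) = (case y of P2 \<Rightarrow> False | _ \<Rightarrow> True) # notpart P2 ys"

fun partrow :: "part \<Rightarrow> bool list \<Rightarrow> bool list \<Rightarrow> bool list \<Rightarrow> bool list" where
  "partrow P0 a b c = a"
| "partrow P1 a b c = b"
| "partrow P2 a b c = c"

fun partrows :: "part list \<Rightarrow> bool list \<Rightarrow> bool list \<Rightarrow> bool list \<Rightarrow> bool list list" where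
  "partrows [] a b c = []"
| "partrows (x # xs) a b c = partrow x a b c # partrows xs a b c"

definition viewmat :: "part list \<Rightarrow> bool list list" where
  "viewmat q = partrows q (notpart P0 q) (notpart P1 q) (notpart P2 q)"

fun notl :: "bool list \<Rightarrow> bool list" where
  "notl [] = []"
| "notl (x # xs) = (if x then False else True) # notl xs"

fun ones :: "bool list \<Rightarrow> bool list" where
  "ones [] = []"
| "ones (x # xs) = True # ones xs"

text \<open>Here \<open>k\<close> stands for \<open>2 - t p\<close>, the least number of neighbours
  in a part. The first argument 0 says that no part is in use, and initially every element is
  allowed everywhere.\<close>

definition view_groups :: "nat \<Rightarrow> bool list \<Rightarrow> bool list list \<Rightarrow> (bool list \<times> bool list \<times> bool list) list" where
  "view_groups k r rs = groups 0 k (notl r) rs (ones r) (ones r) (ones r)"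

fun mats :: "part list list \<Rightarrow> bool list list list" where
  "mats [] = []"
| "mats (q # qs) = viewmat q # mats qs"

fun group_mats :: "bool list \<Rightarrow> (bool list \<times> bool list \<times> bool list) list \<Rightarrow> bool list list list" where
  "group_mats N [] = []"
| "group_mats N ((a, b, c) # gs) = mats (colourings N a b c (Suc (Suc 0)) (Suc (Suc 0)) (Suc (Suc 0))) @ group_mats N gs"

text \<open>A necessary condition that prunes partial systems: each member has some grouping of the
  other members. The limit of two neighbours per part and the degrees are left to
  \<open>search\<close>.\<close>

fun feasible :: "nat list \<Rightarrow> bool list list \<Rightarrow> bool list list \<Rightarrow> bool" where
  "feasible ks rs (r # rs') = (case ks of [] \<Rightarrow> True | k # ks' \<Rightarrow>
     (case view_groups k r (rs @ rs') of [] \<Rightarrow> False | _ # _ \<Rightarrow> feasible ks' (r # rs) rs'))"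
| "feasible ks rs [] = True"

fun views :: "nat list \<Rightarrow> bool list list \<Rightarrow> bool list list \<Rightarrow> bool list list list list" where
  "views ks rs (r # rs') = (case ks of [] \<Rightarrow> [] | k # ks' \<Rightarrow>
     group_mats (notl r) (view_groups k r (rs @ rs')) # views ks' (r # rs) rs')"
| "views ks rs [] = []"

fun shorter :: "'b list \<Rightarrow> 'b list \<Rightarrow> bool" where
  "shorter [] _ = True"
| "shorter (x # xs) [] = False"
| "shorter (x # xs) (y # ys) = shorter xs ys"

fun ins :: "'b list \<Rightarrow> 'b list list \<Rightarrow> 'b list list" where
  "ins x [] = [x]"
| "ins x (y # ys) = (if shorter x y then x # y # ys else y # ins x ys)"

text \<open>Members with fewer candidate views are branched on first.\<close>

fun sort_lists :: "'b list list \<Rightarrow> 'b list list" where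
  "sort_lists [] = []"
| "sort_lists (x # xs) = ins x (sort_lists xs)"

section \<open>Degree tests and backtracking over the views\<close>

fun leq :: "nat \<Rightarrow> nat \<Rightarrow> bool" where
  "leq 0 _ = True"
| "leq (Suc m) 0 = False"
| "leq (Suc m) (Suc n) = leq m n"

fun diff :: "nat \<Rightarrow> nat \<Rightarrow> nat" where
  "diff m 0 = m"
| "diff 0 (Suc n) = 0"
| "diff (Suc m) (Suc n) = diff m n"

text \<open>With \<open>d = dg x + t x\<close> and a row that contains all neighbours of
  \<open>x\<close>, this is a lower bound for \<open>t x\<close>.\<close>

fun drow :: "nat \<Rightarrow> bool list \<Rightarrow> nat" where
  "drow d [] = d"
| "drow 0 (x # xs) = 0"
| "drow (Suc d) (x # xs) = (if x then drow d xs else drow (Suc d) xs)"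

text \<open>The bounds \<open>c\<close>, \<open>c'\<close> are for a single value of
  \<open>t\<close> on the two sides, and \<open>b\<close>, \<open>b'\<close> are the totals still
  available there.\<close>

fun degrees_ok :: "nat \<Rightarrow> nat \<Rightarrow> (bool \<times> nat \<times> bool list) list \<Rightarrow> bool list list \<Rightarrow> nat \<Rightarrow> nat \<Rightarrow> bool" where
  "degrees_ok c c' ((s, d, e) # ds) (a # A) b b' = (case drow d a of 0 \<Rightarrow> degrees_ok c c' ds A b b' | Suc i \<Rightarrow>
     (if s then if leq (Suc i) c then if leq (Suc i) b then degrees_ok c c' ds A (diff b (Suc i)) b' else False else False
      else if leq (Suc i) c' then if leq (Suc i) b' then degrees_ok c c' ds A b (diff b' (Suc i)) else False else False))"
| "degrees_ok c c' _ _ b b' = True"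

fun both :: "bool list \<Rightarrow> bool list \<Rightarrow> nat \<Rightarrow> nat" where
  "both (x # xs) (y # ys) n = (if x then if y then Suc (both xs ys n) else both xs ys n else both xs ys n)"
| "both _ _ n = n"

fun neither :: "bool list \<Rightarrow> bool list \<Rightarrow> bool list \<Rightarrow> nat" where
  "neither (x # xs) (y # ys) (z # zs) = (if x then if y then neither xs ys zs else if z then neither xs ys zs
     else Suc (neither xs ys zs) else neither xs ys zs)"
| "neither _ _ _ = 0"

text \<open>If \<open>x\<close> and \<open>y\<close> belong to one colour class of size 5 and
  \<open>t x = t y = 0\<close>, they have at most one common non-neighbour in the other two classes.
  A conflict exhibits two, so one of them has \<open>t \<noteq> 0\<close>: \<open>both\<close>
  counts those in \<open>I\<close> and \<open>neither\<close> those on the opposite side, which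
  \<open>r\<close> marks. Non-adjacency in an over-approximation is genuine.\<close>

fun conflict :: "bool list \<Rightarrow> bool list \<times> bool list \<Rightarrow> bool list \<times> bool list \<Rightarrow> bool" where
  "conflict r (e, a) (e', a') = leq (Suc (Suc 0)) (both e e' (neither r a a'))"

fun two_conflicts :: "bool list \<Rightarrow> (bool list \<times> bool list) list \<Rightarrow> bool" where
  "two_conflicts r [w, x, y, z] = (if (if conflict r w x then conflict r y z else False) then True
     else if (if conflict r w y then conflict r x z else False) then True
     else if conflict r w z then conflict r x y else False)"
| "two_conflicts r _ = False"

fun same_side :: "bool \<Rightarrow> (bool \<times> nat \<times> bool list) list \<Rightarrow> bool list list \<Rightarrow> (bool list \<times> bool list) list" where
  "same_side True ((s, d, e) # ds) (a # A) = (if s then (e, a) # same_side True ds A else same_side True ds A)"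
| "same_side False ((s, d, e) # ds) (a # A) = (if s then same_side False ds A else (e, a) # same_side False ds A)"
| "same_side _ _ _ = []"

fun app :: "'b list \<Rightarrow> 'b list \<Rightarrow> 'b list" where
  "app [] ys = ys"
| "app (x # xs) ys = app xs (x # ys)"

text \<open>If \<open>t z = 2\<close> on a side with total 3, then among the other four elements of that side at most one has \<open>t \<noteq> 0\<close>, so one of
  two disjoint conflicting pairs consists of elements with \<open>t = 0\<close>.\<close>

fun twins :: "bool list \<Rightarrow> bool list \<Rightarrow> (bool \<times> nat \<times> bool list) list \<Rightarrow> bool list list \<Rightarrow>
    (bool \<times> nat \<times> bool list) list \<Rightarrow> bool list list \<Rightarrow> bool" where
  "twins r r' ds' A' ((s, d, e) # ds) (a # A) =
     (if (if leq (Suc (Suc 0)) (drow d a)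
          then two_conflicts (if s then r' else r) (same_side s (app ds' ds) (app A' A)) else False)
      then True else twins r r' ((s, d, e) # ds') (a # A') ds A)"
| "twins r r' ds' A' _ _ = False"

fun twin_free :: "(bool list \<times> bool list) option \<Rightarrow> (bool \<times> nat \<times> bool list) list \<Rightarrow> bool list list \<Rightarrow> bool" where
  "twin_free None ds A = True"
| "twin_free (Some (r, r')) ds A = (if twins r r' [] [] ds A then False else True)"

text \<open>The result \<open>True\<close> means that some choice of one view per member survives
  the tests. Only \<open>False\<close> carries information, as it refutes the system; accordingly
  \<open>searchl\<close> returns \<open>True\<close> when there is nothing to branch on.\<close>

fun search :: "(bool list \<times> bool list) option \<Rightarrow> nat \<Rightarrow> nat \<Rightarrow> nat \<Rightarrow> nat \<Rightarrow> (bool \<times> nat \<times> bool list) list \<Rightarrow> bool list list \<Rightarrow>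
    bool list list list \<Rightarrow> bool list list list list \<Rightarrow> bool" where
  "search w c c' b b' ds A [] Vs = False"
| "search w c c' b b' ds A (M # V) [] =
     (if (if degrees_ok c c' ds (andm A M) b b' then twin_free w ds (andm A M) else False) then True
      else search w c c' b b' ds A V [])"
| "search w c c' b b' ds A (M # V) (W # Ws) =
     (if (if degrees_ok c c' ds (andm A M) b b' then search w c c' b b' ds (andm A M) W Ws else False) then True
      else search w c c' b b' ds A V (W # Ws))"

fun searchl where
  "searchl w c c' b b' ds A [] = True"
| "searchl w c c' b b' ds A (V # Vs) = search w c c' b b' ds A V Vs"

section \<open>Generation of the set systems\<close>

fun block :: "bool list \<Rightarrow> nat \<Rightarrow> (bool list \<times> nat) list \<Rightarrow> (bool list \<times> nat) list" where
  "block b 0 bs = bs"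
| "block b (Suc n) bs = (b, Suc n) # bs"

fun blocks :: "bool list \<Rightarrow> nat \<Rightarrow> nat \<Rightarrow> (bool list \<times> nat) list list \<Rightarrow> (bool list \<times> nat) list list" where
  "blocks b i j [] = []"
| "blocks b i j (bs # bss) = block (True # b) i (block (False # b) j bs) # blocks b i j bss"

text \<open>Elements of equal type are interchangeable, so a new member is determined up to
  isomorphism by how many elements it takes from each block. In \<open>splits'\<close>,
  \<open>i\<close> elements of the current block are taken, \<open>j\<close> are undecided, and
  \<open>k\<close> remain to be taken from it and the later blocks.\<close>

function (sequential) splits :: "(bool list \<times> nat) list \<Rightarrow> nat \<Rightarrow> (bool list \<times> nat) list list"
  and splits' :: "bool list \<Rightarrow> nat \<Rightarrow> nat \<Rightarrow> nat \<Rightarrow> (bool list \<times> nat) list \<Rightarrow> (bool list \<times> nat) list list" where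
  "splits [] k = (case k of 0 \<Rightarrow> [[]] | Suc _ \<Rightarrow> [])"
| "splits ((b, c) # bs) k = splits' b 0 c k bs"
| "splits' b i 0 k bs = blocks b i 0 (splits bs k)"
| "splits' b i (Suc j) 0 bs = blocks b i (Suc j) (splits bs 0)"
| "splits' b i (Suc j) (Suc k) bs = blocks b i (Suc j) (splits bs (Suc k)) @ splits' b (Suc i) j k bs"
  by pat_completeness auto
termination by (relation "measures [\<lambda>x. case x of Inl (bs, _) \<Rightarrow> length bs | Inr (_, _, _, _, bs) \<Rightarrow> length bs,
   \<lambda>x. case x of Inl _ \<Rightarrow> 0 | Inr (_, _, j, _, _) \<Rightarrow> Suc j]") auto

fun repl where
  "repl b 0 xs = xs"
| "repl b (Suc n) xs = b # repl b n xs"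

fun expand :: "(bool list \<times> nat) list \<Rightarrow> bool list list" where
  "expand [] = []"
| "expand ((b, c) # bs) = repl b c (expand bs)"

fun heads :: "bool list list \<Rightarrow> bool list" where
  "heads [] = []"
| "heads (x # xs) = (case x of [] \<Rightarrow> False | b # _ \<Rightarrow> b) # heads xs"

fun tails :: "bool list list \<Rightarrow> bool list list" where
  "tails [] = []"
| "tails (x # xs) = (case x of [] \<Rightarrow> [] | _ # t \<Rightarrow> t) # tails xs"

fun rows :: "nat list \<Rightarrow> bool list list \<Rightarrow> bool list list" where
  "rows [] es = []"
| "rows (k # ks) es = heads es # rows ks (tails es)"

fun prune :: "nat list \<Rightarrow> (bool list \<times> nat) list list \<Rightarrow> (bool list \<times> nat) list list" where
  "prune ks [] = []"
| "prune ks (bs # bss) = (if feasible ks [] (rows ks (expand bs)) then bs # prune ks bss else prune ks bss)"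

fun extend :: "nat list \<Rightarrow> nat \<Rightarrow> (bool list \<times> nat) list list \<Rightarrow> (bool list \<times> nat) list list" where
  "extend ks k [] = []"
| "extend ks k (bs # bss) = prune ks (splits bs k) @ extend ks k bss"

fun plus :: "nat \<Rightarrow> nat \<Rightarrow> nat" where
  "plus 0 n = n"
| "plus (Suc m) n = Suc (plus m n)"

text \<open>For \<open>d = 6 - card I\<close> the demand of \<open>x\<close> is
  \<open>dg x + t x\<close>, by the degree equation.\<close>

fun demands :: "nat \<Rightarrow> bool list \<Rightarrow> bool list list \<Rightarrow> (bool \<times> nat \<times> bool list) list" where
  "demands d (s # ss) (e # es) = (s, plus (cnt e) d, e) # demands d ss es"
| "demands d _ _ = []"

fun copies :: "'b \<Rightarrow> 'c list \<Rightarrow> 'b list" where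
  "copies r [] = []"
| "copies r (x # xs) = r # copies r xs"

fun bip :: "bool list \<Rightarrow> bool list \<Rightarrow> bool list \<Rightarrow> bool list list" where
  "bip r r' [] = []"
| "bip r r' (x # xs) = (if x then r' else r) # bip r r' xs"

definition possible :: "nat list \<Rightarrow> nat \<Rightarrow> nat \<Rightarrow> nat \<Rightarrow> bool list list \<Rightarrow> bool" where
  "possible ks d c b es = searchl None c 0 b 0 (demands d (copies True es) es)
     (copies (copies True es) es) (sort_lists (views ks [] (rows ks es)))"

fun any_possible where
  "any_possible ks d c b [] = False"
| "any_possible ks d c b (bs # bss) = (if possible ks d c b (expand bs) then True else any_possible ks d c b bss)"

fun incid :: "bool list \<Rightarrow> bool list list \<Rightarrow> nat" where
  "incid (s # ss) (e # es) = (if s then plus (cnt e) (incid ss es) else incid ss es)"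
| "incid _ _ = 0"

fun eqn :: "nat \<Rightarrow> nat \<Rightarrow> bool" where
  "eqn 0 0 = True"
| "eqn (Suc m) (Suc n) = eqn m n"
| "eqn _ _ = False"

text \<open>The sides are two colour classes, marked by \<open>ss\<close>. The number
  \<open>i\<close> is the value of \<open>sum m\<close> on the marked side, known from
  \<open>bip_sum_m\<close>, and \<open>w\<close> switches on the test with
  \<open>twins\<close>.\<close>

definition possible_bip :: "bool \<Rightarrow> nat \<Rightarrow> nat \<Rightarrow> nat \<Rightarrow> nat \<Rightarrow> nat \<Rightarrow> nat list \<Rightarrow> bool list \<Rightarrow> bool list list \<Rightarrow> bool" where
  "possible_bip w i c c' b b' ks ss es =
     (if eqn (incid ss es) i then
        if degrees_ok c c' (demands (Suc (Suc 0)) ss es) (bip ss (notl ss) ss) b b' then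
          searchl (if w then Some (ss, notl ss) else None) c c' b b' (demands (Suc (Suc 0)) ss es) (bip ss (notl ss) ss)
            (sort_lists (views ks [] (rows ks es)))
        else False
      else False)"

fun any_possible_bip where
  "any_possible_bip w i c c' b b' ks [] = False"
| "any_possible_bip w i c c' b b' ks (bs # bss) =
     (if possible_bip w i c c' b b' ks (heads (expand bs)) (tails (expand bs)) then True
      else any_possible_bip w i c c' b b' ks bss)"

fun retain :: "nat list \<Rightarrow> nat \<Rightarrow> nat \<Rightarrow> nat \<Rightarrow> (bool list \<times> nat) list list \<Rightarrow> (bool list \<times> nat) list list" where
  "retain ks d c b [] = []"
| "retain ks d c b (bs # bss) =
     (if possible ks d c b (expand bs) then bs # retain ks d c b bss else retain ks d c b bss)"

fun blocks1 :: "bool list \<Rightarrow> nat \<Rightarrow> (bool list \<times> nat) list list \<Rightarrow> (bool list \<times> nat) list list" where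
  "blocks1 b i [] = []"
| "blocks1 b i (bs # bss) = ((b, i) # bs) # blocks1 b i bss"

abbreviation "n2 \<equiv> Suc (Suc 0)"
abbreviation "n3 \<equiv> Suc n2"
abbreviation "n4 \<equiv> Suc n3"
abbreviation "n5 \<equiv> Suc n4"
abbreviation "n6 \<equiv> Suc n5"
abbreviation "n8 \<equiv> Suc (Suc n6)"
abbreviation "n9 \<equiv> Suc n8"

fun any_extension where
  "any_extension ks k d c b [] = False"
| "any_extension ks k d c b (bs # bss) =
     (if any_possible ks d c b (prune ks (splits bs k)) then True else any_extension ks k d c b bss)"

fun any_bip_extension where
  "any_bip_extension w i k c c' b b' ks [] = False"
| "any_bip_extension w i k c c' b b' ks (bs # bss) =
     (if any_possible_bip w i c c' b b' ks (splits bs k) then True else any_bip_extension w i k c c' b b' ks bss)"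

text \<open>Four of the five members for \<open>card R = 9\<close>: three with \<open>t = 0\<close>,
  so \<open>card (T p) = 3\<close>, and then one with \<open>t = 1\<close> and
  \<open>card (T p) = 4\<close>. The fifth is added by \<open>any_extension\<close>.\<close>

definition "sys9 = extend [Suc 0, n2, n2, n2] n4 (extend [n2, n2, n2] n3 (extend [n2, n2] n3 (extend [n2] n3 [[([], n9)]])))"

text \<open>The start is the normal form of \<open>sys10_sound\<close>: quadruples
  \<open>T a\<close>, \<open>T b\<close> with two common elements, both outside \<open>T v\<close>.
  Thus \<open>T v\<close> is chosen among the other eight elements, after which the block of the two
  common elements is put back with its type completed by \<open>False\<close>. The fourth member is
  unrestricted.\<close>

definition "sys10 = retain [n2, n2, n2, n2] n2 n2 n6 (extend [n2, n2, n2, n2] n4 (prune [n2, n2, n2]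
  (blocks1 [False, True, True] n2 (splits [([True, False], n2), ([False, True], n2), ([False, False], n4)] n4))))"

section \<open>Soundness of the search\<close>

definition types :: "'a set list \<Rightarrow> 'a list \<Rightarrow> bool list list" where
  "types Ss xs = map (\<lambda>x. map (\<lambda>S. x \<in> S) Ss) xs"

definition mask :: "'a list \<Rightarrow> 'a set \<Rightarrow> bool list" where
  "mask xs S = map (\<lambda>x. x \<in> S) xs"

text \<open>The enumeration \<open>xs\<close> of \<open>R\<close> is arbitrary; this freedom is what
  permits the search to treat systems up to isomorphism.\<close>

definition represents :: "'a set list \<Rightarrow> 'a set \<Rightarrow> (bool list \<times> nat) list \<Rightarrow> bool" where
  "represents Ss R bs \<longleftrightarrow> (\<exists>xs. distinct xs \<and> set xs = R \<and> types Ss xs = expand bs)"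

lemma app_rev [simp]: "app xs ys = rev xs @ ys"
  by (induction xs arbitrary: ys) auto

lemma leq_le [simp]: "leq m n \<longleftrightarrow> m \<le> n"
  by (induction m n rule: leq.induct) auto

lemma diff_minus [simp]: "diff m n = m - n"
  by (induction m n rule: diff.induct) auto

lemma plus_add [simp]: "plus m n = m + n"
  by (induction m n rule: plus.induct) auto

lemma eqn_eq [simp]: "eqn m n \<longleftrightarrow> m = n"
  by (induction m n rule: eqn.induct) auto

lemma notl_map [simp]: "notl xs = map Not xs"
  by (induction xs) auto

lemma copies_map: "copies r xs = map (\<lambda>_. r) xs"
  by (induction xs) auto

lemma ones_map: "ones xs = map (\<lambda>_. True) xs"
  by (induction xs) auto

lemma heads_tails [simp]:
  "heads (types (S # Ss) xs) = mask xs S" "tails (types (S # Ss) xs) = types Ss xs"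
  by (induction xs) (auto simp: types_def mask_def)

lemma rows_types: "length ks = length Ss \<Longrightarrow> rows ks (types Ss xs) = map (mask xs) Ss"
  by (induction ks Ss rule: list_induct2) auto

lemma repl_replicate [simp]: "repl b n xs = replicate n b @ xs"
  by (induction n) auto

lemma expand_block [simp]: "expand (block b n bs) = replicate n b @ expand bs"
  by (cases n) auto

lemma set_blocks: "set (blocks b i j bss) = (\<lambda>bs. block (True # b) i (block (False # b) j bs)) ` set bss"
  by (induction bss) auto

lemma split_one:
  "a \<le> j \<Longrightarrow> a \<le> k \<Longrightarrow> bs' \<in> set (splits bs (k - a)) \<Longrightarrow>
     block (True # b) (i + a) (block (False # b) (j - a) bs') \<in> set (splits' b i j k bs)"
proof (induction a arbitrary: i j k)
  case 0
  then show ?case by (cases j; cases k) (auto simp: set_blocks)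
next
  case (Suc a)
  then obtain j' k' where "j = Suc j'" "k = Suc k'" by (cases j; cases k) auto
  then show ?case using Suc.IH[of j' k' "Suc i"] Suc.prems by (auto simp: set_blocks)
qed

text \<open>Within each block the elements satisfying \<open>Q\<close> are listed first, so that the
  block falls into two blocks of constant type.\<close>

lemma splits_sound:
  assumes "map f xs = expand bs" "length (filter Q xs) = k" "distinct xs"
  shows "\<exists>bs'\<in>set (splits bs k). \<exists>xs'. distinct xs' \<and> set xs' = set xs \<and> map (\<lambda>x. Q x # f x) xs' = expand bs'"
  using assms
proof (induction bs arbitrary: xs k)
  case Nil
  then show ?case by simp
next
  case (Cons bc bs)
  obtain b c where bc: "bc = (b, c)" by force
  define ys zs where "ys = take c xs" and "zs = drop c xs"
  have m: "map f xs = replicate c b @ expand bs" using Cons.prems(1) bc by simp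
  then have "length xs \<ge> c" by (metis length_append length_map length_replicate le_add1)
  then have lys: "length ys = c" by (simp add: ys_def)
  have xs: "xs = ys @ zs" by (simp add: ys_def zs_def)
  have ys: "map f ys = replicate c b" and zs: "map f zs = expand bs"
    using m lys by (auto simp: xs)
  define a where "a = length (filter Q ys)"
  have a: "a \<le> c" "k = a + length (filter Q zs)" 
    using Cons.prems(2) lys by (auto simp: a_def xs)
  obtain bs' zs' where IH: "bs' \<in> set (splits bs (k - a))" "distinct zs'" "set zs' = set zs" "map (\<lambda>x. Q x # f x) zs' = expand bs'"
    using Cons.IH[OF zs refl] a Cons.prems(3) by (auto simp: xs)
  have fb: "f x = b" if "x \<in> set ys" for x
    using ys that by (metis in_set_replicate length_pos_if_in_set list.set_map imageI)
  have "length (filter (\<lambda>x. \<not> Q x) ys) = c - a"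
    using sum_length_filter_compl[of Q ys] lys by (simp add: a_def)
  then have "map (\<lambda>x. Q x # f x) (filter Q ys @ filter (\<lambda>x. \<not> Q x) ys @ zs') =
      expand (block (True # b) a (block (False # b) (c - a) bs'))"
    using IH(4) fb by (auto simp: a_def intro!: replicate_eqI)
  moreover have "block (True # b) a (block (False # b) (c - a) bs') \<in> set (splits (bc # bs) k)"
    using split_one[OF a(1) _ IH(1), of b 0] a(2) by (simp add: bc)
  moreover have "distinct (filter Q ys @ filter (\<lambda>x. \<not> Q x) ys @ zs')"
    "set (filter Q ys @ filter (\<lambda>x. \<not> Q x) ys @ zs') = set xs"
    using IH(2,3) Cons.prems(3) by (auto simp: xs)
  ultimately show ?case by blast
qed

lemma length_filter_card: "distinct xs \<Longrightarrow> length (filter Q xs) = card {x\<in>set xs. Q x}"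
  by (metis distinct_card distinct_filter set_filter)

lemma represents_split:
  assumes "represents Ss R bs" "S \<subseteq> R" "card S = k"
  shows "\<exists>bs'\<in>set (splits bs k). represents (S # Ss) R bs'"
proof -
  obtain xs where xs: "distinct xs" "set xs = R" "map (\<lambda>x. map (\<lambda>S. x \<in> S) Ss) xs = expand bs"
    using assms(1) unfolding represents_def types_def by blast
  have "{x\<in>set xs. x \<in> S} = S" using xs assms by auto
  then have "length (filter (\<lambda>x. x \<in> S) xs) = k" using length_filter_card[OF xs(1)] assms(3) by simp
  from splits_sound[OF xs(3) this xs(1)] obtain bs' xs' where "bs' \<in> set (splits bs k)" "distinct xs'" "set xs' = set xs"
    "map (\<lambda>x. (x \<in> S) # map (\<lambda>S. x \<in> S) Ss) xs' = expand bs'" by blast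
  then show ?thesis using xs unfolding represents_def types_def by auto
qed

lemma andl_map: "andl (map f xs) (map g xs) = map (\<lambda>x. f x \<and> g x) xs"
  by (induction xs) auto

lemma andl_mask [simp]: "andl (mask xs a) (mask xs b) = mask xs (a \<inter> b)"
  by (simp add: mask_def andl_map)

lemma many_map: "many k (map n xs) (map a xs) \<longleftrightarrow> k \<le> length (filter (\<lambda>x. n x \<and> a x) xs)"
proof (induction xs arbitrary: k)
  case Nil
  then show ?case by (cases k) auto
next
  case (Cons x xs)
  then show ?case by (cases k) auto
qed

lemma covered_mask: "covered (mask xs a) (mask xs b) (mask xs c) \<longleftrightarrow> set xs \<subseteq> a \<union> b \<union> c"
  by (induction xs) (auto simp: mask_def)

lemma groups_sound:
  assumes P12: "\<And>A B C. P A B C \<Longrightarrow> P B A C" and P23: "\<And>A B C. P A B C \<Longrightarrow> P A C B"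
    and Pk: "\<And>A B C. P A B C \<Longrightarrow> k \<le> length (filter (\<lambda>x. n x \<and> x \<in> A) xs)"
    and Pc: "\<And>A B C. P A B C \<Longrightarrow> set xs \<subseteq> A \<union> B \<union> C"
  shows "(\<And>A B C Q. P A B C \<Longrightarrow> Q \<in> set Qs \<Longrightarrow> A \<subseteq> Q \<or> B \<subseteq> Q \<or> C \<subseteq> Q) \<Longrightarrow> P A B C \<Longrightarrow>
    A \<subseteq> a \<Longrightarrow> B \<subseteq> b \<Longrightarrow> C \<subseteq> c \<Longrightarrow> (l = 0 \<longrightarrow> a = b \<and> b = c) \<Longrightarrow> (l = Suc 0 \<longrightarrow> b = c) \<Longrightarrow>
    \<exists>A' B' C' a' b' c'. P A' B' C' \<and> A' \<subseteq> a' \<and> B' \<subseteq> b' \<and> C' \<subseteq> c' \<and>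
      (mask xs a', mask xs b', mask xs c') \<in> set (groups l k (map n xs) (map (mask xs) Qs) (mask xs a) (mask xs b) (mask xs c))"
proof (induction Qs arbitrary: l A B C a b c)
  case Nil
  have "set xs \<subseteq> a \<union> b \<union> c" using Pc[OF Nil(2)] Nil(3-5) by blast
  then have "(mask xs a, mask xs b, mask xs c) \<in> set (groups l k (map n xs) [] (mask xs a) (mask xs b) (mask xs c))"
    by (simp add: covered_mask)
  then show ?case using Nil(2-5) unfolding list.map by blast
next
  case (Cons Q Qs)
  have mn: "many k (map n xs) (mask xs (a \<inter> Q))" if "P A B C" "A \<subseteq> a" "A \<subseteq> Q" for A B C a
  proof -
    have "length (filter (\<lambda>x. n x \<and> x \<in> A) xs) \<le> length (filter (\<lambda>x. n x \<and> x \<in> a \<inter> Q) xs)"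
      using that(2,3) by (induction xs) auto
    then show ?thesis unfolding mask_def many_map using Pk[OF that(1)] by linarith
  qed
  have Q: "A \<subseteq> Q \<or> B \<subseteq> Q \<or> C \<subseteq> Q" using Cons.prems(1)[OF Cons.prems(2)] by auto
  define good where "good X \<longleftrightarrow> (\<exists>A' B' C' a' b' c'. P A' B' C' \<and> A' \<subseteq> a' \<and> B' \<subseteq> b' \<and> C' \<subseteq> c' \<and>
      (mask xs a', mask xs b', mask xs c') \<in> X)" for X
  have good_mono: "good Y" if "good X" "X \<subseteq> Y" for X Y using that unfolding good_def by blast
  have PQ: "A \<subseteq> Q \<or> B \<subseteq> Q \<or> C \<subseteq> Q" if "P A B C" "Q \<in> set Qs" for A B C Q
    using Cons.prems(1)[OF that(1)] that(2) by simp
  have IH: "good (set (groups l k (map n xs) (map (mask xs) Qs) (mask xs a) (mask xs b) (mask xs c)))"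
    if "P A B C" "A \<subseteq> a" "B \<subseteq> b" "C \<subseteq> c" "l = 0 \<longrightarrow> a = b \<and> b = c" "l = Suc 0 \<longrightarrow> b = c" for A B C a b c l
    unfolding good_def using Cons.IH[OF PQ that] .
  have P3: "P A B C" "P B A C" "P C B A" "P A C B" "P C A B" using Cons.prems(2) P12 P23 by blast+
  note s = Cons.prems(3-5) and l = Cons.prems(6,7)
  let ?N = "map n xs" and ?M = "map (mask xs) Qs"
  have "good (set (groups l k ?N (mask xs Q # ?M) (mask xs a) (mask xs b) (mask xs c)))"
  proof (cases l)
    case 0
    have e: "b = a" "c = a" using l 0 by auto
    have one: ?thesis if A': "P A' B' C'" "A' \<subseteq> Q" "A' \<subseteq> a" "B' \<subseteq> a" "C' \<subseteq> a" for A' B' C'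
    proof (rule good_mono)
      show "good (set (groups (Suc 0) k ?N ?M (mask xs (a \<inter> Q)) (mask xs b) (mask xs c)))"
        by (rule IH[OF A'(1)]) (use A' e in auto)
      show "set (groups (Suc 0) k ?N ?M (mask xs (a \<inter> Q)) (mask xs b) (mask xs c)) \<subseteq>
          set (groups l k ?N (mask xs Q # ?M) (mask xs a) (mask xs b) (mask xs c))"
        using mn[OF A'(1,3,2)] 0 by simp
    qed
    have s': "A \<subseteq> a" "B \<subseteq> a" "C \<subseteq> a" using s e by auto
    show ?thesis using Q one[OF P3(1) _ s'(1,2,3)] one[OF P3(2) _ s'(2,1,3)] one[OF P3(3) _ s'(3,2,1)] by blast
  next
    case l1: (Suc l')
    have A: ?thesis if q: "A \<subseteq> Q"
    proof (rule good_mono)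
      show "good (set (groups l k ?N ?M (mask xs (a \<inter> Q)) (mask xs b) (mask xs c)))"
        by (rule IH[OF P3(1)]) (use s q l l1 in auto)
      show "set (groups l k ?N ?M (mask xs (a \<inter> Q)) (mask xs b) (mask xs c)) \<subseteq>
          set (groups l k ?N (mask xs Q # ?M) (mask xs a) (mask xs b) (mask xs c))"
        using mn[OF P3(1) s(1) q] l1 by (cases l') auto
    qed
    show ?thesis
    proof (cases l')
      case 0
      have e: "c = b" using l l1 0 by auto
      have two: ?thesis if B': "P A B' C'" "B' \<subseteq> Q" "B' \<subseteq> b" "C' \<subseteq> b" for B' C'
      proof (rule good_mono)
        show "good (set (groups (Suc (Suc 0)) k ?N ?M (mask xs a) (mask xs (b \<inter> Q)) (mask xs c)))"
          by (rule IH[OF B'(1)]) (use B' s e in auto)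
        show "set (groups (Suc (Suc 0)) k ?N ?M (mask xs a) (mask xs (b \<inter> Q)) (mask xs c)) \<subseteq>
            set (groups l k ?N (mask xs Q # ?M) (mask xs a) (mask xs b) (mask xs c))"
          using mn[OF P12[OF B'(1)] B'(3,2)] l1 0 by simp
      qed
      have s': "B \<subseteq> b" "C \<subseteq> b" using s e by auto
      show ?thesis using Q A two[OF P3(1) _ s'(1,2)] two[OF P3(4) _ s'(2,1)] by blast
    next
      case l2: (Suc l'')
      have B: ?thesis if q: "B \<subseteq> Q"
      proof (rule good_mono)
        show "good (set (groups l k ?N ?M (mask xs a) (mask xs (b \<inter> Q)) (mask xs c)))"
          by (rule IH[OF P3(1)]) (use s q l1 l2 in auto)
        show "set (groups l k ?N ?M (mask xs a) (mask xs (b \<inter> Q)) (mask xs c)) \<subseteq>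
            set (groups l k ?N (mask xs Q # ?M) (mask xs a) (mask xs b) (mask xs c))"
          using mn[OF P3(2) s(2) q] l1 l2 by auto
      qed
      have C: ?thesis if q: "C \<subseteq> Q"
      proof (rule good_mono)
        show "good (set (groups l k ?N ?M (mask xs a) (mask xs b) (mask xs (c \<inter> Q))))"
          by (rule IH[OF P3(1)]) (use s q l1 l2 in auto)
        show "set (groups l k ?N ?M (mask xs a) (mask xs b) (mask xs (c \<inter> Q))) \<subseteq>
            set (groups l k ?N (mask xs Q # ?M) (mask xs a) (mask xs b) (mask xs c))"
          using mn[OF P3(3) s(3) q] l1 l2 by auto
      qed
      show ?thesis using Q A B C by blast
    qed
  qed
  then show ?case unfolding good_def by simp
qed

lemma set_consall: "set (consall x ys) = (#) x ` set ys"
  by (induction ys) auto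

lemma colourings_sound:
  assumes "\<And>x. x \<in> set xs \<Longrightarrow> (col x = P0 \<longrightarrow> x \<in> a) \<and> (col x = P1 \<longrightarrow> x \<in> b) \<and> (col x = P2 \<longrightarrow> x \<in> c)"
    and "length (filter (\<lambda>x. n x \<and> col x = P0) xs) \<le> i" "length (filter (\<lambda>x. n x \<and> col x = P1) xs) \<le> j"
      "length (filter (\<lambda>x. n x \<and> col x = P2) xs) \<le> k"
  shows "map col xs \<in> set (colourings (map n xs) (mask xs a) (mask xs b) (mask xs c) i j k)"
  using assms
proof (induction xs arbitrary: i j k)
  case (Cons x xs)
  have IH: "map col xs \<in> set (colourings (map n xs) (mask xs a) (mask xs b) (mask xs c) i j k)"
    if "length (filter (\<lambda>x. n x \<and> col x = P0) xs) \<le> i" "length (filter (\<lambda>x. n x \<and> col x = P1) xs) \<le> j"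
      "length (filter (\<lambda>x. n x \<and> col x = P2) xs) \<le> k" for i j k
    using Cons.IH[OF _ that] Cons.prems(1) by simp
  have m: "mask (x # xs) S = (x \<in> S) # mask xs S" for S by (simp add: mask_def)
  have x: "(col x = P0 \<longrightarrow> x \<in> a) \<and> (col x = P1 \<longrightarrow> x \<in> b) \<and> (col x = P2 \<longrightarrow> x \<in> c)" using Cons.prems(1) by simp
  show ?case
  proof (cases "n x")
    case True
    show ?thesis
    proof (cases "col x")
      case P0
      then obtain i' where "i = Suc i'" using Cons.prems(2) True by (cases i) auto
      then show ?thesis using IH[of i' j k] Cons.prems(2-4) x P0 True by (simp add: m set_consall)
    next
      case P1
      then obtain j' where "j = Suc j'" using Cons.prems(3) True by (cases j) auto
      then show ?thesis using IH[of i j' k] Cons.prems(2-4) x P1 True by (simp add: m set_consall)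
    next
      case P2
      then obtain k' where "k = Suc k'" using Cons.prems(4) True by (cases k) auto
      then show ?thesis using IH[of i j k'] Cons.prems(2-4) x P2 True by (simp add: m set_consall)
    qed
  next
    case False
    then show ?thesis using IH[of i j k] Cons.prems(2-4) x 
      by (cases "col x") (simp_all add: m set_consall)
  qed
qed (simp add: mask_def)

lemma notpart_map: "notpart p q = map (\<lambda>y. y \<noteq> p) q"
proof (induction q)
  case (Cons y q)
  then show ?case by (cases p; cases y) auto
qed simp

lemma viewmat_map: "viewmat q = map (\<lambda>x. map (\<lambda>y. y \<noteq> x) q) q"
proof -
  have "partrows p (notpart P0 q) (notpart P1 q) (notpart P2 q) = map (\<lambda>x. map (\<lambda>y. y \<noteq> x) q) p" for p
  proof (induction p)
    case (Cons x p)
    then show ?case by (cases x) (auto simp: notpart_map)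
  qed simp
  then show ?thesis by (simp add: viewmat_def)
qed

lemma set_mats: "set (mats qs) = viewmat ` set qs"
  by (induction qs) auto

lemma set_group_mats: "set (group_mats N gs) =
    (\<Union>(a, b, c)\<in>set gs. viewmat ` set (colourings N a b c (Suc (Suc 0)) (Suc (Suc 0)) (Suc (Suc 0))))"
  by (induction N gs rule: group_mats.induct) (auto simp: set_mats)

lemma set_sort_lists: "set (sort_lists xs) = set xs"
proof -
  have "set (ins x ys) = insert x (set ys)" for x :: "'b list" and ys by (induction ys) auto
  then show ?thesis by (induction xs) auto
qed

lemma set_prune: "set (prune ks bss) = {bs\<in>set bss. feasible ks [] (rows ks (expand bs))}"
  by (induction bss) auto

lemma set_extend: "set (extend ks k bss) = (\<Union>bs\<in>set bss. set (prune ks (splits bs k)))"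
  by (induction bss) auto

lemma cnt_filter: "cnt (map f xs) = length (filter f xs)"
  by (induction xs) auto

lemma drow_minus: "drow d a = d - cnt a"
  by (induction d a rule: drow.induct) auto

section \<open>Soundness of the search for an actual view system\<close>

context view_system begin

text \<open>Matrices that allow at least all pairs in \<open>E\<close>. The degree tests need no
  more, because an upper bound on degrees gives lower bounds on \<open>t\<close>.\<close>

definition sound :: "'a list \<Rightarrow> bool list list \<Rightarrow> bool" where
  "sound xs M \<longleftrightarrow> (\<exists>f. M = map (\<lambda>x. map (f x) xs) xs \<and> (\<forall>x\<in>R. \<forall>y\<in>R. E x y \<longrightarrow> f x y))"

lemma sound_andm:
  assumes "sound xs M" "sound xs N" shows "sound xs (andm M N)"
proof -
  obtain f g where f: "M = map (\<lambda>x. map (f x) xs) xs" "\<forall>x\<in>R. \<forall>y\<in>R. E x y \<longrightarrow> f x y"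
    and g: "N = map (\<lambda>x. map (g x) xs) xs" "\<forall>x\<in>R. \<forall>y\<in>R. E x y \<longrightarrow> g x y"
    using assms unfolding sound_def by blast
  have "andm (map (\<lambda>x. map (f x) xs) ys) (map (\<lambda>x. map (g x) xs) ys) = map (\<lambda>x. map (\<lambda>y. f x y \<and> g x y) xs) ys" for ys
    by (induction ys) (auto simp: andl_map)
  from this[of xs] show ?thesis unfolding sound_def f(1) g(1)
    by (intro exI[of _ "\<lambda>x y. f x y \<and> g x y"] conjI) (use f(2) g(2) in blast)+
qed

lemma view_groups_sound:
  assumes xs: "distinct xs" "set xs = R" and p: "p \<in> I" "k + t p \<le> 2" and ps: "set ps \<subseteq> I - {p}"
  obtains A B C a b c where "parts p A B C" "A \<subseteq> a" "B \<subseteq> b" "C \<subseteq> c"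
    "(mask xs a, mask xs b, mask xs c) \<in> set (view_groups k (mask xs (T p)) (map (\<lambda>q. mask xs (T q)) ps))"
proof -
  obtain A B C where P: "parts p A B C" using parts_exist[OF p(1)] .
  have k: "k \<le> length (filter (\<lambda>x. x \<notin> T p \<and> x \<in> A) xs)" if "parts p A B C" for A B C
  proof -
    have "{x\<in>set xs. x \<notin> T p \<and> x \<in> A} = A - T p" using parts_sub(1)[OF that] xs by auto
    then show ?thesis using length_filter_card[OF xs(1)] parts_K1(1)[OF that p(1)] p(2) by simp
  qed
  have Pc: "set xs \<subseteq> A \<union> B \<union> C" if "parts p A B C" for A B C using that xs unfolding parts_def by auto
  have PQ: "A \<subseteq> Q \<or> B \<subseteq> Q \<or> C \<subseteq> Q" if "parts p A B C" "Q \<in> set (map T ps)" for A B C Q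
    using parts_in[OF that(1)] that(2) ps by auto
  have o: "ones (mask xs (T p)) = mask xs UNIV" by (simp add: ones_map mask_def)
  have n: "notl (mask xs (T p)) = map (\<lambda>x. x \<notin> T p) xs" by (simp add: mask_def)
  have "\<exists>A' B' C' a' b' c'. parts p A' B' C' \<and> A' \<subseteq> a' \<and> B' \<subseteq> b' \<and> C' \<subseteq> c' \<and>
      (mask xs a', mask xs b', mask xs c') \<in> set (view_groups k (mask xs (T p)) (map (\<lambda>q. mask xs (T q)) ps))"
    unfolding view_groups_def o n
    using groups_sound[where P = "parts p" and Qs = "map T ps" and l = 0 and a = UNIV and b = UNIV and c = UNIV,
      OF parts_12 parts_23 k Pc PQ P] by (simp add: o_def)
  then show ?thesis using that by blast
qed

lemma feasible_sound:
  assumes xs: "distinct xs" "set xs = R" 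
  shows "list_all2 (\<lambda>k p. k + t p \<le> 2) ks ps \<Longrightarrow> set (qs @ ps) \<subseteq> I \<Longrightarrow> distinct (qs @ ps) \<Longrightarrow>
    feasible ks (map (\<lambda>q. mask xs (T q)) qs) (map (\<lambda>q. mask xs (T q)) ps)"
proof (induction ks ps arbitrary: qs rule: list_all2_induct)
  case (Cons k ks p ps)
  have "p \<in> I" "set (qs @ ps) \<subseteq> I - {p}" using Cons.prems by auto
  from view_groups_sound[OF xs this(1) Cons.hyps(1) this(2)]
  obtain g where "g \<in> set (view_groups k (mask xs (T p)) (map (\<lambda>q. mask xs (T q)) (qs @ ps)))" .
  moreover have "feasible ks (map (\<lambda>q. mask xs (T q)) (p # qs)) (map (\<lambda>q. mask xs (T q)) ps)"
    using Cons.prems by (intro Cons.IH) auto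
  ultimately show ?case by (auto split: list.split)
qed simp

lemma views_sound:
  assumes xs: "distinct xs" "set xs = R" 
  shows "list_all2 (\<lambda>k p. k + t p \<le> 2) ks ps \<Longrightarrow> set (qs @ ps) \<subseteq> I \<Longrightarrow> distinct (qs @ ps) \<Longrightarrow>
    V \<in> set (views ks (map (\<lambda>q. mask xs (T q)) qs) (map (\<lambda>q. mask xs (T q)) ps)) \<Longrightarrow> \<exists>M\<in>set V. sound xs M"
proof (induction ks ps arbitrary: qs rule: list_all2_induct)
  case (Cons k ks p ps)
  show ?case
  proof (cases "V \<in> set (views ks (map (\<lambda>q. mask xs (T q)) (p # qs)) (map (\<lambda>q. mask xs (T q)) ps))")
    case True
    then show ?thesis using Cons.prems by (intro Cons.IH[of "p # qs"]) auto
  next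
    case False
    then have V: "V = group_mats (notl (mask xs (T p))) (view_groups k (mask xs (T p)) (map (\<lambda>q. mask xs (T q)) (qs @ ps)))"
      using Cons.prems(3) by auto
    have p: "p \<in> I" "set (qs @ ps) \<subseteq> I - {p}" using Cons.prems by auto
    from view_groups_sound[OF xs p(1) Cons.hyps(1) p(2)]
    obtain A B C a b c where P: "parts p A B C" "A \<subseteq> a" "B \<subseteq> b" "C \<subseteq> c"
      and g: "(mask xs a, mask xs b, mask xs c) \<in> set (view_groups k (mask xs (T p)) (map (\<lambda>q. mask xs (T q)) (qs @ ps)))" .
    define col where "col x = (if x \<in> A then P0 else if x \<in> B then P1 else P2)" for x
    have R: "A \<union> B \<union> C = R" "A \<inter> B = {}" "A \<inter> C = {}" "B \<inter> C = {}" using P(1) unfolding parts_def by auto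
    have col: "col x = P0 \<longleftrightarrow> x \<in> A" "col x = P1 \<longleftrightarrow> x \<in> B" "col x = P2 \<longleftrightarrow> x \<in> C" if "x \<in> R" for x
      using that R by (auto simp: col_def)
    have sz: "length (filter (\<lambda>x. x \<notin> T p \<and> col x = c) xs) \<le> Suc (Suc 0)" if "{x\<in>R. x \<notin> T p \<and> col x = c} = X - T p" "card (X - T p) \<le> 2" for c X
      using length_filter_card[OF xs(1)] that xs(2) by simp
    have le2: "card (A - T p) \<le> 2" "card (B - T p) \<le> 2" "card (C - T p) \<le> 2" using P(1) unfolding parts_def by auto
    have "map col xs \<in> set (colourings (map (\<lambda>x. x \<notin> T p) xs) (mask xs a) (mask xs b) (mask xs c) (Suc (Suc 0)) (Suc (Suc 0)) (Suc (Suc 0)))"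
    proof (rule colourings_sound)
      show "(col x = P0 \<longrightarrow> x \<in> a) \<and> (col x = P1 \<longrightarrow> x \<in> b) \<and> (col x = P2 \<longrightarrow> x \<in> c)" if "x \<in> set xs" for x
        using that xs(2) col P(2-4) by auto
      have Q: "{x\<in>R. x \<notin> T p \<and> col x = P0} = A - T p" "{x\<in>R. x \<notin> T p \<and> col x = P1} = B - T p"
        "{x\<in>R. x \<notin> T p \<and> col x = P2} = C - T p" using col R(1) by auto
      show "length (filter (\<lambda>x. x \<notin> T p \<and> col x = P0) xs) \<le> Suc (Suc 0)"
        "length (filter (\<lambda>x. x \<notin> T p \<and> col x = P1) xs) \<le> Suc (Suc 0)"
        "length (filter (\<lambda>x. x \<notin> T p \<and> col x = P2) xs) \<le> Suc (Suc 0)" using sz[OF Q(1) le2(1)] sz[OF Q(2) le2(2)] sz[OF Q(3) le2(3)] .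
    qed
    moreover have "notl (mask xs (T p)) = map (\<lambda>x. x \<notin> T p) xs" by (simp add: mask_def)
    ultimately have "viewmat (map col xs) \<in> set V"
      unfolding V set_group_mats by (intro UN_I[OF g]) simp
    moreover have "sound xs (viewmat (map col xs))"
      unfolding sound_def
    proof (intro exI conjI ballI impI)
      show "viewmat (map col xs) = map (\<lambda>x. map ((\<lambda>x y. col y \<noteq> col x) x) xs) xs" by (simp add: viewmat_map o_def)
      fix x y assume "x \<in> R" "y \<in> R" "E x y"
      then show "col y \<noteq> col x" using parts_indep[OF P(1)] col[of x] col[of y] unfolding indep_def
        by (cases "col x") auto
    qed
    ultimately show ?thesis by blast
  qed
qed simp

lemma represents_feasible:
  assumes "represents (map T ps) R bs" "set ps \<subseteq> I" "distinct ps" "list_all2 (\<lambda>k p. k + t p \<le> 2) ks ps"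
  shows "feasible ks [] (rows ks (expand bs))"
proof -
  obtain xs where xs: "distinct xs" "set xs = R" "types (map T ps) xs = expand bs"
    using assms(1) unfolding represents_def by blast
  have "rows ks (expand bs) = map (\<lambda>q. mask xs (T q)) ps"
    using rows_types[of ks "map T ps" xs] assms(4) xs(3) by (simp add: list_all2_lengthD o_def)
  then show ?thesis using feasible_sound[OF xs(1,2) assms(4), of "[]"] assms(2,3) by simp
qed

text \<open>One step in generating \<open>sys9\<close> and \<open>sys10\<close>: the actual system
  remains represented after a member is added and the infeasible lists are removed.\<close>

lemma represents_extend:
  assumes "\<exists>bs\<in>set bss. represents (map T ps) R bs" "p # ps = ps'" "set ps' \<subseteq> I" "distinct ps'"
    "list_all2 (\<lambda>k p. k + t p \<le> 2) ks ps'" "card (T p) = k"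
  shows "\<exists>bs\<in>set (extend ks k bss). represents (map T ps') R bs"
proof -
  obtain bs where bs: "bs \<in> set bss" "represents (map T ps) R bs" using assms(1) by blast
  have "T p \<subseteq> R" using T_sub[of p] assms(2,3) by auto
  from represents_split[OF bs(2) this assms(6)] obtain bs' where
    bs': "bs' \<in> set (splits bs k)" "represents (map T ps') R bs'" using assms(2) by auto
  have "bs' \<in> set (prune ks (splits bs k))" using represents_feasible[OF bs'(2) assms(3-5)] bs'(1) by (simp add: set_prune)
  then show ?thesis using bs(1) bs'(2) by (auto simp: set_extend)
qed


lemma degrees_ok_sound:
  fixes side :: "'a \<Rightarrow> bool" and e :: "'a \<Rightarrow> bool list"
  assumes xs: "distinct xs" "set xs = R" and f: "\<forall>x\<in>R. \<forall>y\<in>R. E x y \<longrightarrow> f x y"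
    and d: "\<And>x. x \<in> R \<Longrightarrow> d x = dg x + t x" and c: "\<And>x. x \<in> R \<Longrightarrow> t x \<le> (if side x then c else c')"
  shows "set ys \<subseteq> R \<Longrightarrow> sum_list (map t (filter side ys)) \<le> b \<Longrightarrow> sum_list (map t (filter (\<lambda>x. \<not> side x) ys)) \<le> b' \<Longrightarrow>
    degrees_ok c c' (map (\<lambda>x. (side x, d x, e x)) ys) (map (\<lambda>x. map (f x) xs) ys) b b'"
proof (induction ys arbitrary: b b')
  case (Cons x ys)
  have x: "x \<in> R" using Cons.prems(1) by auto
  have "{y\<in>R. E x y} \<subseteq> {y\<in>set xs. f x y}" using f x xs(2) by auto
  then have "dg x \<le> cnt (map (f x) xs)"
    unfolding cnt_filter length_filter_card[OF xs(1)] dg_def by (intro card_mono) auto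
  then have i: "drow (d x) (map (f x) xs) \<le> t x" using d[OF x] by (simp add: drow_minus)
  have ys: "set ys \<subseteq> R" using Cons.prems(1) by auto
  show ?case
  proof (cases "drow (d x) (map (f x) xs)")
    case 0
    then show ?thesis using Cons.IH[OF ys, of b b'] Cons.prems(2,3) by (auto split: if_splits)
  next
    case (Suc j)
    then show ?thesis using Cons.IH[OF ys, of "b - Suc j" b'] Cons.IH[OF ys, of b "b' - Suc j"] Cons.prems(2,3) i c[OF x]
      by (cases "side x") auto
  qed
qed simp

text \<open>The branch that always picks the matrix of an actual view keeps a sound matrix, so it
  passes every test.\<close>

lemma search_sound:
  assumes ok: "\<And>M. sound xs M \<Longrightarrow> degrees_ok c c' ds M b b'" and tw: "\<And>M. sound xs M \<Longrightarrow> twin_free w ds M"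
  shows "sound xs A \<Longrightarrow> \<exists>M\<in>set V. sound xs M \<Longrightarrow> (\<And>W. W \<in> set Vs \<Longrightarrow> \<exists>M\<in>set W. sound xs M) \<Longrightarrow>
    search w c c' b b' ds A V Vs"
proof (induction Vs arbitrary: A V)
  case Nil
  note A = Nil(1)
  show ?case using Nil(2)
  proof (induction V)
    case (Cons M V)
    then show ?case using ok[OF sound_andm[OF A, of M]] tw[OF sound_andm[OF A, of M]] by auto
  qed simp
next
  case (Cons W Ws)
  note A = Cons.prems(1)
  have W: "search w c c' b b' ds (andm A M) W Ws" if "sound xs M" for M
    using Cons.IH[OF sound_andm[OF A that]] Cons.prems(3) by auto
  show ?case using Cons.prems(2)
  proof (induction V)
    case (Cons M V)
    then show ?case using ok[OF sound_andm[OF A, of M]] W[of M] by auto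
  qed simp
qed

lemma searchl_sound:
  assumes ok: "\<And>M. sound xs M \<Longrightarrow> degrees_ok c c' ds M b b'" and tw: "\<And>M. sound xs M \<Longrightarrow> twin_free w ds M"
    and A: "sound xs A" and Vs: "\<And>W. W \<in> set Vs \<Longrightarrow> \<exists>M\<in>set W. sound xs M"
  shows "searchl w c c' b b' ds A Vs"
proof (cases Vs)
  case (Cons V Ws)
  then show ?thesis using search_sound[OF ok tw A, of V Ws] Vs by auto
qed simp

lemma types_at: "cnt (map (\<lambda>S. x \<in> S) (map T ps)) = card {p\<in>set ps. x \<in> T p}" if "distinct ps"
  using length_filter_card[OF that] by (simp add: cnt_filter o_def)

lemma demands_map:
  "demands d (map side xs) (types Ss xs) =
     map (\<lambda>x. (side x, cnt (map (\<lambda>S. x \<in> S) Ss) + d, map (\<lambda>S. x \<in> S) Ss)) xs"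
  by (induction xs) (auto simp: types_def)

lemma represents_possible:
  assumes "represents (map T ps) R bs" "set ps = I" "distinct ps" "list_all2 (\<lambda>k p. k + t p \<le> 2) ks ps"
    and d: "d + card I = 6" and t: "\<And>x. x \<in> R \<Longrightarrow> t x \<le> c" "sum t R \<le> b"
  shows "possible ks d c b (expand bs)"
proof -
  obtain xs where xs: "distinct xs" "set xs = R" "types (map T ps) xs = expand bs"
    using assms(1) unfolding represents_def by blast
  have rows: "rows ks (expand bs) = map (\<lambda>q. mask xs (T q)) ps"
    using rows_types[of ks "map T ps" xs] assms(4) xs(3) by (simp add: list_all2_lengthD o_def)
  have dm: "demands d (copies True (expand bs)) (expand bs) = map (\<lambda>x. (True, cnt (map (\<lambda>S. x \<in> S) (map T ps)) + d, map (\<lambda>S. x \<in> S) (map T ps))) xs"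
    using demands_map[of d "\<lambda>_. True" xs "map T ps"] by (simp add: copies_map types_def comp_def flip: xs(3))
  have deg': "cnt (map (\<lambda>S. x \<in> S) (map T ps)) + d = dg x + t x" if "x \<in> R" for x
    unfolding types_at[OF assms(3)] assms(2) using deg[OF that] d by (simp add: dg_def)
  have sm: "sum_list (map t xs) = sum t R" using xs by (simp add: sum_list_distinct_conv_sum_set)
  have st: "sum_list (map t (filter (\<lambda>_. True) xs)) \<le> b" "sum_list (map t (filter (\<lambda>x. \<not> True) xs)) \<le> 0"
    using sm t(2) by auto
  show ?thesis unfolding possible_def
  proof (rule searchl_sound)
    show "degrees_ok c 0 (demands d (copies True (expand bs)) (expand bs)) M b 0" if M: "sound xs M" for M
    proof -
      obtain f where "M = map (\<lambda>x. map (f x) xs) xs" "\<forall>x\<in>R. \<forall>y\<in>R. E x y \<longrightarrow> f x y"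
        using M unfolding sound_def by blast
      then show ?thesis unfolding dm using deg' t(1) st xs(2)
        by (simp only:) (intro degrees_ok_sound[OF xs(1,2)], auto)
    qed
    show "twin_free None ds M" for ds M by simp
    show "sound xs (copies (copies True (expand bs)) (expand bs))"
      unfolding sound_def by (intro exI[of _ "\<lambda>_ _. True"]) (simp add: copies_map types_def flip: xs(3))
    show "\<exists>M\<in>set W. sound xs M" if "W \<in> set (sort_lists (views ks [] (rows ks (expand bs))))" for W
      using views_sound[OF xs(1,2) assms(4), of "[]" W] that assms(2,3) by (simp add: set_sort_lists rows)
  qed
qed

lemma any_possible_iff: "any_possible ks d c b bss \<longleftrightarrow> (\<exists>bs\<in>set bss. possible ks d c b (expand bs))"
  by (induction bss) auto

lemma any_extension_iff: "any_extension ks k d c b bss \<longleftrightarrow> (\<exists>bs\<in>set (extend ks k bss). possible ks d c b (expand bs))"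
  by (induction bss) (auto simp: any_possible_iff)

lemma set_retain: "set (retain ks d c b bss) = {bs\<in>set bss. possible ks d c b (expand bs)}"
  by (induction bss) auto


lemma both_map: "both (map f ps) (map g ps) n = n + length (filter (\<lambda>p. f p \<and> g p) ps)"
  by (induction ps) auto

lemma neither_map: "neither (map f xs) (map g xs) (map h xs) = length (filter (\<lambda>x. f x \<and> \<not> g x \<and> \<not> h x) xs)"
  by (induction xs) auto

lemma same_side_map:
  "same_side s (map (\<lambda>x. (side x, d x, e x)) ys) (map row ys) = map (\<lambda>x. (e x, row x)) (filter (\<lambda>x. side x = s) ys)"
  by (cases s; induction ys) auto

lemma conflict_sound:
  assumes xs: "distinct xs" "set xs = R" and f: "\<forall>x\<in>R. \<forall>y\<in>R. E x y \<longrightarrow> f x y" and ps: "distinct ps" "set ps = I"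
    and H: "card {p\<in>I. x \<in> T p \<and> y \<in> T p} + card {v\<in>R. side v \<noteq> s \<and> \<not> E x v \<and> \<not> E y v} \<le> 1"
    and x: "x \<in> R" "y \<in> R"
  shows "\<not> conflict (map (\<lambda>v. side v \<noteq> s) xs) (map (\<lambda>p. x \<in> T p) ps, map (f x) xs) (map (\<lambda>p. y \<in> T p) ps, map (f y) xs)"
proof -
  have "{v\<in>set xs. side v \<noteq> s \<and> \<not> f x v \<and> \<not> f y v} \<subseteq> {v\<in>R. side v \<noteq> s \<and> \<not> E x v \<and> \<not> E y v}"
    using f x xs(2) by auto
  then have "card {v\<in>set xs. side v \<noteq> s \<and> \<not> f x v \<and> \<not> f y v} \<le> card {v\<in>R. side v \<noteq> s \<and> \<not> E x v \<and> \<not> E y v}"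
    by (intro card_mono) (auto simp: finR)
  then show ?thesis using H ps(2)
    by (simp add: both_map neither_map length_filter_card[OF ps(1)] length_filter_card[OF xs(1)])
qed

lemma two_conflicts_length: "two_conflicts r l \<Longrightarrow> length l = 4"
  by (cases "(r, l)" rule: two_conflicts.cases) auto

lemma twins_sound:
  fixes side :: "'a \<Rightarrow> bool"
  assumes xs: "distinct xs" "set xs = R" and f: "\<forall>x\<in>R. \<forall>y\<in>R. E x y \<longrightarrow> f x y" and ps: "distinct ps" "set ps = I"
    and d: "\<And>x. x \<in> R \<Longrightarrow> d x = dg x + t x"
    and side: "\<And>s. sum t {x\<in>R. side x = s} \<le> 3"
    and H: "\<And>x y. x \<in> R \<Longrightarrow> y \<in> R \<Longrightarrow> x \<noteq> y \<Longrightarrow> side x = side y \<Longrightarrow> t x = 0 \<Longrightarrow> t y = 0 \<Longrightarrow>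
      card {p\<in>I. x \<in> T p \<and> y \<in> T p} + card {v\<in>R. side v \<noteq> side x \<and> \<not> E x v \<and> \<not> E y v} \<le> 1"
  shows "distinct (zs @ ys) \<Longrightarrow> set (zs @ ys) \<subseteq> R \<Longrightarrow>
    \<not> twins (map side xs) (map (\<lambda>x. \<not> side x) xs)
      (map (\<lambda>x. (side x, d x, map (\<lambda>p. x \<in> T p) ps)) zs) (map (\<lambda>x. map (f x) xs) zs)
      (map (\<lambda>x. (side x, d x, map (\<lambda>p. x \<in> T p) ps)) ys) (map (\<lambda>x. map (f x) xs) ys)"
proof (induction ys arbitrary: zs)
  case (Cons z ys)
  define s where "s = side z"
  define r where "r = (if s then map (\<lambda>x. \<not> side x) xs else map side xs)"
  have r: "r = map (\<lambda>v. side v \<noteq> s) xs" by (auto simp: r_def)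
  define F where "F x = (map (\<lambda>p. x \<in> T p) ps, map (f x) xs)" for x
  define l where "l = filter (\<lambda>x. side x = s) (rev zs @ ys)"
  have z: "z \<in> R" using Cons.prems(2) by auto
  have "{y\<in>R. E z y} \<subseteq> {y\<in>set xs. f z y}" using f z xs(2) by auto
  then have "dg z \<le> cnt (map (f z) xs)"
    unfolding cnt_filter length_filter_card[OF xs(1)] dg_def by (intro card_mono) auto
  then have dz: "drow (d z) (map (f z) xs) \<le> t z" using d[OF z] by (simp add: drow_minus)
  have no: "\<not> (2 \<le> drow (d z) (map (f z) xs) \<and> two_conflicts r (map F l))"
  proof
    assume a: "2 \<le> drow (d z) (map (f z) xs) \<and> two_conflicts r (map F l)"
    then have "length l = 4" using two_conflicts_length by fastforce
    then obtain x1 x2 x3 x4 where l: "l = [x1, x2, x3, x4]"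
      by (auto simp: numeral_eq_Suc length_Suc_conv)
    have dl: "distinct (z # l)" "set l \<subseteq> {x\<in>R. side x = s}" using Cons.prems unfolding l_def by auto
    have "sum t (set (z # l)) \<le> sum t {x\<in>R. side x = s}"
      using dl z finR by (intro sum_mono2) (auto simp: s_def)
    then have sm: "t z + t x1 + t x2 + t x3 + t x4 \<le> 3" using side[of s] dl(1) unfolding l by simp
    have C: "0 < t x + t y" if "conflict r (F x) (F y)" "x \<in> set l" "y \<in> set l" "x \<noteq> y" for x y
    proof (rule ccontr)
      assume "\<not> 0 < t x + t y"
      then have "card {p\<in>I. x \<in> T p \<and> y \<in> T p} + card {v\<in>R. side v \<noteq> s \<and> \<not> E x v \<and> \<not> E y v} \<le> 1"
        using H[of x y] that dl(2) by auto
      from conflict_sound[OF xs f ps this] show False using that dl(2) unfolding F_def r by auto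
    qed
    have "conflict r (F x1) (F x2) \<and> conflict r (F x3) (F x4) \<or> conflict r (F x1) (F x3) \<and> conflict r (F x2) (F x4) \<or>
      conflict r (F x1) (F x4) \<and> conflict r (F x2) (F x3)"
      using a unfolding l by (auto split: if_splits)
    then have "2 \<le> t x1 + t x2 + t x3 + t x4"
      using C[of x1 x2] C[of x3 x4] C[of x1 x3] C[of x2 x4] C[of x1 x4] C[of x2 x3] dl(1) unfolding l by auto
    then show False using sm dz a by linarith
  qed
  have "same_side s (map (\<lambda>x. (side x, d x, map (\<lambda>p. x \<in> T p) ps)) (rev zs @ ys)) (map (\<lambda>x. map (f x) xs) (rev zs @ ys)) = map F l"
    unfolding same_side_map F_def l_def by simp
  then show ?case using no Cons.IH[of "z # zs"] Cons.prems unfolding r_def s_def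
    by (auto simp: rev_map)
qed simp

text \<open>The side \<open>X\<close> is put in front of the sets \<open>T p\<close>, so that
  membership in it becomes the head of each type and splits blocks like one more member.\<close>

lemma represents_possible_bip:
  assumes "represents (X # map T ps) R bs" "set ps = I" "distinct ps" "list_all2 (\<lambda>k p. k + t p \<le> 2) ks ps"
    and X: "X \<subseteq> R" and d: "card I = 4" and bip: "\<And>x y. x \<in> R \<Longrightarrow> y \<in> R \<Longrightarrow> E x y \<Longrightarrow> (x \<in> X) \<noteq> (y \<in> X)"
    and t: "\<And>x. x \<in> X \<Longrightarrow> t x \<le> c" "\<And>x. x \<in> R - X \<Longrightarrow> t x \<le> c'" "sum t X \<le> b" "sum t (R - X) \<le> b'"
    and i: "sum m X = i"
    and w: "w \<Longrightarrow> b \<le> 3" "w \<Longrightarrow> b' \<le> 3"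
      "\<And>x y. w \<Longrightarrow> x \<in> R \<Longrightarrow> y \<in> R \<Longrightarrow> x \<noteq> y \<Longrightarrow> x \<in> X \<longleftrightarrow> y \<in> X \<Longrightarrow> t x = 0 \<Longrightarrow> t y = 0 \<Longrightarrow>
      card {p\<in>I. x \<in> T p \<and> y \<in> T p} + card {v\<in>R. (v \<in> X) \<noteq> (x \<in> X) \<and> \<not> E x v \<and> \<not> E y v} \<le> 1"
  shows "possible_bip w i c c' b b' ks (heads (expand bs)) (tails (expand bs))"
proof -
  obtain xs where xs: "distinct xs" "set xs = R" "types (X # map T ps) xs = expand bs"
    using assms(1) unfolding represents_def by blast
  have h: "heads (expand bs) = mask xs X" "tails (expand bs) = types (map T ps) xs" using xs(3) by (metis heads_tails)+
  have rows: "rows ks (types (map T ps) xs) = map (\<lambda>q. mask xs (T q)) ps"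
    using rows_types[of ks "map T ps" xs] assms(4) by (simp add: list_all2_lengthD o_def)
  define D where "D x = cnt (map (\<lambda>S. x \<in> S) (map T ps)) + Suc (Suc 0)" for x
  have dm: "demands (Suc (Suc 0)) (mask xs X) (types (map T ps) xs) = map (\<lambda>x. (x \<in> X, D x, map (\<lambda>p. x \<in> T p) ps)) xs"
    using demands_map[of "Suc (Suc 0)" "\<lambda>x. x \<in> X" xs "map T ps"] by (simp add: mask_def D_def comp_def)
  have deg': "D x = dg x + t x" if "x \<in> R" for x
    unfolding D_def types_at[OF assms(3)] assms(2) using deg[OF that] d by (simp add: dg_def)
  have sums: "sum_list (map t (filter (\<lambda>x. x \<in> X) xs)) \<le> b" "sum_list (map t (filter (\<lambda>x. x \<notin> X) xs)) \<le> b'"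
  proof -
    have "sum_list (map t (filter Q xs)) = sum t {x\<in>R. Q x}" for Q
      using xs by (simp add: sum_list_distinct_conv_sum_set)
    moreover have "{x\<in>R. x \<in> X} = X" "{x\<in>R. x \<notin> X} = R - X" using X by auto
    ultimately show "sum_list (map t (filter (\<lambda>x. x \<in> X) xs)) \<le> b" "sum_list (map t (filter (\<lambda>x. x \<notin> X) xs)) \<le> b'"
      using t(3,4) by simp_all
  qed
  have ok: "degrees_ok c c' (map (\<lambda>x. (x \<in> X, D x, map (\<lambda>p. x \<in> T p) ps)) xs) M b b'" if sM: "sound xs M" for M
  proof -
    obtain f where M: "M = map (\<lambda>x. map (f x) xs) xs" and f: "\<forall>x\<in>R. \<forall>y\<in>R. E x y \<longrightarrow> f x y"
      using sM unfolding sound_def by blast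
    show ?thesis unfolding M
      by (rule degrees_ok_sound[OF xs(1,2) f deg' _ _ sums]) (use t xs(2) in auto)
  qed
  have tw: "twin_free (if w then Some (mask xs X, notl (mask xs X)) else None) (map (\<lambda>x. (x \<in> X, D x, map (\<lambda>p. x \<in> T p) ps)) xs) M"
    if sM: "sound xs M" for M
  proof (cases w)
    case True
    obtain f where M: "M = map (\<lambda>x. map (f x) xs) xs" and f: "\<forall>x\<in>R. \<forall>y\<in>R. E x y \<longrightarrow> f x y"
      using sM unfolding sound_def by blast
    have "{x\<in>R. x \<in> X} = X" "{x\<in>R. x \<notin> X} = R - X" using X by auto
    then have s3: "sum t {x\<in>R. (x \<in> X) = s} \<le> 3" for s using t(3,4) w(1,2) True by (cases s) auto
    have "\<not> twins (map (\<lambda>x. x \<in> X) xs) (map (\<lambda>x. x \<notin> X) xs)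
      (map (\<lambda>x. (x \<in> X, D x, map (\<lambda>p. x \<in> T p) ps)) []) (map (\<lambda>x. map (f x) xs) [])
      (map (\<lambda>x. (x \<in> X, D x, map (\<lambda>p. x \<in> T p) ps)) xs) (map (\<lambda>x. map (f x) xs) xs)"
      by (rule twins_sound[OF xs(1,2) f assms(3,2) deg' s3 w(3)[OF True]]) (use xs(1,2) in simp_all)
    moreover have "notl (mask xs X) = map (\<lambda>x. x \<notin> X) xs" "mask xs X = map (\<lambda>x. x \<in> X) xs" by (simp_all add: mask_def)
    ultimately show ?thesis unfolding M using True by (simp only: if_True twin_free.simps list.map if_False)
  qed simp
  have A: "bip (mask xs X) (notl (mask xs X)) (mask xs X) = map (\<lambda>x. map (\<lambda>y. (x \<in> X) \<noteq> (y \<in> X)) xs) xs"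
  proof -
    have "bip r r' (mask ys X) = map (\<lambda>x. if x \<in> X then r' else r) ys" for r r' ys by (induction ys) (auto simp: mask_def)
    then show ?thesis by (auto simp: mask_def)
  qed
  have sA: "sound xs (bip (mask xs X) (notl (mask xs X)) (mask xs X))"
    unfolding sound_def A by (intro exI[of _ "\<lambda>x y. (x \<in> X) \<noteq> (y \<in> X)"]) (use bip in auto)
  have "incid (mask xs X) (types (map T ps) xs) = i"
  proof -
    have "incid (mask ys X) (types (map T ps) ys) = sum_list (map m (filter (\<lambda>x. x \<in> X) ys))" for ys
      using types_at[OF assms(3)] assms(2) by (induction ys) (auto simp: mask_def types_def m_def)
    moreover have "sum_list (map m (filter (\<lambda>x. x \<in> X) xs)) = sum m {x\<in>R. x \<in> X}"
      using xs by (simp add: sum_list_distinct_conv_sum_set)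
    moreover have "{x\<in>R. x \<in> X} = X" using X by auto
    ultimately show ?thesis using i by simp
  qed
  moreover have "searchl (if w then Some (mask xs X, notl (mask xs X)) else None) c c' b b'
      (map (\<lambda>x. (x \<in> X, D x, map (\<lambda>p. x \<in> T p) ps)) xs) (bip (mask xs X) (notl (mask xs X)) (mask xs X))
      (sort_lists (views ks [] (rows ks (types (map T ps) xs))))"
  proof (rule searchl_sound[OF ok tw sA])
    show "\<exists>M\<in>set W. sound xs M" if "W \<in> set (sort_lists (views ks [] (rows ks (types (map T ps) xs))))" for W
      using views_sound[OF xs(1,2) assms(4), of "[]" W] that assms(2,3) by (simp add: set_sort_lists rows)
  qed
  ultimately show ?thesis unfolding possible_bip_def h dm using ok[OF sA] by simp
qed

lemma any_possible_bip_iff: "any_possible_bip w i c c' b b' ks bss \<longleftrightarrow>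
    (\<exists>bs\<in>set bss. possible_bip w i c c' b b' ks (heads (expand bs)) (tails (expand bs)))"
  by (induction bss) simp_all

lemma any_bip_extension_iff: "any_bip_extension w i k c c' b b' ks bss \<longleftrightarrow>
    (\<exists>bs\<in>set bss. \<exists>bs'\<in>set (splits bs k). possible_bip w i c c' b b' ks (heads (expand bs')) (tails (expand bs')))"
  by (induction bss) (simp_all add: any_possible_bip_iff)

end

section \<open>The evaluations and the classes that they exclude\<close>

lemma no_system_9: "\<not> any_extension [Suc 0, Suc 0, n2, n2, n2] n4 (Suc 0) n2 n4 sys9"
  by code_simp

text \<open>Sides of size 5 with three cut edges each; \<open>n8\<close> is half of the 16
  incidences.\<close>

lemma no_system_10_55: "\<not> any_bip_extension True n8 n5 n2 n2 n3 n3 [n2, n2, n2, n2] sys10"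
  by code_simp

text \<open>Sides of sizes 6 and 4 with all six cut edges at the larger one;
  \<open>bip_sum_m\<close> then splits the 16 incidences into 9 and 7.\<close>

lemma no_system_10_64: "\<not> any_bip_extension False n9 n6 n2 0 n6 0 [n2, n2, n2, n2] sys10"
  by code_simp


lemma represents_empty: "represents Ss {} []"
  unfolding represents_def by (intro exI[of _ "[]"]) (simp add: types_def)

lemma represents_block:
  assumes "represents Ss R bs" "finite K" "K \<inter> R = {}" "card K = n" "\<And>x. x \<in> K \<Longrightarrow> map (\<lambda>S. x \<in> S) Ss = b"
  shows "represents Ss (K \<union> R) ((b, n) # bs)"
proof -
  obtain xs where xs: "distinct xs" "set xs = R" "types Ss xs = expand bs" using assms(1) unfolding represents_def by blast
  obtain ks where ks: "set ks = K" "distinct ks" using finite_distinct_list[OF assms(2)] by blast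
  have "length ks = n" using distinct_card[OF ks(2)] ks(1) assms(4) by simp
  then have "types Ss ks = replicate n b" using assms(5) ks(1) unfolding types_def by (intro replicate_eqI) auto
  then show ?thesis unfolding represents_def
    using xs ks assms(3) by (intro exI[of _ "ks @ xs"]) (auto simp: types_def)
qed

lemma set_blocks1: "set (blocks1 b i bss) = (\<lambda>bs. (b, i) # bs) ` set bss"
  by (induction bss) auto

context view_system begin

lemma card_T: "card R = 6 + k \<Longrightarrow> p \<in> I \<Longrightarrow> card (T p) = k + t p"
  using T_card by fastforce

text \<open>In the search, \<open>Suc 0\<close> is \<open>6 - card I\<close> and \<open>n4\<close>
  is the number of cut edges left for \<open>R\<close>, after the two at \<open>p\<close> and
  \<open>q\<close>.\<close>

lemma rule_9_32:
  assumes r: "card R = 9" and I: "I = {u, v, w, p, q}" "distinct [u, v, w, p, q]"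
    and t: "t u = 0" "t v = 0" "t w = 0" "t p = 1" "t q = 1"
  shows False
proof -
  have mem: "u \<in> I" "v \<in> I" "w \<in> I" "p \<in> I" "q \<in> I" using I by auto
  have c: "card (T u) = n3" "card (T v) = n3" "card (T w) = n3" "card (T p) = n4" "card (T q) = n4"
    using card_T[of 3] r mem t by simp_all
  have R0: "\<exists>bs\<in>set [[([], n9)]]. represents (map T []) R bs"
    using represents_block[OF represents_empty finR, of n9 "[]" "[]"] r by simp
  have R1: "\<exists>bs\<in>set (extend [n2] n3 [[([], n9)]]). represents (map T [u]) R bs"
    by (rule represents_extend[OF R0 refl]) (use mem t c in simp_all)
  have R2: "\<exists>bs\<in>set (extend [n2, n2] n3 (extend [n2] n3 [[([], n9)]])). represents (map T [v, u]) R bs"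
    by (rule represents_extend[OF R1 refl]) (use mem t c I(2) in auto)
  have R3: "\<exists>bs\<in>set (extend [n2, n2, n2] n3 (extend [n2, n2] n3 (extend [n2] n3 [[([], n9)]]))).
      represents (map T [w, v, u]) R bs"
    by (rule represents_extend[OF R2 refl]) (use mem t c I(2) in auto)
  have "\<exists>bs\<in>set sys9. represents (map T [p, w, v, u]) R bs"
    unfolding sys9_def by (rule represents_extend[OF R3 refl]) (use mem t c I(2) in auto)
  then have "\<exists>bs\<in>set (extend [Suc 0, Suc 0, n2, n2, n2] n4 sys9). represents (map T [q, p, w, v, u]) R bs"
    by (rule represents_extend[OF _ refl]) (use mem t c I(2) in auto)
  then obtain bs where bs: "bs \<in> set (extend [Suc 0, Suc 0, n2, n2, n2] n4 sys9)" "represents (map T [q, p, w, v, u]) R bs"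
    by blast
  have n: "card I = 5" unfolding I(1) using I(2) by simp
  have tI: "sum t I = 2" unfolding I(1) using I(2) t by simp
  have "possible [Suc 0, Suc 0, n2, n2, n2] (Suc 0) n2 n4 (expand bs)"
  proof (rule represents_possible[OF bs(2)])
    show "set [q, p, w, v, u] = I" "distinct [q, p, w, v, u]" using I by auto
    show "list_all2 (\<lambda>k p. k + t p \<le> 2) [Suc 0, Suc 0, n2, n2, n2] [q, p, w, v, u]" using t by simp
    show "Suc 0 + card I = 6" using n by simp
    show "sum t R \<le> n4" using tot tI by simp
    show "t x \<le> n2" if "x \<in> R" for x using t_le[of x] that by simp
  qed
  then show False using bs(1) no_system_9 unfolding any_extension_iff by blast
qed

text \<open>The 16 incidences do not cover ten elements twice, so some \<open>x\<close> lies in no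
  \<open>T q\<close> with \<open>q\<close> different from a suitable \<open>v\<close>. In the view
  of \<open>v\<close> the part of \<open>x\<close> is then useless for the other three members, and
  two of them, \<open>a\<close> and \<open>b\<close>, share a part \<open>S\<close>. Now
  \<open>S - T v\<close> has at least two elements, while \<open>diff_card\<close> allows only two
  in \<open>T a \<inter> T b\<close>. So the intersection is \<open>S - T v\<close>, a pair disjoint
  from \<open>T v\<close>.\<close>

lemma sys10_sound:
  assumes r: "card R = 10" and n: "card I = 4" and t: "\<And>p. p \<in> I \<Longrightarrow> t p = 0"
  obtains ps bs where "bs \<in> set sys10" "set ps = I" "distinct ps" "length ps = 4" "represents (map T ps) R bs"
proof -
  have c: "card (T p) = 4" if "p \<in> I" for p using card_T[of 4 p] r t[OF that] that by simp
  have tR: "sum t R = 6" using tot t by simp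
  have "\<exists>v\<in>I. \<exists>x\<in>R. \<forall>q\<in>I - {v}. x \<notin> T q"
  proof (rule ccontr)
    assume neg: "\<not> ?thesis"
    have "2 \<le> m x" if x: "x \<in> R" for x
    proof -
      obtain v where "v \<in> I" using n by fastforce
      then obtain q where q: "q \<in> I" "x \<in> T q" using neg x by blast
      then obtain q' where q': "q' \<in> I - {q}" "x \<in> T q'" using neg x by blast
      have "{q, q'} \<subseteq> {p\<in>I. x \<in> T p}" using q q' by auto
      then have "card {q, q'} \<le> m x" unfolding m_def by (intro card_mono) (auto simp: finI)
      moreover have "card {q, q'} = 2" using q' by auto
      ultimately show ?thesis by simp
    qed
    then have "2 * card R \<le> sum m R" using sum_mono[of R "\<lambda>_. 2" m] by (simp add: mult.commute)
    moreover have "sum m R + 24 = 40" using sum_m n r t by simp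
    ultimately show False using r by simp
  qed
  then obtain v x where v: "v \<in> I" "x \<in> R" "\<And>q. q \<in> I - {v} \<Longrightarrow> x \<notin> T q" by blast
  obtain A B C where Q: "parts v A B C" using parts_exist[OF v(1)] .
  have "A \<union> B \<union> C = R" using Q unfolding parts_def by (elim conjE)
  then consider "x \<in> A" | "x \<in> B" | "x \<in> C" using v(2) by blast
  then obtain A B C where P: "parts v A B C" "x \<in> A"
    using Q parts_12[OF Q] parts_13[OF Q] by cases blast+
  have BC: "B \<subseteq> T q \<or> C \<subseteq> T q" if "q \<in> I - {v}" for q
    using parts_in[OF P(1), of q] that v(3)[OF that] P(2) by auto
  have "card (I - {v}) = 3" using n v(1) by simp
  then obtain a b d where abd: "I - {v} = {a, b, d}" "a \<noteq> b" "a \<noteq> d" "b \<noteq> d" by (auto simp: card_3_iff)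
  have PS: "parts v A S (R - A - S)" if "S \<in> {B, C}" for S
  proof -
    have "R - A - B = C" "R - A - C = B" using P(1) unfolding parts_def by auto
    then show ?thesis using P(1) parts_23[OF P(1)] that by auto
  qed
  have mem: "a \<in> I - {v}" "b \<in> I - {v}" "d \<in> I - {v}" using abd(1) by auto
  obtain S a b d where S: "parts v A S (R - A - S)" "I - {v} = {a, b, d}" "a \<noteq> b" "a \<noteq> d" "b \<noteq> d" "S \<subseteq> T a" "S \<subseteq> T b"
  proof -
    assume *: "\<And>S a b d. parts v A S (R - A - S) \<Longrightarrow> I - {v} = {a, b, d} \<Longrightarrow> a \<noteq> b \<Longrightarrow> a \<noteq> d \<Longrightarrow> b \<noteq> d \<Longrightarrow>
      S \<subseteq> T a \<Longrightarrow> S \<subseteq> T b \<Longrightarrow> thesis"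
    have eq: "I - {v} = {a, d, b}" "I - {v} = {b, d, a}" using abd(1) by auto
    consider S where "S \<in> {B, C}" "S \<subseteq> T a" "S \<subseteq> T b" | S where "S \<in> {B, C}" "S \<subseteq> T a" "S \<subseteq> T d"
      | S where "S \<in> {B, C}" "S \<subseteq> T b" "S \<subseteq> T d" using BC[OF mem(1)] BC[OF mem(2)] BC[OF mem(3)] by blast
    then show thesis
    proof cases
      case 1 then show ?thesis using *[OF PS abd] by blast
    next
      case 2 then show ?thesis using *[OF PS eq(1) abd(3,2) abd(4)[symmetric]] by blast
    next
      case 3 then show ?thesis using *[OF PS eq(2) abd(4) abd(2)[symmetric] abd(3)[symmetric]] by blast
    qed
  qed
  have I: "I = {d, v, b, a}" "distinct [d, v, b, a]" using S(2-5) v(1) by auto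
  have mem: "a \<in> I" "b \<in> I" "v \<in> I" "d \<in> I" using I by auto
  note fin = finT[OF mem(1)] finT[OF mem(2)] and cc = c[OF mem(1)] c[OF mem(2)] c[OF mem(3)] c[OF mem(4)]
    and sub = T_sub[OF mem(1)] T_sub[OF mem(2)] T_sub[OF mem(3)]
  define K where "K = T a \<inter> T b"
  have cS: "2 \<le> card (S - T v)" using parts_K1[OF parts_12[OF S(1)] v(1)] t[OF v(1)] by simp
  have SK: "S - T v \<subseteq> K" using S(6,7) by (auto simp: K_def)
  have finK: "finite K" using fin by (simp add: K_def)
  have split: "card (T b) = card (T b - T a) + card K" "card (T a) = card (T a - T b) + card K"
    unfolding K_def using card_Int_Diff[OF fin(2), of "T a"] card_Int_Diff[OF fin(1), of "T b"] by (simp_all add: Int_commute)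
  have "2 \<le> card (T b - T a)" using diff_card[of a b] t[of a] mem S(3) by simp
  then have "card K \<le> 2" using split(1) cc by simp
  then have K: "K = S - T v" "card K = 2"
    using card_seteq[OF finK SK] cS card_mono[OF finK SK] by auto
  have c2: "card (T b - T a) = 2" "card (T a - T b) = 2" using split cc K(2) by auto
  have "card (T a \<union> T b) = 6" using card_Un_Int[OF fin] cc K(2) by (simp add: K_def)
  then have c4: "card (R - (T a \<union> T b)) = 4"
    using card_Diff_subset[of "T a \<union> T b" R] sub fin r by simp
  have e: "R - K = (T b - T a) \<union> ((T a - T b) \<union> ((R - (T a \<union> T b)) \<union> {}))" using sub by (auto simp: K_def)
  have r0: "represents [T b, T a] (R - K) [([True, False], n2), ([False, True], n2), ([False, False], n4)]"
    unfolding e by (intro represents_block represents_empty) (use c2 c4 fin finR in auto)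
  have tv: "T v \<subseteq> R - K" using sub(3) K(1) by blast
  have "card (T v) = n4" using cc(3) by simp
  from represents_split[OF r0 tv this] obtain bs where
    bs: "bs \<in> set (splits [([True, False], n2), ([False, True], n2), ([False, False], n4)] n4)" "represents [T v, T b, T a] (R - K) bs"
    by blast
  have KR: "K \<union> (R - K) = R" using sub by (auto simp: K_def)
  have "represents [T v, T b, T a] (K \<union> (R - K)) (([False, True, True], n2) # bs)"
    by (rule represents_block[OF bs(2) finK]) (use K in \<open>auto simp: K_def\<close>)
  then have rep: "represents (map T [v, b, a]) R (([False, True, True], n2) # bs)" unfolding KR by simp
  have "feasible [n2, n2, n2] [] (rows [n2, n2, n2] (expand (([False, True, True], n2) # bs)))"
    by (rule represents_feasible[OF rep]) (use mem t I(2) in auto)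
  then have "\<exists>bs\<in>set (prune [n2, n2, n2] (blocks1 [False, True, True] n2
      (splits [([True, False], n2), ([False, True], n2), ([False, False], n4)] n4))). represents (map T [v, b, a]) R bs"
    using bs(1) rep unfolding set_prune set_blocks1 by blast
  then have "\<exists>bs\<in>set (extend [n2, n2, n2, n2] n4 (prune [n2, n2, n2] (blocks1 [False, True, True] n2
      (splits [([True, False], n2), ([False, True], n2), ([False, False], n4)] n4)))). represents (map T [d, v, b, a]) R bs"
    by (rule represents_extend[OF _ refl]) (use mem t cc I(2) in auto)
  then obtain bs' where bs': "bs' \<in> set (extend [n2, n2, n2, n2] n4 (prune [n2, n2, n2] (blocks1 [False, True, True] n2
      (splits [([True, False], n2), ([False, True], n2), ([False, False], n4)] n4))))" "represents (map T [d, v, b, a]) R bs'"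
    by blast
  have "possible [n2, n2, n2, n2] n2 n2 n6 (expand bs')"
  proof (rule represents_possible[OF bs'(2)])
    show "set [d, v, b, a] = I" "distinct [d, v, b, a]" using I by auto
    show "list_all2 (\<lambda>k p. k + t p \<le> 2) [n2, n2, n2, n2] [d, v, b, a]" using t mem by simp
    show "n2 + card I = 6" using n by simp
    show "sum t R \<le> n6" using tR by simp
    show "t x \<le> n2" if "x \<in> R" for x using t_le[of x] that by simp
  qed
  then have "bs' \<in> set sys10" unfolding sys10_def set_retain using bs'(1) by blast
  moreover have "set [d, v, b, a] = I" "length [d, v, b, a] = 4" using I(1) by auto
  ultimately show ?thesis using that bs'(2) I(2) by blast
qed

text \<open>All edges of \<open>R\<close> run between \<open>X\<close> and \<open>R - X\<close>, so
  both sides have the same degree sum, and \<open>dg x + t x = m x + 2\<close> for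
  \<open>card I = 4\<close>.\<close>

lemma bip_sum_m:
  assumes X: "X \<subseteq> R" and n: "card I = 4" and bip: "\<And>x y. x \<in> R \<Longrightarrow> y \<in> R \<Longrightarrow> E x y \<Longrightarrow> (x \<in> X) \<noteq> (y \<in> X)"
  shows "sum m X + 2 * card X + sum t (R - X) = sum m (R - X) + 2 * card (R - X) + sum t X"
proof -
  have s: "sum dg Y + sum t Y = sum m Y + 2 * card Y" if "Y \<subseteq> R" for Y
  proof -
    have "(\<Sum>y\<in>Y. dg y + t y) = (\<Sum>y\<in>Y. m y + 2)"
      using dg_eq that n by (intro sum.cong refl) fastforce
    also have "\<dots> = sum m Y + 2 * card Y" unfolding sum.distrib sum_constant by simp
    finally show ?thesis unfolding sum.distrib .
  qed
  have "{y\<in>R. E x y} = {y\<in>R - X. E x y}" if "x \<in> X" for x using bip that X by blast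
  then have a: "sum dg X = (\<Sum>x\<in>X. card {y\<in>R - X. E x y})"
    unfolding dg_def by (intro sum.cong refl) simp
  have "{y\<in>R. E x y} = {y\<in>X. E x y}" if "x \<in> R - X" for x using bip that X by blast
  then have b: "sum dg (R - X) = (\<Sum>y\<in>R - X. card {x\<in>X. E y x})"
    unfolding dg_def by (intro sum.cong refl) simp
  have "sum dg X = sum dg (R - X)"
    unfolding a b using X by (intro dg_swap) auto
  then show ?thesis using s[OF X] s[of "R - X"] by simp
qed

text \<open>The set \<open>I\<close> is a colour class of size 4 without cut edges, and
  \<open>X\<close> and \<open>R - X\<close> are the other two classes.\<close>

lemma rule_10:
  assumes r: "card R = 10" and n: "card I = 4" and t: "\<And>p. p \<in> I \<Longrightarrow> t p = 0"
    and X: "X \<subseteq> R" and bip: "\<And>x y. x \<in> R \<Longrightarrow> y \<in> R \<Longrightarrow> E x y \<Longrightarrow> (x \<in> X) \<noteq> (y \<in> X)"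
  shows rule_10_55: "card X = 5 \<Longrightarrow> sum t X = 3 \<Longrightarrow>
      (\<And>x y. x \<in> R \<Longrightarrow> y \<in> R \<Longrightarrow> x \<noteq> y \<Longrightarrow> x \<in> X \<longleftrightarrow> y \<in> X \<Longrightarrow> t x = 0 \<Longrightarrow> t y = 0 \<Longrightarrow>
        card {p\<in>I. x \<in> T p \<and> y \<in> T p} + card {v\<in>R. (v \<in> X) \<noteq> (x \<in> X) \<and> \<not> E x v \<and> \<not> E y v} \<le> 1) \<Longrightarrow> False"
    and rule_10_64: "card X = 6 \<Longrightarrow> sum t X = 6 \<Longrightarrow> False"
proof -
  obtain ps bs where bs: "bs \<in> set sys10" "set ps = I" "distinct ps" "length ps = 4" "represents (map T ps) R bs"
    using sys10_sound[OF r n t] .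
  have la: "list_all2 (\<lambda>k p. k + t p \<le> 2) [n2, n2, n2, n2] ps"
    using bs(2,4) t by (auto simp: numeral_eq_Suc length_Suc_conv)
  have fX: "finite X" using X finR finite_subset by auto
  have tR: "sum t X + sum t (R - X) = 6" using tot t sum.subset_diff[OF X finR, of t] by simp
  have mR: "sum m X + sum m (R - X) = 16" using sum_m n r t sum.subset_diff[OF X finR, of m] by simp
  have cR: "card (R - X) + card X = 10" using card_Diff_subset[OF fX X] card_mono[OF finR X] r by simp
  note b = bip_sum_m[OF X n bip]
  show False if h: "card X = 5" "sum t X = 3" and H:
    "\<And>x y. x \<in> R \<Longrightarrow> y \<in> R \<Longrightarrow> x \<noteq> y \<Longrightarrow> x \<in> X \<longleftrightarrow> y \<in> X \<Longrightarrow> t x = 0 \<Longrightarrow> t y = 0 \<Longrightarrow>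
        card {p\<in>I. x \<in> T p \<and> y \<in> T p} + card {v\<in>R. (v \<in> X) \<noteq> (x \<in> X) \<and> \<not> E x v \<and> \<not> E y v} \<le> 1"
  proof -
    have "card X = n5" using h(1) by simp
    from represents_split[OF bs(5) X this]
    obtain bs' where bs': "bs' \<in> set (splits bs n5)" "represents (X # map T ps) R bs'" by blast
    have "possible_bip True n8 n2 n2 n3 n3 [n2, n2, n2, n2] (heads (expand bs')) (tails (expand bs'))"
    proof (rule represents_possible_bip[OF bs'(2) bs(2,3) la X n bip])
      show "sum m X = n8" using b tR mR cR h by simp
      show "sum t X \<le> n3" "sum t (R - X) \<le> n3" using tR h by simp_all
      show "t x \<le> n2" if "x \<in> X" for x using t_le[of x] X that by auto
      show "t x \<le> n2" if "x \<in> R - X" for x using t_le[of x] that by auto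
    qed (use H in auto)
    then show False using no_system_10_55 bs(1) bs'(1) unfolding any_bip_extension_iff by blast
  qed
  show False if h: "card X = 6" "sum t X = 6"
  proof -
    have "card X = n6" using h(1) by simp
    from represents_split[OF bs(5) X this]
    obtain bs' where bs': "bs' \<in> set (splits bs n6)" "represents (X # map T ps) R bs'" by blast
    have z: "sum t (R - X) = 0" using tR h(2) by simp
    have "possible_bip False n9 n2 0 n6 0 [n2, n2, n2, n2] (heads (expand bs')) (tails (expand bs'))"
    proof (rule represents_possible_bip[OF bs'(2) bs(2,3) la X n bip])
      show "sum m X = n9" using b tR mR cR h by simp
      show "sum t X \<le> n6" "sum t (R - X) \<le> 0" using tR h by simp_all
      show "t x \<le> n2" if "x \<in> X" for x using t_le[of x] X that by auto
      show "t x \<le> 0" if "x \<in> R - X" for x using z that finR by simp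
    qed auto
    then show False using no_system_10_64 bs(1) bs'(1) unfolding any_bip_extension_iff by blast
  qed
qed

end

section \<open>Critical graphs and their small shores\<close>

lemma card_less_2E:
  assumes "finite S" "\<not> 2 \<le> card S" obtains a where "S \<subseteq> {a}"
proof -
  have "card S = 0 \<or> card S = 1" using assms(2) by linarith
  then show ?thesis
  proof
    assume "card S = 0"
    then show ?thesis using assms(1) that by simp
  next
    assume "card S = 1"
    then show ?thesis using that card_1_singletonE by blast
  qed
qed

text \<open>The axiom \<open>two_conflicts\<close> forbids that all monochromatic edges are equal to
  one given pair. With \<open>a\<close>, \<open>b\<close> arbitrary it expresses in a single
  statement that the graph is not 3-colourable and that deleting any edge does not change
  this.\<close>

locale critical_graph =
  fixes V :: "'a set" and E :: "'a \<Rightarrow> 'a \<Rightarrow> bool"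
  assumes finV: "finite V" and E_sym: "E x y \<Longrightarrow> E y x" and E_irr: "\<not> E x x" and E_V: "E x y \<Longrightarrow> x \<in> V"
    and six: "x \<in> V \<Longrightarrow> card {y\<in>V. E x y} = 6"
    and two_conflicts: "\<forall>x\<in>V. c x < (3::nat) \<Longrightarrow> \<exists>x\<in>V. \<exists>y\<in>V. E x y \<and> c x = c y \<and> {x, y} \<noteq> {a, b}"
    and delete: "v \<in> V \<Longrightarrow> \<exists>c. (\<forall>x\<in>V. c x < (3::nat)) \<and> (\<forall>x\<in>V - {v}. \<forall>y\<in>V - {v}. E x y \<longrightarrow> c x \<noteq> c y)"
begin

lemma split_222:
  assumes v: "v \<in> V" and c: "\<forall>x\<in>V. c x < (3::nat)" "\<forall>x\<in>V - {v}. \<forall>y\<in>V - {v}. E x y \<longrightarrow> c x \<noteq> c y"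
    and j: "j < 3"
  shows "card {y\<in>V. E v y \<and> c y = j} \<le> 2"
proof -
  have ge: "2 \<le> card {y\<in>V. E v y \<and> c y = j}" if j: "j < 3" for j
  proof (rule ccontr)
    assume "\<not> ?thesis"
    then obtain a where a: "{y\<in>V. E v y \<and> c y = j} \<subseteq> {a}"
      using card_less_2E[of "{y\<in>V. E v y \<and> c y = j}"] finV by auto
    \<comment> \<open>After recolouring \<open>v\<close> with \<open>j\<close>, the only possible
      conflict is between \<open>v\<close> and \<open>a\<close>.\<close>
    have "\<forall>x\<in>V. (c(v := j)) x < 3" using c(1) j by simp
    from two_conflicts[OF this, of v a] obtain x y
      where xy: "x \<in> V" "y \<in> V" "E x y" "(c(v := j)) x = (c(v := j)) y" "{x, y} \<noteq> {v, a}" by blast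
    have ne: "x \<noteq> y" using xy(3) E_irr by auto
    consider "x = v" | "y = v" | "x \<noteq> v" "y \<noteq> v" by blast
    then show False
    proof cases
      case 1
      then have "y \<in> {y\<in>V. E v y \<and> c y = j}" using xy ne by auto
      then show False using a xy(5) 1 by blast
    next
      case 2
      then have "x \<in> {y\<in>V. E v y \<and> c y = j}" using xy ne E_sym by auto
      then show False using a xy(5) 2 by blast
    next
      case 3
      then show False using c(2) xy by simp
    qed
  qed
  have "{y\<in>V. E v y} = {y\<in>V. E v y \<and> c y = 0} \<union> {y\<in>V. E v y \<and> c y = 1} \<union> {y\<in>V. E v y \<and> c y = 2}"
  proof -
    have "c y = 0 \<or> c y = 1 \<or> c y = 2" if "y \<in> V" for y using c(1) that by (auto simp: less_Suc_eq numeral_eq_Suc)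
    then show ?thesis by blast
  qed
  moreover have "card ({y\<in>V. E v y \<and> c y = 0} \<union> {y\<in>V. E v y \<and> c y = 1} \<union> {y\<in>V. E v y \<and> c y = 2}) =
      card {y\<in>V. E v y \<and> c y = 0} + card {y\<in>V. E v y \<and> c y = 1} + card {y\<in>V. E v y \<and> c y = 2}"
  proof (subst card_Un_disjoint)
    show "card ({y\<in>V. E v y \<and> c y = 0} \<union> {y\<in>V. E v y \<and> c y = 1}) + card {y\<in>V. E v y \<and> c y = 2} =
      card {y\<in>V. E v y \<and> c y = 0} + card {y\<in>V. E v y \<and> c y = 1} + card {y\<in>V. E v y \<and> c y = 2}"
      using finV by (subst card_Un_disjoint) auto
  qed (use finV in auto)
  ultimately have "card {y\<in>V. E v y \<and> c y = 0} + card {y\<in>V. E v y \<and> c y = 1} + card {y\<in>V. E v y \<and> c y = 2} = 6"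
    using six[OF v] by simp
  moreover have "j = 0 \<or> j = 1 \<or> j = 2" using j by auto
  ultimately show ?thesis using ge[of 0] ge[of 1] ge[of 2] by (elim disjE) simp_all
qed

definition out :: "'a set \<Rightarrow> 'a \<Rightarrow> nat" where
  "out A x = card {y\<in>V - A. E x y}"

definition proper :: "'a set \<Rightarrow> ('a \<Rightarrow> nat) \<Rightarrow> bool" where
  "proper A c \<longleftrightarrow> (\<forall>x\<in>A. c x < 3) \<and> (\<forall>x\<in>A. \<forall>y\<in>A. E x y \<longrightarrow> c x \<noteq> c y)"

lemma proper_exists:
  assumes "A \<subseteq> V" "A \<noteq> V" shows "\<exists>c. proper A c"
proof -
  obtain v where v: "v \<in> V" "v \<notin> A" using assms by blast
  obtain c where "\<forall>x\<in>V. c x < 3" "\<forall>x\<in>V - {v}. \<forall>y\<in>V - {v}. E x y \<longrightarrow> c x \<noteq> (c y :: nat)"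
    using delete[OF v(1)] by blast
  moreover have "A \<subseteq> V - {v}" using v assms by blast
  ultimately show ?thesis unfolding proper_def by blast
qed

text \<open>With \<open>M i j\<close> the number of cut edges from colour \<open>i\<close> in
  \<open>A\<close> to colour \<open>j\<close> outside, recolouring the outside by a permutation
  gives one transversal sum of \<open>M\<close> as the number of conflicts. Every entry of
  \<open>M\<close> lies in two of the six transversals.\<close>

lemma cut_colours:
  assumes A: "A \<subseteq> V" "A \<noteq> {}" "A \<noteq> V" and \<phi>: "proper A \<phi>"
  shows "6 \<le> sum (out A) A"
    and "sum (out A) A = 6 \<Longrightarrow> sum (out A) {x\<in>A. \<phi> x = 0} mod 3 = sum (out A) {x\<in>A. \<phi> x = 1} mod 3 \<and>
      sum (out A) {x\<in>A. \<phi> x = 1} mod 3 = sum (out A) {x\<in>A. \<phi> x = 2} mod 3"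
proof -
  obtain \<psi> where \<psi>: "proper (V - A) \<psi>" using proper_exists[of "V - A"] A by blast
  define C where "C = {p \<in> A \<times> (V - A). E (fst p) (snd p)}"
  have finA: "finite A" using A finV finite_subset by blast
  then have finC: "finite C" unfolding C_def using finV by simp
  define M where "M i j = card {p\<in>C. \<phi> (fst p) = i \<and> \<psi> (snd p) = j}" for i j
  have lt3: "i = 0 \<or> i = 1 \<or> i = 2" if "i < 3" for i :: nat using that by auto
  have cl: "\<phi> x = 0 \<or> \<phi> x = 1 \<or> \<phi> x = 2" if "x \<in> A" for x using \<phi> lt3 that unfolding proper_def by blast
  have cr: "\<psi> x = 0 \<or> \<psi> x = 1 \<or> \<psi> x = 2" if "x \<in> V - A" for x using \<psi> lt3 that unfolding proper_def by blast
  have part: "card {p\<in>C. Q p} = card {p\<in>C. Q p \<and> \<psi> (snd p) = 0} + card {p\<in>C. Q p \<and> \<psi> (snd p) = 1} + card {p\<in>C. Q p \<and> \<psi> (snd p) = 2}" for Q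
  proof -
    have "{p\<in>C. Q p} = {p\<in>C. Q p \<and> \<psi> (snd p) = 0} \<union> {p\<in>C. Q p \<and> \<psi> (snd p) = 1} \<union> {p\<in>C. Q p \<and> \<psi> (snd p) = 2}"
    proof -
      have "\<psi> (snd p) = 0 \<or> \<psi> (snd p) = 1 \<or> \<psi> (snd p) = 2" if "p \<in> C" for p
        using cr[of "snd p"] that unfolding C_def by auto
      then show ?thesis by blast
    qed
    also have "card \<dots> = card ({p\<in>C. Q p \<and> \<psi> (snd p) = 0} \<union> {p\<in>C. Q p \<and> \<psi> (snd p) = 1}) + card {p\<in>C. Q p \<and> \<psi> (snd p) = 2}"
      using finC by (intro card_Un_disjoint) auto
    also have "card ({p\<in>C. Q p \<and> \<psi> (snd p) = 0} \<union> {p\<in>C. Q p \<and> \<psi> (snd p) = 1}) =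
        card {p\<in>C. Q p \<and> \<psi> (snd p) = 0} + card {p\<in>C. Q p \<and> \<psi> (snd p) = 1}"
      using finC by (intro card_Un_disjoint) auto
    finally show ?thesis .
  qed
  have k: "sum (out A) {x\<in>A. \<phi> x = i} = M i 0 + M i 1 + M i 2" for i
  proof -
    have "sum (out A) {x\<in>A. \<phi> x = i} = card (SIGMA x:{x\<in>A. \<phi> x = i}. {y\<in>V - A. E x y})"
      unfolding out_def using finA finV by (subst card_SigmaI) auto
    also have "(SIGMA x:{x\<in>A. \<phi> x = i}. {y\<in>V - A. E x y}) = {p\<in>C. \<phi> (fst p) = i}" by (auto simp: C_def)
    finally show ?thesis unfolding M_def part[of "\<lambda>p. \<phi> (fst p) = i"] .
  qed
  have tot: "sum (out A) A = sum (out A) {x\<in>A. \<phi> x = 0} + sum (out A) {x\<in>A. \<phi> x = 1} + sum (out A) {x\<in>A. \<phi> x = 2}"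
  proof -
    have "A = {x\<in>A. \<phi> x = 0} \<union> {x\<in>A. \<phi> x = 1} \<union> {x\<in>A. \<phi> x = 2}" using cl by blast
    then have "sum (out A) A = sum (out A) ({x\<in>A. \<phi> x = 0} \<union> {x\<in>A. \<phi> x = 1} \<union> {x\<in>A. \<phi> x = 2})" by simp
    also have "\<dots> = sum (out A) ({x\<in>A. \<phi> x = 0} \<union> {x\<in>A. \<phi> x = 1}) + sum (out A) {x\<in>A. \<phi> x = 2}"
      using finA by (intro sum.union_disjoint) auto
    also have "sum (out A) ({x\<in>A. \<phi> x = 0} \<union> {x\<in>A. \<phi> x = 1}) = sum (out A) {x\<in>A. \<phi> x = 0} + sum (out A) {x\<in>A. \<phi> x = 1}"
      using finA by (intro sum.union_disjoint) auto
    finally show ?thesis .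
  qed
  have conf: "2 \<le> M i 0 + M j 1 + M l 2" if "i < 3" "j < 3" "l < 3" "i \<noteq> j" "i \<noteq> l" "j \<noteq> l" for i j l
  proof -
    define \<sigma> where "\<sigma> u = (if u = 0 then i else if u = 1 then j else l)" for u :: nat
    have "2 \<le> card {p\<in>C. \<phi> (fst p) = \<sigma> (\<psi> (snd p))}"
    proof (rule ccontr)
      assume "\<not> ?thesis"
      then obtain ab where "{p\<in>C. \<phi> (fst p) = \<sigma> (\<psi> (snd p))} \<subseteq> {ab}"
        using card_less_2E[of "{p\<in>C. \<phi> (fst p) = \<sigma> (\<psi> (snd p))}"] finC by auto
      then obtain a b where ab: "{p\<in>C. \<phi> (fst p) = \<sigma> (\<psi> (snd p))} \<subseteq> {(a, b)}" by (cases ab) blast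
      define c where "c x = (if x \<in> A then \<phi> x else \<sigma> (\<psi> x))" for x
      have "\<forall>x\<in>V. c x < 3" using \<phi> that unfolding c_def proper_def \<sigma>_def by simp
      from two_conflicts[OF this, of a b] obtain x y where
        xy: "x \<in> V" "y \<in> V" "E x y" "c x = c y" "{x, y} \<noteq> {a, b}" by blast
      have cross: False if "x \<in> A" "y \<in> V - A" "E x y" "c x = c y" "{x, y} \<noteq> {a, b}" for x y
      proof -
        have "(x, y) \<in> {p\<in>C. \<phi> (fst p) = \<sigma> (\<psi> (snd p))}" using that by (auto simp: C_def c_def)
        then show False using ab that(5) by auto
      qed
      consider "x \<in> A" "y \<in> A" | "x \<in> A" "y \<notin> A" | "x \<notin> A" "y \<in> A" | "x \<notin> A" "y \<notin> A" by blast
      then show False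
      proof cases
        case 1
        then show ?thesis using xy \<phi> unfolding proper_def c_def by simp
      next
        case 2
        then show ?thesis using cross[of x y] xy by simp
      next
        case 3
        then show ?thesis using cross[of y x] xy E_sym by (simp add: insert_commute)
      next
        case 4
        then have "\<psi> x \<noteq> \<psi> y" using xy \<psi> unfolding proper_def by simp
        moreover have "\<sigma> (\<psi> x) = \<sigma> (\<psi> y)" using 4 xy(4) by (simp add: c_def)
        ultimately show ?thesis using cr[of x] cr[of y] xy 4 \<open>i \<noteq> j\<close> \<open>i \<noteq> l\<close> \<open>j \<noteq> l\<close> by (auto simp: \<sigma>_def split: if_splits)
      qed
    qed
    moreover have "card {p\<in>C. \<phi> (fst p) = \<sigma> (\<psi> (snd p))} = M i 0 + M j 1 + M l 2"
      unfolding part[of "\<lambda>p. \<phi> (fst p) = \<sigma> (\<psi> (snd p))"] M_def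
      by (intro arg_cong2[of _ _ _ _ "(+)"] arg_cong[of _ _ card]) (auto simp: \<sigma>_def)
    ultimately show ?thesis by simp
  qed
  have six: "2 \<le> M 0 0 + M 1 1 + M 2 2" "2 \<le> M 0 0 + M 2 1 + M 1 2" "2 \<le> M 1 0 + M 0 1 + M 2 2"
    "2 \<le> M 1 0 + M 2 1 + M 0 2" "2 \<le> M 2 0 + M 0 1 + M 1 2" "2 \<le> M 2 0 + M 1 1 + M 0 2"
    by (rule conf; simp)+
  show "6 \<le> sum (out A) A" unfolding tot k using six by linarith
  assume "sum (out A) A = 6"
  then have s: "M 0 0 + M 0 1 + M 0 2 + (M 1 0 + M 1 1 + M 1 2) + (M 2 0 + M 2 1 + M 2 2) = 6" unfolding tot k .
  \<comment> \<open>For cut size 6 all transversal sums are 2, so two rows of \<open>M\<close>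
    differ by a constant, and their sums differ by three times the difference of their first
    entries.\<close>
  have e: "M 0 0 + M 0 1 + M 0 2 + 3 * M 1 0 = M 1 0 + M 1 1 + M 1 2 + 3 * M 0 0"
    "M 1 0 + M 1 1 + M 1 2 + 3 * M 2 0 = M 2 0 + M 2 1 + M 2 2 + 3 * M 1 0" using six s by linarith+
  have m: "u mod 3 = v mod 3" if "u + 3 * a = v + 3 * b" for u v a b :: nat
    using arg_cong[OF that, of "\<lambda>z. z mod 3"] by simp
  show "sum (out A) {x\<in>A. \<phi> x = 0} mod 3 = sum (out A) {x\<in>A. \<phi> x = 1} mod 3 \<and>
      sum (out A) {x\<in>A. \<phi> x = 1} mod 3 = sum (out A) {x\<in>A. \<phi> x = 2} mod 3"
    unfolding k using m[OF e(1)] m[OF e(2)] by blast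
qed

lemma nbrs: "A \<subseteq> V \<Longrightarrow> x \<in> A \<Longrightarrow> card {y\<in>A. E x y} + out A x = 6"
proof -
  assume A: "A \<subseteq> V" "x \<in> A"
  have "{y\<in>V. E x y} = {y\<in>A. E x y} \<union> {y\<in>V - A. E x y}" using A by blast
  moreover have "card ({y\<in>A. E x y} \<union> {y\<in>V - A. E x y}) = card {y\<in>A. E x y} + card {y\<in>V - A. E x y}"
    using finV finite_subset[OF A(1) finV] by (intro card_Un_disjoint) auto
  ultimately show ?thesis using six[of x] A by (auto simp: out_def)
qed

text \<open>Moving \<open>x\<close> across removes \<open>out A x\<close> edges from the cut and
  adds the other \<open>6 - out A x\<close> edges at \<open>x\<close>.\<close>

lemma out_remove:
  assumes "A \<subseteq> V" "x \<in> A"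
  shows "sum (out (A - {x})) (A - {x}) + 2 * out A x = sum (out A) A + 6"
proof -
  have fin: "finite A" using assms finV finite_subset by blast
  have "out (A - {x}) y = out A y + of_bool (E x y)" if "y \<in> A - {x}" for y
  proof -
    have "{z\<in>V - (A - {x}). E y z} = {z\<in>V - A. E y z} \<union> {z\<in>{x}. E y z}" using assms by auto
    moreover have "card ({z\<in>V - A. E y z} \<union> {z\<in>{x}. E y z}) = card {z\<in>V - A. E y z} + card {z\<in>{x}. E y z}"
      using finV assms by (intro card_Un_disjoint) auto
    moreover have "{z\<in>{x}. E y z} = (if E x y then {x} else {})" using E_sym by auto
    ultimately show ?thesis by (simp add: out_def)
  qed
  then have "sum (out (A - {x})) (A - {x}) = sum (out A) (A - {x}) + (\<Sum>y\<in>A - {x}. of_bool (E x y))"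
    by (simp add: sum.distrib)
  also have "(\<Sum>y\<in>A - {x}. of_bool (E x y)) = card {y\<in>A. E x y}"
  proof -
    have "{y\<in>A. E x y} = (A - {x}) \<inter> {y. E x y}" using E_irr by auto
    then show ?thesis using fin by (simp add: of_bool_def sum.If_cases)
  qed
  finally show ?thesis using nbrs[OF assms] sum.remove[OF fin assms(2), of "out A"] by simp
qed

lemma view_system_class:
  assumes A: "A \<subseteq> V" and t: "\<And>x. x \<in> A \<Longrightarrow> out A x \<le> 2" and cut: "sum (out A) A = 6"
    and I: "I \<subseteq> A" "\<And>x y. x \<in> I \<Longrightarrow> y \<in> I \<Longrightarrow> \<not> E x y"
  shows "view_system I (A - I) (\<lambda>p. {x\<in>A - I. \<not> E p x}) (out A) E"
proof
  have finA: "finite A" using A finV finite_subset by blast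
  then have fin: "finite I" "finite (A - I)" using I(1) finite_subset by auto
  show "finite I" "finite (A - I)" by (fact fin)+
  show "{x\<in>A - I. \<not> E p x} \<subseteq> A - I" for p by blast
  show "card (A - I) + out A p = card {x\<in>A - I. \<not> E p x} + 6" if p: "p \<in> I" for p
  proof -
    have "{y\<in>A. E p y} = {x\<in>A - I. E p x}" using I p by blast
    moreover have "card (A - I) = card {x\<in>A - I. E p x} + card {x\<in>A - I. \<not> E p x}"
      using card_Int_Diff[OF fin(2), of "{x. E p x}"] by (simp add: Int_def set_diff_eq)
    moreover have "p \<in> A" using p I by blast
    ultimately show ?thesis using nbrs[OF A, of p] by simp
  qed
  show "E x y \<Longrightarrow> E y x" for x y by (rule E_sym)
  show "out A p \<le> 2" if "p \<in> I \<union> (A - I)" for p using t[of p] I that by blast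
  show "\<exists>c :: 'a \<Rightarrow> nat. (\<forall>x\<in>A - I. c x < 3) \<and> (\<forall>x\<in>A - I. \<forall>y\<in>A - I. E x y \<longrightarrow> c x \<noteq> c y) \<and>
      (\<forall>j<3. card {x\<in>(A - I) - {x\<in>A - I. \<not> E p x}. c x = j} \<le> 2) \<and>
      (\<forall>q\<in>I - {p}. \<exists>j<3. \<forall>x\<in>A - I. c x = j \<longrightarrow> x \<in> {x\<in>A - I. \<not> E q x})" if p: "p \<in> I" for p
  proof -
    have pV: "p \<in> V" using p I A by blast
    obtain c where c: "\<forall>x\<in>V. c x < (3::nat)" "\<forall>x\<in>V - {p}. \<forall>y\<in>V - {p}. E x y \<longrightarrow> c x \<noteq> c y"
      using delete[OF pV] by blast
    have "card {x\<in>(A - I) - {x\<in>A - I. \<not> E p x}. c x = j} \<le> 2" if "j < 3" for j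
    proof -
      have "card {x\<in>(A - I) - {x\<in>A - I. \<not> E p x}. c x = j} \<le> card {y\<in>V. E p y \<and> c y = j}"
        using A finV by (intro card_mono) auto
      then show ?thesis using split_222[OF pV c that] by simp
    qed
    moreover have "\<exists>j<3. \<forall>x\<in>A - I. c x = j \<longrightarrow> x \<in> {x\<in>A - I. \<not> E q x}" if q: "q \<in> I - {p}" for q
    proof (intro exI conjI ballI impI)
      show "c q < 3" using c(1) q I A by blast
      fix x assume x: "x \<in> A - I" "c x = c q"
      then have "x \<in> V - {p}" "q \<in> V - {p}" using q I A p by auto
      then have "\<not> E q x" using c(2) x(2) by metis
      then show "x \<in> {x\<in>A - I. \<not> E q x}" using x by simp
    qed
    moreover have "\<forall>x\<in>A - I. c x < 3" "\<forall>x\<in>A - I. \<forall>y\<in>A - I. E x y \<longrightarrow> c x \<noteq> c y"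
      using c A p by blast+
    ultimately show ?thesis by (intro exI[of _ c] conjI) auto
  qed
  show "card {y\<in>A - I. E x y} + card I + out A x = 6 + card {p\<in>I. x \<in> {x\<in>A - I. \<not> E p x}}" if x: "x \<in> A - I" for x
  proof -
    have "{y\<in>A. E x y} = {y\<in>A - I. E x y} \<union> {y\<in>I. E x y}" using I by blast
    moreover have "card ({y\<in>A - I. E x y} \<union> {y\<in>I. E x y}) = card {y\<in>A - I. E x y} + card {y\<in>I. E x y}"
      using fin by (intro card_Un_disjoint) auto
    moreover have "card I = card {y\<in>I. E x y} + card (I - {y. E x y})"
      using card_Int_Diff[OF fin(1), of "{y. E x y}"] by (simp add: Int_def)
    moreover have "I - {y. E x y} = {p\<in>I. x \<in> {x\<in>A - I. \<not> E p x}}" using x E_sym by blast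
    ultimately show ?thesis using nbrs[OF A, of x] x by simp
  qed
  show "sum (out A) I + sum (out A) (A - I) = 6" using cut sum.subset_diff[OF I(1) finA, of "out A"] by simp
qed

end

section \<open>Arithmetic of the class sizes\<close>

text \<open>Here \<open>r\<close> is \<open>card R\<close>, and \<open>s\<close>, \<open>q\<close>,
  \<open>w\<close> count the members with \<open>t\<close> equal to 0, 1, 2. The first three
  conditions come from \<open>card (T p) \<ge> 0\<close>, the others from the rules;
  \<open>15 + q + 2 * w \<le> 3 * (s + q + w)\<close> negates the edge hypothesis of
  \<open>rule_8_22\<close>.\<close>

definition class_ok :: "nat \<Rightarrow> nat \<Rightarrow> nat \<Rightarrow> nat \<Rightarrow> bool" where
  "class_ok r s q w \<longleftrightarrow> (1 \<le> s \<longrightarrow> 6 \<le> r) \<and> (1 \<le> q \<longrightarrow> 5 \<le> r) \<and> (1 \<le> w \<longrightarrow> 4 \<le> r) \<and>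
    (r \<le> 7 \<longrightarrow> s \<le> 1) \<and> (r \<le> 6 \<longrightarrow> s = 0 \<or> q = 0) \<and> (r \<le> 6 \<longrightarrow> q \<le> 2) \<and> (r = 7 \<longrightarrow> s = 0 \<or> q \<le> 2) \<and>
    (r = 8 \<longrightarrow> s \<le> 3 \<and> (s = 3 \<longrightarrow> q = 0)) \<and> (r = 9 \<longrightarrow> s \<le> 3 \<and> \<not> (s = 3 \<and> q = 2 \<and> w = 0)) \<and>
    (r = 8 \<longrightarrow> s \<le> 1 \<or> q \<le> 1 \<or> 15 + q + 2 * w \<le> 3 * (s + q + w)) \<and>
    (r = 8 \<longrightarrow> \<not> (s = 3 \<and> q + 2 * w + 6 = 2 * (s + q + w))) \<and>
    (r = 8 \<longrightarrow> \<not> (s = 1 \<and> q = 4 \<and> w = 0))"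

text \<open>This and the next five lemmas treat the possible numbers of cut edges at a class. The
  number 5 does not occur: three congruent numbers modulo 3 with sum 6 are 6, 0, 0 or 3, 3, 0 or 4,
  1, 1 or 2, 2, 2 in some order.\<close>

lemma class_0: "class_ok r n 0 0 \<Longrightarrow> r + n \<le> 14 \<Longrightarrow>
    n \<le> 4 \<and> (1 \<le> n \<longrightarrow> 7 \<le> r + n) \<and> (2 \<le> n \<longrightarrow> 10 \<le> r + n) \<and> (3 \<le> n \<longrightarrow> 12 \<le> r + n) \<and> (4 \<le> n \<longrightarrow> 14 \<le> r + n)"
  unfolding class_ok_def by presburger

lemma class_1: "class_ok r s 1 0 \<Longrightarrow> n = s + 1 \<Longrightarrow> r + n \<le> 14 \<Longrightarrow>
    n \<le> 4 \<and> (1 \<le> n \<longrightarrow> 6 \<le> r + n) \<and> (2 \<le> n \<longrightarrow> 9 \<le> r + n) \<and> (3 \<le> n \<longrightarrow> 11 \<le> r + n) \<and> (4 \<le> n \<longrightarrow> 13 \<le> r + n)"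
  unfolding class_ok_def by presburger

lemma class_2: "class_ok r s q w \<Longrightarrow> q + 2 * w = 2 \<Longrightarrow> n = s + q + w \<Longrightarrow> r + n \<le> 14 \<Longrightarrow>
    n \<le> 4 \<and> (1 \<le> n \<longrightarrow> 5 \<le> r + n) \<and> (2 \<le> n \<longrightarrow> 7 \<le> r + n) \<and> (3 \<le> n \<longrightarrow> 10 \<le> r + n) \<and> (4 \<le> n \<longrightarrow> 13 \<le> r + n)"
proof -
  assume h: "class_ok r s q w" "q + 2 * w = 2" "n = s + q + w" "r + n \<le> 14"
  have "w = 0 \<and> q = 2 \<or> w = 1 \<and> q = 0" using h(2) by presburger
  then show ?thesis using h unfolding class_ok_def by presburger
qed

lemma class_3: "class_ok r s q w \<Longrightarrow> q + 2 * w = 3 \<Longrightarrow> n = s + q + w \<Longrightarrow> r + n \<le> 14 \<Longrightarrow>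
    n \<le> 5 \<and> 7 \<le> r + n \<and> (3 \<le> n \<longrightarrow> 10 \<le> r + n) \<and> (4 \<le> n \<longrightarrow> 12 \<le> r + n) \<and> (5 \<le> n \<longrightarrow> 14 \<le> r + n)"
proof -
  assume h: "class_ok r s q w" "q + 2 * w = 3" "n = s + q + w" "r + n \<le> 14"
  have "w = 0 \<and> q = 3 \<or> w = 1 \<and> q = 1" using h(2) by presburger
  then show ?thesis using h unfolding class_ok_def by presburger
qed

lemma class_4: "class_ok r s q w \<Longrightarrow> q + 2 * w = 4 \<Longrightarrow> n = s + q + w \<Longrightarrow> r + n \<le> 14 \<Longrightarrow>
    n \<le> 5 \<and> 6 \<le> r + n \<and> (3 \<le> n \<longrightarrow> 8 \<le> r + n) \<and> (4 \<le> n \<longrightarrow> 11 \<le> r + n) \<and> (5 \<le> n \<longrightarrow> 14 \<le> r + n)"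
proof -
  assume h: "class_ok r s q w" "q + 2 * w = 4" "n = s + q + w" "r + n \<le> 14"
  have "w = 0 \<and> q = 4 \<or> w = 1 \<and> q = 2 \<or> w = 2 \<and> q = 0" using h(2) by presburger
  then show ?thesis using h unfolding class_ok_def by presburger
qed

lemma class_6: "class_ok r s q w \<Longrightarrow> q + 2 * w = 6 \<Longrightarrow> n = s + q + w \<Longrightarrow> r + n \<le> 14 \<Longrightarrow>
    n \<le> 6 \<and> 7 \<le> r + n \<and> (4 \<le> n \<longrightarrow> 9 \<le> r + n) \<and> (5 \<le> n \<longrightarrow> 12 \<le> r + n) \<and> (6 \<le> n \<longrightarrow> 13 \<le> r + n)"
proof -
  assume h: "class_ok r s q w" "q + 2 * w = 6" "n = s + q + w" "r + n \<le> 14"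
  have "w = 0 \<and> q = 6 \<or> w = 1 \<and> q = 4 \<or> w = 2 \<and> q = 2 \<or> w = 3 \<and> q = 0" using h(2) by presburger
  then show ?thesis using h unfolding class_ok_def by presburger
qed

text \<open>\<open>k\<close> cut edges meet the class, which has size \<open>n\<close>, in a shore of size \<open>a\<close>.\<close>

definition bounded :: "nat \<Rightarrow> nat \<Rightarrow> nat \<Rightarrow> bool" where
  "bounded k n a \<longleftrightarrow>
    (k = 0 \<longrightarrow> n \<le> 4 \<and> (1 \<le> n \<longrightarrow> 7 \<le> a) \<and> (2 \<le> n \<longrightarrow> 10 \<le> a) \<and> (3 \<le> n \<longrightarrow> 12 \<le> a) \<and> (4 \<le> n \<longrightarrow> 14 \<le> a)) \<and>
    (k = 1 \<longrightarrow> n \<le> 4 \<and> (1 \<le> n \<longrightarrow> 6 \<le> a) \<and> (2 \<le> n \<longrightarrow> 9 \<le> a) \<and> (3 \<le> n \<longrightarrow> 11 \<le> a) \<and> (4 \<le> n \<longrightarrow> 13 \<le> a)) \<and>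
    (k = 2 \<longrightarrow> n \<le> 4 \<and> (1 \<le> n \<longrightarrow> 5 \<le> a) \<and> (2 \<le> n \<longrightarrow> 7 \<le> a) \<and> (3 \<le> n \<longrightarrow> 10 \<le> a) \<and> (4 \<le> n \<longrightarrow> 13 \<le> a)) \<and>
    (k = 3 \<longrightarrow> n \<le> 5 \<and> 7 \<le> a \<and> (3 \<le> n \<longrightarrow> 10 \<le> a) \<and> (4 \<le> n \<longrightarrow> 12 \<le> a) \<and> (5 \<le> n \<longrightarrow> 14 \<le> a)) \<and>
    (k = 4 \<longrightarrow> n \<le> 5 \<and> 6 \<le> a \<and> (3 \<le> n \<longrightarrow> 8 \<le> a) \<and> (4 \<le> n \<longrightarrow> 11 \<le> a) \<and> (5 \<le> n \<longrightarrow> 14 \<le> a)) \<and>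
    (k = 6 \<longrightarrow> n \<le> 6 \<and> 7 \<le> a \<and> (4 \<le> n \<longrightarrow> 9 \<le> a) \<and> (5 \<le> n \<longrightarrow> 12 \<le> a) \<and> (6 \<le> n \<longrightarrow> 13 \<le> a))"

lemma class_bounded:
  assumes "class_ok r s q w" "n = s + q + w" "k = q + 2 * w" "a = r + n" "a \<le> 14"
  shows "bounded k n a"
proof -
  have a: "r + n \<le> 14" using assms(4,5) by simp
  have z: "class_ok r n 0 0" if "k = 0" using assms(1-3) that by simp
  have o: "class_ok r s 1 0 \<and> n = s + 1" if "k = 1"
  proof -
    have "q = 1" "w = 0" using assms(3) that by presburger+
    then show ?thesis using assms(1,2) by simp
  qed
  have c0: "q + 2 * w = 0 \<Longrightarrow> class_ok r n 0 0" and c1: "q + 2 * w = 1 \<Longrightarrow> class_ok r s 1 0" "q + 2 * w = 1 \<Longrightarrow> n = s + 1"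
    using z o assms(3) by simp_all
  show ?thesis unfolding bounded_def assms(3,4)
    apply (intro conjI[of "_ \<longrightarrow> _"] impI)
         apply (rule class_0[OF c0 a], assumption)
        apply (rule class_1[OF c1 a], assumption, assumption)
       apply (rule class_2[OF assms(1) _ assms(2) a], assumption)
      apply (rule class_3[OF assms(1) _ assms(2) a], assumption)
     apply (rule class_4[OF assms(1) _ assms(2) a], assumption)
    apply (rule class_6[OF assms(1) _ assms(2) a], assumption)
    done
qed

text \<open>The thresholds of \<open>bounded\<close>, read as the largest possible class size for a
  given shore size; the last branch is meant for \<open>k = 6\<close>.\<close>

definition cap :: "nat \<Rightarrow> nat \<Rightarrow> nat" where
  "cap k a = (if k = 0 then if a < 7 then 0 else if a < 10 then 1 else if a < 12 then 2 else if a < 14 then 3 else 4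
     else if k = 1 then if a < 6 then 0 else if a < 9 then 1 else if a < 11 then 2 else if a < 13 then 3 else 4
     else if k = 2 then if a < 5 then 0 else if a < 7 then 1 else if a < 10 then 2 else if a < 13 then 3 else 4
     else if k = 3 then if a < 7 then 0 else if a < 10 then 2 else if a < 12 then 3 else if a < 14 then 4 else 5
     else if k = 4 then if a < 6 then 0 else if a < 8 then 2 else if a < 11 then 3 else if a < 14 then 4 else 5
     else if a < 7 then 0 else if a < 9 then 3 else if a < 12 then 4 else if a < 13 then 5 else 6)"

lemma bounded_cap:
  assumes "bounded k n a" "k \<in> {0, 1, 2, 3, 4, 6}" "3 \<le> k \<longrightarrow> 7 \<le> a \<or> k = 4 \<and> 6 \<le> a" shows "n \<le> cap k a"
proof -
  consider "k = 0" | "k = 1" | "k = 2" | "k = 3" | "k = 4" | "k = 6" using assms(2) by blast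
  then show ?thesis using assms(1,3) unfolding bounded_def cap_def by cases (simp_all, presburger+)
qed

lemma cap_sum:
  assumes "2 \<le> a" "a < 14"
  shows "cap 6 a + cap 0 a + cap 0 a < a" "cap 3 a + cap 3 a + cap 0 a < a" "cap 4 a + cap 1 a + cap 1 a < a"
    "cap 2 a + cap 2 a + cap 2 a < a"
proof -
  have "a = 2 \<or> a = 3 \<or> a = 4 \<or> a = 5 \<or> a = 6 \<or> a = 7 \<or> a = 8 \<or> a = 9 \<or> a = 10 \<or> a = 11 \<or> a = 12 \<or> a = 13"
    using assms by presburger
  then show "cap 6 a + cap 0 a + cap 0 a < a" "cap 3 a + cap 3 a + cap 0 a < a" "cap 4 a + cap 1 a + cap 1 a < a"
    "cap 2 a + cap 2 a + cap 2 a < a" by (elim disjE; simp add: cap_def)+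
qed

lemma cap_14: "cap 6 14 = 6" "cap 0 14 = 4" "cap 3 14 = 5" "cap 4 14 = 5" "cap (Suc 0) 14 = 4" "cap 2 14 = 4"
  by (simp_all add: cap_def)

text \<open>Below 14 the three caps never reach the shore size. At 14 the distributions 6, 0, 0 and
  3, 3, 0 reach it with 6 + 4 + 4 and 5 + 5 + 4, without slack, while 4, 1, 1 and 2, 2, 2 reach only
  13 and 12.\<close>

lemma cover:
  fixes n0 n1 n2 :: nat
  assumes b: "bounded k0 n0 a" "bounded k1 n1 a" "bounded k2 n2 a" and a: "a = n0 + n1 + n2" "2 \<le> a" "a \<le> 14"
    and k: "k0 + k1 + k2 = 6" "k0 mod 3 = k1 mod 3" "k1 mod 3 = k2 mod 3"
  shows "a = 14 \<and>
    (n0 = 5 \<and> n1 = 5 \<and> n2 = 4 \<and> k0 = 3 \<and> k1 = 3 \<and> k2 = 0 \<or> n0 = 5 \<and> n1 = 4 \<and> n2 = 5 \<and> k0 = 3 \<and> k1 = 0 \<and> k2 = 3 \<or>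
     n0 = 4 \<and> n1 = 5 \<and> n2 = 5 \<and> k0 = 0 \<and> k1 = 3 \<and> k2 = 3 \<or> n0 = 6 \<and> n1 = 4 \<and> n2 = 4 \<and> k0 = 6 \<and> k1 = 0 \<and> k2 = 0 \<or>
     n0 = 4 \<and> n1 = 6 \<and> n2 = 4 \<and> k0 = 0 \<and> k1 = 6 \<and> k2 = 0 \<or> n0 = 4 \<and> n1 = 4 \<and> n2 = 6 \<and> k0 = 0 \<and> k1 = 0 \<and> k2 = 6)"
proof -
  have small: "k \<in> {0, 1, 2, 3, 4, 6} \<and> (3 \<le> k \<longrightarrow> 7 \<le> a \<or> k = 4 \<and> 6 \<le> a)" if "bounded k n a" "k \<in> {0, 1, 2, 3, 4, 6}" for k n
  proof -
    note h = that
    consider "k = 0" | "k = 1" | "k = 2" | "k = 3" | "k = 4" | "k = 6" using h(2) by blast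
    then show ?thesis using h(1) unfolding bounded_def by cases simp_all
  qed
  have ks: "k0 = 6 \<and> k1 = 0 \<and> k2 = 0 \<or> k0 = 0 \<and> k1 = 6 \<and> k2 = 0 \<or> k0 = 0 \<and> k1 = 0 \<and> k2 = 6 \<or>
    k0 = 3 \<and> k1 = 3 \<and> k2 = 0 \<or> k0 = 3 \<and> k1 = 0 \<and> k2 = 3 \<or> k0 = 0 \<and> k1 = 3 \<and> k2 = 3 \<or>
    k0 = 4 \<and> k1 = 1 \<and> k2 = 1 \<or> k0 = 1 \<and> k1 = 4 \<and> k2 = 1 \<or> k0 = 1 \<and> k1 = 1 \<and> k2 = 4 \<or> k0 = 2 \<and> k1 = 2 \<and> k2 = 2"
  proof -
    have k2: "k2 = 6 - k0 - k1" and le: "k0 + k1 \<le> 6" using k(1) by simp_all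
    have "k0 = 0 \<or> k0 = 1 \<or> k0 = 2 \<or> k0 = 3 \<or> k0 = 4 \<or> k0 = 5 \<or> k0 = 6" using le by presburger
    moreover have "k1 = 0 \<or> k1 = 1 \<or> k1 = 2 \<or> k1 = 3 \<or> k1 = 4 \<or> k1 = 5 \<or> k1 = 6" using le by presburger
    ultimately show ?thesis using le k(2,3) unfolding k2 by (elim disjE; simp)
  qed
  have le: "n \<le> cap k a" if "bounded k n a" "k \<in> {0, 1, 2, 3, 4, 6}" for k n
    using bounded_cap[OF that] small[OF that] by blast
  have "k0 \<in> {0, 1, 2, 3, 4, 6}" "k1 \<in> {0, 1, 2, 3, 4, 6}" "k2 \<in> {0, 1, 2, 3, 4, 6}"
    using ks by (elim disjE conjE; simp only: insert_iff; simp)+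
  then have c: "n0 \<le> cap k0 a" "n1 \<le> cap k1 a" "n2 \<le> cap k2 a" 
    using le[OF b(1)] le[OF b(2)] le[OF b(3)] by blast+
  have a14: "a = 14"
  proof (rule ccontr)
    assume "a \<noteq> 14"
    then have "a < 14" using a(3) by simp
    note s = cap_sum[OF a(2) this]
    have "cap k0 a + cap k1 a + cap k2 a < a" using ks
      by (elim disjE conjE) (hypsubst, use s in linarith)+
    then show False using c a(1) by linarith
  qed
  have c': "n0 \<le> cap k0 14" "n1 \<le> cap k1 14" "n2 \<le> cap k2 14" "n0 + n1 + n2 = 14" using c a(1) unfolding a14 by simp_all
  have ge: "14 \<le> cap k0 14 + cap k1 14 + cap k2 14" using c' by linarith
  have tight: "cap k0 14 + cap k1 14 + cap k2 14 \<le> 14 \<longrightarrow> n0 = cap k0 14 \<and> n1 = cap k1 14 \<and> n2 = cap k2 14"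
    by (intro impI conjI) (use c' in linarith)+
  have "n0 = 5 \<and> n1 = 5 \<and> n2 = 4 \<and> k0 = 3 \<and> k1 = 3 \<and> k2 = 0 \<or> n0 = 5 \<and> n1 = 4 \<and> n2 = 5 \<and> k0 = 3 \<and> k1 = 0 \<and> k2 = 3 \<or>
     n0 = 4 \<and> n1 = 5 \<and> n2 = 5 \<and> k0 = 0 \<and> k1 = 3 \<and> k2 = 3 \<or> n0 = 6 \<and> n1 = 4 \<and> n2 = 4 \<and> k0 = 6 \<and> k1 = 0 \<and> k2 = 0 \<or>
     n0 = 4 \<and> n1 = 6 \<and> n2 = 4 \<and> k0 = 0 \<and> k1 = 6 \<and> k2 = 0 \<or> n0 = 4 \<and> n1 = 4 \<and> n2 = 6 \<and> k0 = 0 \<and> k1 = 0 \<and> k2 = 6"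
    using ks ge tight by (elim disjE[where R = "_ \<or> _"]; simp add: cap_14)
  then show ?thesis using a14 by blast
qed

lemma obtain_distinct:
  assumes "n \<le> card S" obtains xs where "set xs \<subseteq> S" "distinct xs" "length xs = n"
proof -
  obtain S' where S': "S' \<subseteq> S" "card S' = n" "finite S'" using obtain_subset_with_card_n[OF assms] by blast
  obtain xs where "set xs = S'" "distinct xs" using finite_distinct_list[OF S'(3)] by blast
  then show ?thesis using that S' distinct_card by fastforce
qed

lemma two_of: assumes "2 \<le> card S" obtains x y where "x \<in> S" "y \<in> S" "x \<noteq> y"
proof -
  obtain xs where xs: "set xs \<subseteq> S" "distinct xs" "length xs = 2" using obtain_distinct[OF assms] .
  then obtain x y where "xs = [x, y]" by (auto simp: numeral_eq_Suc length_Suc_conv)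
  then show ?thesis using that xs by auto
qed

lemma three_of: assumes "3 \<le> card S" obtains x y z where "x \<in> S" "y \<in> S" "z \<in> S" "x \<noteq> y" "x \<noteq> z" "y \<noteq> z"
proof -
  obtain xs where xs: "set xs \<subseteq> S" "distinct xs" "length xs = 3" using obtain_distinct[OF assms] .
  then obtain x y z where "xs = [x, y, z]" by (auto simp: numeral_eq_Suc length_Suc_conv)
  then show ?thesis using that xs by auto
qed

lemma four_of: assumes "4 \<le> card S"
  obtains x y z u where "x \<in> S" "y \<in> S" "z \<in> S" "u \<in> S" "x \<noteq> y" "x \<noteq> z" "y \<noteq> z" "x \<noteq> u" "y \<noteq> u" "z \<noteq> u"
proof -
  obtain xs where xs: "set xs \<subseteq> S" "distinct xs" "length xs = 4" using obtain_distinct[OF assms] .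
  then obtain x y z u where "xs = [x, y, z, u]" by (auto simp: numeral_eq_Suc length_Suc_conv)
  then show ?thesis using that xs by auto
qed

section \<open>From the rules to the numerical conditions\<close>

context view_system begin

definition lev :: "nat \<Rightarrow> 'a set" where "lev j = {p\<in>I. t p = j}"

lemma levels: "card I = card (lev 0) + card (lev 1) + card (lev 2)" "sum t I = card (lev 1) + 2 * card (lev 2)"
  and I_lev: "I = lev 0 \<union> lev 1 \<union> lev 2"
proof -
  have "t p = 0 \<or> t p = 1 \<or> t p = 2" if "p \<in> I" for p using t_le[of p] that by auto
  then show I: "I = lev 0 \<union> lev 1 \<union> lev 2" unfolding lev_def by blast
  have f: "finite (lev j)" for j unfolding lev_def using finI by simp
  have d: "lev 0 \<inter> lev 1 = {}" "(lev 0 \<union> lev 1) \<inter> lev 2 = {}" by (auto simp: lev_def)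
  show "card I = card (lev 0) + card (lev 1) + card (lev 2)"
    by (subst I, subst card_Un_disjoint[OF _ _ d(2)], use f in blast, use f in blast, subst card_Un_disjoint[OF _ _ d(1)]) (use f in auto)
  have "sum t I = sum t (lev 0 \<union> lev 1) + sum t (lev 2)"
    by (subst I, rule sum.union_disjoint) (use f d in auto)
  also have "sum t (lev 0 \<union> lev 1) = sum t (lev 0) + sum t (lev 1)"
    by (rule sum.union_disjoint) (use f d in auto)
  finally show "sum t I = card (lev 1) + 2 * card (lev 2)" by (simp add: lev_def)
qed

text \<open>The 2-colouring \<open>f\<close> of \<open>R\<close>, which \<open>rule_8_bip\<close>
  requires, exists because \<open>R\<close> consists of the other two colour classes.\<close>

lemma class_ok_levels:
  assumes bip: "\<And>x y. x \<in> R \<Longrightarrow> y \<in> R \<Longrightarrow> E x y \<Longrightarrow> f x \<noteq> (f y :: bool)"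
  shows "class_ok (card R) (card (lev 0)) (card (lev 1)) (card (lev 2))"
proof -
  have f: "finite (lev j)" for j unfolding lev_def using finI by simp
  have memb: "p \<in> I" "t p = j" if "p \<in> lev j" for p j using that by (auto simp: lev_def)
  have low: "6 \<le> card R + j" if "1 \<le> card (lev j)" for j
  proof -
    obtain p where "p \<in> lev j" using \<open>1 \<le> card (lev j)\<close> by fastforce
    then show ?thesis using T_card[OF memb(1)] memb(2) by fastforce
  qed
  have one: "\<exists>p. p \<in> lev j" if "card (lev j) \<noteq> 0" for j using that by (metis card.empty ex_in_conv)
  show ?thesis unfolding class_ok_def
  proof (intro conjI impI)
    show "6 \<le> card R" if "1 \<le> card (lev 0)" using low[OF that] by simp
    show "5 \<le> card R" if "1 \<le> card (lev 1)" using low[OF that] by simp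
    show "4 \<le> card R" if "1 \<le> card (lev 2)" using low[OF that] by simp
    show "card (lev 0) \<le> 1" if r: "card R \<le> 7"
    proof (rule ccontr)
      assume "\<not> card (lev 0) \<le> 1"
      then obtain u v where "u \<in> lev 0" "v \<in> lev 0" "u \<noteq> v" using two_of[of "lev 0"] by auto
      then show False using rule_7[OF r] memb by metis
    qed
    show "card (lev 0) = 0 \<or> card (lev 1) = 0" if r: "card R \<le> 6"
    proof (rule ccontr)
      assume "\<not> ?thesis"
      then obtain u p where "u \<in> lev 0" "p \<in> lev 1" using one[of 0] one[of 1] by auto
      then show False using rule_6[OF r] memb by metis
    qed
    show "card (lev 1) \<le> 2" if r: "card R \<le> 6"
    proof (rule ccontr)
      assume "\<not> ?thesis"
      then obtain p q s where "p \<in> lev 1" "q \<in> lev 1" "s \<in> lev 1" "p \<noteq> q" "p \<noteq> s" "q \<noteq> s" using three_of[of "lev 1"] by auto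
      then show False using rule_6'[OF r] memb by metis
    qed
    show "card (lev 0) = 0 \<or> card (lev 1) \<le> 2" if r: "card R = 7"
    proof (rule ccontr)
      assume a: "\<not> ?thesis"
      then obtain p q s where "p \<in> lev 1" "q \<in> lev 1" "s \<in> lev 1" "p \<noteq> q" "p \<noteq> s" "q \<noteq> s" using three_of[of "lev 1"] by auto
      moreover obtain v where "v \<in> lev 0" using one[of 0] a by auto
      ultimately show False using rule_7'[OF r, of v p q s] memb by auto
    qed
    show "card (lev 0) \<le> 3" if r: "card R = 8"
    proof (rule ccontr)
      assume a: "\<not> ?thesis"
      then have "4 \<le> card (lev 0)" by simp
      from four_of[OF this] obtain x y z u where "x \<in> lev 0" "y \<in> lev 0" "z \<in> lev 0" "u \<in> lev 0"
        "x \<noteq> y" "x \<noteq> z" "y \<noteq> z" "x \<noteq> u" "y \<noteq> u" "z \<noteq> u" .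
      then show False using rule_8_3[OF r, of u x y z] memb by auto
    qed
    show "card (lev 1) = 0" if r: "card R = 8" "card (lev 0) = 3"
    proof (rule ccontr)
      assume a: "card (lev 1) \<noteq> 0"
      have "3 \<le> card (lev 0)" using r by simp
      from three_of[OF this] obtain x y z where "x \<in> lev 0" "y \<in> lev 0" "z \<in> lev 0" "x \<noteq> y" "x \<noteq> z" "y \<noteq> z" .
      moreover obtain p where "p \<in> lev 1" using one[OF a] by blast
      ultimately have *: "p \<in> lev 1" "x \<in> lev 0" "y \<in> lev 0" "z \<in> lev 0" "x \<noteq> p" "y \<noteq> p" "z \<noteq> p" "x \<noteq> y" "x \<noteq> z" "y \<noteq> z"
        by (auto simp: lev_def)
      show False using rule_8_3[OF r(1) *(1-4)[THEN memb(1)] *(5-10)] *(1-4)[THEN memb(2)] by simp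
    qed
    show "card (lev 0) \<le> 3" if r: "card R = 9"
    proof (rule ccontr)
      assume a: "\<not> ?thesis"
      then have "4 \<le> card (lev 0)" by simp
      from four_of[OF this] obtain x y z u where "x \<in> lev 0" "y \<in> lev 0" "z \<in> lev 0" "u \<in> lev 0"
        "x \<noteq> y" "x \<noteq> z" "y \<noteq> z" "x \<noteq> u" "y \<noteq> u" "z \<noteq> u" .
      then show False using rule_9_4[OF r, of u x y z] memb by auto
    qed
    show "\<not> (card (lev 0) = 3 \<and> card (lev 1) = 2 \<and> card (lev 2) = 0)" if r: "card R = 9"
    proof
      assume a: "card (lev 0) = 3 \<and> card (lev 1) = 2 \<and> card (lev 2) = 0"
      obtain u v w where u: "lev 0 = {u, v, w}" "u \<noteq> v" "u \<noteq> w" "v \<noteq> w" using a by (auto simp: card_3_iff)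
      obtain p q where p: "lev 1 = {p, q}" "p \<noteq> q" using a by (auto simp: card_2_iff)
      have "lev 2 = {}" using a f by simp
      then have I: "I = {u, v, w, p, q}" using I_lev u(1) p(1) by auto
      have tt: "t u = 0" "t v = 0" "t w = 0" "t p = 1" "t q = 1"
        using memb(2)[of u 0] memb(2)[of v 0] memb(2)[of w 0] memb(2)[of p 1] memb(2)[of q 1] u(1) p(1) by simp_all
      then have "distinct [u, v, w, p, q]" using u p(2) by auto
      then show False using rule_9_32[OF r I] tt by blast
    qed
    show "card (lev 0) \<le> 1 \<or> card (lev 1) \<le> 1 \<or> 15 + card (lev 1) + 2 * card (lev 2) \<le> 3 * (card (lev 0) + card (lev 1) + card (lev 2))"
      if r: "card R = 8"
    proof (rule ccontr)
      assume a: "\<not> ?thesis"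
      then have c: "2 \<le> card (lev 0)" "2 \<le> card (lev 1)" by auto
      obtain u v where "u \<in> lev 0" "v \<in> lev 0" "u \<noteq> v" using two_of[OF c(1)] .
      moreover obtain p q where "p \<in> lev 1" "q \<in> lev 1" "p \<noteq> q" using two_of[OF c(2)] .
      moreover have "3 * card I < 15 + sum t I" using a levels by simp
      ultimately show False using rule_8_22[OF r, of u v p q] memb by auto
    qed
    show "\<not> (card (lev 0) = 3 \<and> card (lev 1) + 2 * card (lev 2) + 6 = 2 * (card (lev 0) + card (lev 1) + card (lev 2)))"
      if r: "card R = 8"
    proof
      assume a: "card (lev 0) = 3 \<and> card (lev 1) + 2 * card (lev 2) + 6 = 2 * (card (lev 0) + card (lev 1) + card (lev 2))"
      then have "3 \<le> card (lev 0)" by simp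
      from three_of[OF this] obtain x y z where x: "x \<in> lev 0" "y \<in> lev 0" "z \<in> lev 0" "x \<noteq> y" "x \<noteq> z" "y \<noteq> z" .
      have "sum t I + 6 = 2 * card I" using a levels by simp
      then show False
        by (rule rule_8_bip[where f = f, OF r memb(1)[OF x(1)] memb(1)[OF x(2)] memb(1)[OF x(3)] x(4-6)
            memb(2)[OF x(1)] memb(2)[OF x(2)] memb(2)[OF x(3)] _ bip])
    qed
    show "\<not> (card (lev 0) = 1 \<and> card (lev 1) = 4 \<and> card (lev 2) = 0)" if r: "card R = 8"
    proof
      assume a: "card (lev 0) = 1 \<and> card (lev 1) = 4 \<and> card (lev 2) = 0"
      obtain v where v: "lev 0 = {v}" using a by (auto simp: card_1_singleton_iff)
      have e: "lev 2 = {}" using a f by simp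
      interpret view_8_14 I R T t E v
      proof
        show "card R = 8" "card I = 5" using r a levels by simp_all
        show "v \<in> I" "t v = 0" using v memb[of v 0] by simp_all
        show "t p = 1" if "p \<in> I - {v}" for p
        proof -
          have "p \<in> lev 1" using that I_lev v e by blast
          then show ?thesis by (rule memb(2))
        qed
      qed
      show False by (rule contra)
    qed
  qed
qed

end

section \<open>Induction over the shores\<close>

context critical_graph begin

lemma class_bound:
  assumes A: "A \<subseteq> V" "card A \<le> 14" and t: "\<And>x. x \<in> A \<Longrightarrow> out A x \<le> 2" and cut: "sum (out A) A = 6"
    and \<phi>: "proper A \<phi>" and i: "i < 3"
  shows "bounded (sum (out A) {x\<in>A. \<phi> x = i}) (card {x\<in>A. \<phi> x = i}) (card A)"
proof -
  define I where "I = {x\<in>A. \<phi> x = i}"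
  have I: "I \<subseteq> A" "\<And>x y. x \<in> I \<Longrightarrow> y \<in> I \<Longrightarrow> \<not> E x y"
    using \<phi> unfolding I_def proper_def by (auto, metis)
  interpret view_system I "A - I" "\<lambda>p. {x\<in>A - I. \<not> E p x}" "out A" E
    by (rule view_system_class[OF A(1) t cut I])
  \<comment> \<open>Some colour other than \<open>i\<close>; having it or not separates the other
    two classes.\<close>
  define j where "j = (if i = 0 then 1 else 0 :: nat)"
  have bip: "(\<phi> x = j) \<noteq> (\<phi> y = j)" if "x \<in> A - I" "y \<in> A - I" "E x y" for x y
  proof -
    have "\<phi> x < 3" "\<phi> y < 3" "\<phi> x \<noteq> \<phi> y" "\<phi> x \<noteq> i" "\<phi> y \<noteq> i" using that \<phi> unfolding I_def proper_def by auto
    then show ?thesis using i unfolding j_def by (cases "i = 0") auto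
  qed
  have finA: "finite A" using A finV finite_subset by blast
  have "card A = card (A - I) + card I"
    using card_Diff_subset[OF finite_subset[OF I(1) finA] I(1)] card_mono[OF finA I(1)] by simp
  from class_bounded[OF class_ok_levels[OF bip] levels this A(2)] show ?thesis unfolding I_def .
qed

text \<open>The class of colour \<open>i\<close> has no cut edges and plays the role of
  \<open>I\<close> in \<open>rule_10\<close>, with the class of colour \<open>j\<close> as
  \<open>X\<close>.\<close>

lemma no_portless_class:
  assumes A: "A \<subseteq> V" "card A = 14" and t: "\<And>x. x \<in> A \<Longrightarrow> out A x \<le> 2" and cut: "sum (out A) A = 6"
    and \<phi>: "proper A \<phi>" and ij: "i < 3" "j < 3" "l < 3" "i \<noteq> j" "i \<noteq> l" "j \<noteq> l"
    and Z: "card {x\<in>A. \<phi> x = i} = 4" "sum (out A) {x\<in>A. \<phi> x = i} = 0"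
    and X: "card {x\<in>A. \<phi> x = j} = 5 \<and> sum (out A) {x\<in>A. \<phi> x = j} = 3 \<and> card {x\<in>A. \<phi> x = l} = 5 \<or>
      card {x\<in>A. \<phi> x = j} = 6 \<and> sum (out A) {x\<in>A. \<phi> x = j} = 6"
  shows False
proof -
  have finA: "finite A" using A finV finite_subset by blast
  define I where "I u = {x\<in>A. \<phi> x = u}" for u
  have I: "I u \<subseteq> A" "\<And>x y. x \<in> I u \<Longrightarrow> y \<in> I u \<Longrightarrow> \<not> E x y" for u
    using \<phi> unfolding I_def proper_def by (auto, metis)
  have vs: "view_system (I u) (A - I u) (\<lambda>p. {x\<in>A - I u. \<not> E p x}) (out A) E" for u
    by (rule view_system_class[OF A(1) t cut I])
  have cI: "card (A - I u) = 14 - card (I u)" for u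
    using card_Diff_subset[OF finite_subset[OF I(1) finA] I(1)] A(2) by simp
  interpret Z: view_system "I i" "A - I i" "\<lambda>p. {x\<in>A - I i. \<not> E p x}" "out A" E by (rule vs)
  have r: "card (A - I i) = 10" using cI[of i] Z(1) by (simp add: I_def)
  have n: "card (I i) = 4" using Z(1) by (simp add: I_def)
  have t0: "out A p = 0" if "p \<in> I i" for p using Z(2) that finA by (simp add: I_def)
  have cl: "\<phi> x = j \<or> \<phi> x = l" if "x \<in> A - I i" for x
  proof -
    have "\<phi> x < 3" "\<phi> x \<noteq> i" using that \<phi> unfolding I_def proper_def by auto
    then show ?thesis using ij by arith
  qed
  have XR: "I j \<subseteq> A - I i" using ij by (auto simp: I_def)
  have bip: "(x \<in> I j) \<noteq> (y \<in> I j)" if "x \<in> A - I i" "y \<in> A - I i" "E x y" for x y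
  proof -
    have "\<phi> x \<noteq> \<phi> y" using that \<phi> unfolding proper_def by auto
    then show ?thesis using cl[OF that(1)] cl[OF that(2)] that(1,2) unfolding I_def by auto
  qed
  from X show False
  proof
    assume h: "card {x\<in>A. \<phi> x = j} = 6 \<and> sum (out A) {x\<in>A. \<phi> x = j} = 6"
    show False
      by (rule Z.rule_10_64[OF r n t0 XR bip]) (use h in \<open>simp_all add: I_def\<close>)
  next
    assume h: "card {x\<in>A. \<phi> x = j} = 5 \<and> sum (out A) {x\<in>A. \<phi> x = j} = 3 \<and> card {x\<in>A. \<phi> x = l} = 5"
    \<comment> \<open>This uses the view system of the class of \<open>x\<close> and
      \<open>y\<close> in place of that of colour \<open>i\<close>. The class has size 5, so
      \<open>T x\<close> is a triple, at least two elements of which are outside \<open>T y\<close>.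
      The common non-neighbours in the other two classes, \<open>P\<close> and \<open>Q\<close>, all
      lie in \<open>T x \<inter> T y\<close>.\<close>
    have tw: "card {p\<in>I i. x \<in> {x\<in>A - I i. \<not> E p x} \<and> y \<in> {x\<in>A - I i. \<not> E p x}} +
        card {v\<in>A - I i. (v \<in> I j) \<noteq> (x \<in> I j) \<and> \<not> E x v \<and> \<not> E y v} \<le> 1"
      if xy: "x \<in> A - I i" "y \<in> A - I i" "x \<noteq> y" "x \<in> I j \<longleftrightarrow> y \<in> I j" "out A x = 0" "out A y = 0" for x y
    proof -
      define u where "u = \<phi> x"
      have u: "u = j \<or> u = l" "\<phi> y = u" using cl[OF xy(1)] cl[OF xy(2)] xy(1,2,4) unfolding u_def I_def by auto
      have xyI: "x \<in> I u" "y \<in> I u" using xy(1,2) u by (auto simp: I_def u_def)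
      define T where "T p = {x\<in>A - I u. \<not> E p x}" for p
      interpret U: view_system "I u" "A - I u" T "out A" E unfolding T_def by (rule vs)
      have "card (I u) = 5" using u(1) h by (auto simp: I_def)
      then have "card (A - I u) = 9" using cI[of u] by simp
      then have c3: "card (T x) = 3" using U.T_card[OF xyI(1)] xy(5) by simp
      have "2 \<le> card (T x - T y)" using U.diff_card[OF xyI(2,1) xy(3)] xy(6) by simp
      moreover have "card (T x) = card (T x \<inter> T y) + card (T x - T y)" using card_Int_Diff[OF U.finT[OF xyI(1)]] .
      ultimately have c1: "card (T x \<inter> T y) \<le> 1" using c3 by simp
      define P where "P = {p\<in>I i. x \<in> {x\<in>A - I i. \<not> E p x} \<and> y \<in> {x\<in>A - I i. \<not> E p x}}"
      define Q where "Q = {v\<in>A - I i. (v \<in> I j) \<noteq> (x \<in> I j) \<and> \<not> E x v \<and> \<not> E y v}"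
      have ui: "u \<noteq> i" using u(1) ij by auto
      have "P \<subseteq> T x \<inter> T y" unfolding P_def T_def I_def using ui E_sym by auto
      moreover have "Q \<subseteq> T x \<inter> T y"
      proof
        fix v assume v: "v \<in> Q"
        then have "v \<in> A" "(\<phi> v = j) \<noteq> (\<phi> x = j)" "\<not> E x v" "\<not> E y v" using xy(1) by (auto simp: Q_def I_def)
        then show "v \<in> T x \<inter> T y" unfolding T_def I_def u_def by auto
      qed
      moreover have "P \<inter> Q = {}" by (auto simp: P_def Q_def)
      moreover have "finite P" "finite Q" using finA by (auto simp: P_def Q_def I_def)
      ultimately have "card P + card Q \<le> card (T x \<inter> T y)"
        using card_mono[of "T x \<inter> T y" "P \<union> Q"] U.finT[OF xyI(1)] by (simp add: card_Un_disjoint)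
      then show ?thesis using c1 unfolding P_def Q_def by linarith
    qed
    show False
      by (rule Z.rule_10_55[OF r n t0 XR bip _ _ tw]) (use h in \<open>simp_all add: I_def\<close>)
  qed
qed

text \<open>Removing \<open>x\<close> from \<open>A\<close> leaves a cut of size
  \<open>12 - 2 * out A x\<close>. It is at least 6 by \<open>cut_colours\<close>, and not 6 by
  induction, which gives \<open>out A x \<le> 2\<close>.\<close>

lemma no_small_shore:
  assumes "A \<subseteq> V" "A \<noteq> V" "2 \<le> card A" "card A \<le> 14"
  shows "sum (out A) A \<noteq> 6"
  using assms
proof (induction "card A" arbitrary: A rule: less_induct)
  case less
  note A = less.prems
  have finA: "finite A" using A(1) finV finite_subset by blast
  show ?case
  proof
    assume cut: "sum (out A) A = 6"
    have t: "out A x \<le> 2" if x: "x \<in> A" for x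
    proof -
      define A' where "A' = A - {x}"
      have c: "card A' = card A - 1" using x finA by (simp add: A'_def)
      have A': "A' \<subseteq> V" "A' \<noteq> V" using A(1,2) by (auto simp: A'_def)
      moreover have "A' \<noteq> {}" using c A(3) by auto
      ultimately have A': "A' \<subseteq> V" "A' \<noteq> V" "A' \<noteq> {}" by auto
      obtain \<phi> where "proper A' \<phi>" using proper_exists[OF A'(1,2)] by blast
      from cut_colours(1)[OF A'(1,3,2) this] have "6 \<le> sum (out A') A'" .
      moreover have e: "sum (out A') A' + 2 * out A x = 12" using out_remove[OF A(1) x] cut by (simp add: A'_def)
      moreover have "sum (out A') A' \<noteq> 6"
      \<comment> \<open>The induction hypothesis does not cover a single remaining vertex. In that
        case \<open>x\<close> has at most one neighbour in \<open>A\<close>, so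
        \<open>out A x\<close> is at least 5, not 3.\<close>
      proof (cases "card A = 2")
        case True
        have "card {y\<in>A. E x y} \<le> card A'" using finA E_irr by (intro card_mono) (auto simp: A'_def)
        then show ?thesis using nbrs[OF A(1) x] c True e by linarith
      next
        case False
        then show ?thesis using less.hyps[of A'] c A A' by simp
      qed
      ultimately show ?thesis by linarith
    qed
    obtain \<phi> where \<phi>: "proper A \<phi>" using proper_exists[OF A(1,2)] by blast
    define n k where "n i = card {x\<in>A. \<phi> x = i}" and "k i = sum (out A) {x\<in>A. \<phi> x = i}" for i
    have "A \<noteq> {}" using A(3) by auto
    from cut_colours(2)[OF A(1) this A(2) \<phi> cut]
    have mods: "k 0 mod 3 = k 1 mod 3" "k 1 mod 3 = k 2 mod 3" unfolding k_def by auto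
    have part: "A = {x\<in>A. \<phi> x = 0} \<union> {x\<in>A. \<phi> x = 1} \<union> {x\<in>A. \<phi> x = 2}"
    proof -
      have "\<phi> x = 0 \<or> \<phi> x = 1 \<or> \<phi> x = 2" if "x \<in> A" for x
      proof -
        have "\<phi> x < 3" using \<phi> that unfolding proper_def by blast
        then show ?thesis by auto
      qed
      then show ?thesis by blast
    qed
    have sums: "sum g A = sum g {x\<in>A. \<phi> x = 0} + sum g {x\<in>A. \<phi> x = 1} + sum g {x\<in>A. \<phi> x = 2}" for g :: "'a \<Rightarrow> nat"
    proof -
      have "sum g A = sum g ({x\<in>A. \<phi> x = 0} \<union> {x\<in>A. \<phi> x = 1} \<union> {x\<in>A. \<phi> x = 2})" using part by simp
      also have "\<dots> = sum g ({x\<in>A. \<phi> x = 0} \<union> {x\<in>A. \<phi> x = 1}) + sum g {x\<in>A. \<phi> x = 2}"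
        using finA by (intro sum.union_disjoint) auto
      also have "sum g ({x\<in>A. \<phi> x = 0} \<union> {x\<in>A. \<phi> x = 1}) = sum g {x\<in>A. \<phi> x = 0} + sum g {x\<in>A. \<phi> x = 1}"
        using finA by (intro sum.union_disjoint) auto
      finally show ?thesis .
    qed
    have ns: "card A = n 0 + n 1 + n 2" using sums[of "\<lambda>_. 1"] finA by (simp add: n_def)
    have ks: "k 0 + k 1 + k 2 = 6" using sums[of "out A"] cut by (simp add: k_def)
    have b: "bounded (k i) (n i) (card A)" if "i < 3" for i
      unfolding k_def n_def by (rule class_bound[OF A(1,4) t cut \<phi> that])
    have *: "bounded (k 0) (n 0) (card A)" "bounded (k 1) (n 1) (card A)" "bounded (k 2) (n 2) (card A)" using b by simp_all
    note c = cover[OF * ns A(3,4) ks mods]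
    have kill: False if "i < 3" "j < 3" "l < 3" "i \<noteq> j" "i \<noteq> l" "j \<noteq> l" "n i = 4" "k i = 0"
      "n j = 5 \<and> k j = 3 \<and> n l = 5 \<or> n j = 6 \<and> k j = 6" for i j l
      using no_portless_class[OF A(1) conjunct1[OF c] t cut \<phi> that(1-6)] that(7-9) unfolding n_def k_def by blast
    from conjunct2[OF c] show False
    proof (elim disjE conjE)
      assume "n 0 = 5" "n 1 = 5" "n 2 = 4" "k 0 = 3" "k 1 = 3" "k 2 = 0"
      then show False by (intro kill[of 2 0 1]) simp_all
    next
      assume "n 0 = 5" "n 1 = 4" "n 2 = 5" "k 0 = 3" "k 1 = 0" "k 2 = 3"
      then show False by (intro kill[of 1 0 2]) simp_all
    next
      assume "n 0 = 4" "n 1 = 5" "n 2 = 5" "k 0 = 0" "k 1 = 3" "k 2 = 3"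
      then show False by (intro kill[of 0 1 2]) simp_all
    next
      assume "n 0 = 6" "n 1 = 4" "n 2 = 4" "k 0 = 6" "k 1 = 0" "k 2 = 0"
      then show False by (intro kill[of 1 0 2]) simp_all
    next
      assume "n 0 = 4" "n 1 = 6" "n 2 = 4" "k 0 = 0" "k 1 = 6" "k 2 = 0"
      then show False by (intro kill[of 0 1 2]) simp_all
    next
      assume "n 0 = 4" "n 1 = 4" "n 2 = 6" "k 0 = 0" "k 1 = 0" "k 2 = 6"
      then show False by (intro kill[of 0 2 1]) simp_all
    qed
  qed
qed

end

section \<open>Translation from the given definitions\<close>

lemma chromatic_number_le: "proper_colouring G k c \<Longrightarrow> chromatic_number G \<le> k"
  unfolding chromatic_number_def by (rule Least_le) blast

lemma critical_graph_of_4_1: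
  assumes G: "graph_4_1 G" and reg: "regular 6 G"
  shows "critical_graph (verts G) (\<lambda>x y. {x, y} \<in> edges G)"
proof
  have fs: "finite_simple_graph G" using G unfolding graph_4_1_def by blast
  have e2: "e \<subseteq> verts G" "card e = 2" if "e \<in> edges G" for e using fs that unfolding finite_simple_graph_def by auto
  show "finite (verts G)" using fs unfolding finite_simple_graph_def by blast
  show "{y, x} \<in> edges G" if "{x, y} \<in> edges G" for x y using that by (simp add: insert_commute)
  show "{x, x} \<notin> edges G" for x using e2(2)[of "{x, x}"] by auto
  show "x \<in> verts G" if "{x, y} \<in> edges G" for x y using e2(1)[OF that] by simp
  show "card {y\<in>verts G. {x, y} \<in> edges G} = 6" if x: "x \<in> verts G" for x
  proof -
    have "bij_betw (\<lambda>y. {x, y}) {y\<in>verts G. {x, y} \<in> edges G} {e\<in>edges G. x \<in> e}"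
      unfolding bij_betw_def
    proof
      show "inj_on (\<lambda>y. {x, y}) {y\<in>verts G. {x, y} \<in> edges G}" by (auto simp: inj_on_def doubleton_eq_iff)
      show "(\<lambda>y. {x, y}) ` {y\<in>verts G. {x, y} \<in> edges G} = {e\<in>edges G. x \<in> e}"
      proof
        show "{e\<in>edges G. x \<in> e} \<subseteq> (\<lambda>y. {x, y}) ` {y\<in>verts G. {x, y} \<in> edges G}"
        proof
          fix e assume e: "e \<in> {e\<in>edges G. x \<in> e}"
          then obtain a b where ab: "e = {a, b}" using e2(2)[of e] by (auto simp: card_2_iff)
          then have "e = {x, if a = x then b else a}" using e by auto
          moreover from this have "(if a = x then b else a) \<in> verts G" using e2(1)[of e] e by auto
          ultimately show "e \<in> (\<lambda>y. {x, y}) ` {y\<in>verts G. {x, y} \<in> edges G}" using e by blast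
        qed
      qed auto
    qed
    then show ?thesis using reg x bij_betw_same_card unfolding regular_def degree_def by fastforce
  qed
  show "\<exists>x\<in>verts G. \<exists>y\<in>verts G. {x, y} \<in> edges G \<and> c x = c y \<and> {x, y} \<noteq> {a, b}"
    if c: "\<forall>x\<in>verts G. c x < 3" for c :: "'a \<Rightarrow> nat" and a b
  proof (rule ccontr)
    assume neg: "\<not> ?thesis"
    show False
    \<comment> \<open>A map whose only conflict can be \<open>{a, b}\<close> is a proper colouring
      of the graph without this edge, or of the graph itself if the pair is no edge.\<close>
    proof (cases "{a, b} \<in> edges G")
      case True
      have "proper_colouring (delete_edge G {a, b}) 3 c"
        using c neg unfolding proper_colouring_def delete_edge_def by auto
      then have "chromatic_number (delete_edge G {a, b}) \<le> 3" by (rule chromatic_number_le)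
      then show False using G True unfolding graph_4_1_def by force
    next
      case False
      have "proper_colouring G 3 c" using c neg False unfolding proper_colouring_def by metis
      then have "chromatic_number G \<le> 3" by (rule chromatic_number_le)
      then show False using G unfolding graph_4_1_def by simp
    qed
  qed
  show "\<exists>c. (\<forall>x\<in>verts G. c x < (3::nat)) \<and>
      (\<forall>x\<in>verts G - {v}. \<forall>y\<in>verts G - {v}. {x, y} \<in> edges G \<longrightarrow> c x \<noteq> c y)" if v: "v \<in> verts G" for v
  proof -
    have "finite_simple_graph (delete_vertex G v)" using fs unfolding finite_simple_graph_def delete_vertex_def by auto
    from proper_colouring_chromatic_number[OF this] obtain c where
      "proper_colouring (delete_vertex G v) 3 c" using G v unfolding graph_4_1_def by auto
    \<comment> \<open>The deleted vertex receives the arbitrary colour 0, since all values have to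
      be below 3.\<close>
    then have "(\<forall>x\<in>verts G. (c(v := 0)) x < 3) \<and>
      (\<forall>x\<in>verts G - {v}. \<forall>y\<in>verts G - {v}. {x, y} \<in> edges G \<longrightarrow> (c(v := 0)) x \<noteq> (c(v := 0)) y)"
      unfolding proper_colouring_def delete_vertex_def by auto
    then show ?thesis by blast
  qed
qed

text \<open>As \<open>A\<close> and \<open>B\<close> are disjoint, each edge of the cut comes from
  exactly one ordered pair.\<close>

lemma card_edges_between:
  assumes "finite A" "finite B" "A \<inter> B = {}"
  shows "card (edges_between G A B) = (\<Sum>x\<in>A. card {y\<in>B. {x, y} \<in> edges G})"
proof -
  define S where "S = (SIGMA x:A. {y\<in>B. {x, y} \<in> edges G})"
  have "inj_on (\<lambda>p. {fst p, snd p}) S"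
  proof (rule inj_onI)
    fix p q assume pq: "p \<in> S" "q \<in> S" "{fst p, snd p} = {fst q, snd q}"
    then have m: "fst p \<in> A" "snd p \<in> B" "fst q \<in> A" "snd q \<in> B" by (auto simp: S_def)
    then have "fst p \<noteq> snd q" using assms(3) by auto
    then show "p = q" using pq(3) by (auto simp: doubleton_eq_iff prod_eq_iff)
  qed
  moreover have "(\<lambda>p. {fst p, snd p}) ` S = edges_between G A B"
  proof
    show "(\<lambda>p. {fst p, snd p}) ` S \<subseteq> edges_between G A B"
      unfolding S_def edges_between_def by clarsimp blast
    show "edges_between G A B \<subseteq> (\<lambda>p. {fst p, snd p}) ` S"
    proof
      fix e assume "e \<in> edges_between G A B"
      then obtain a b where ab: "a \<in> A" "b \<in> B" "e = {a, b}" "e \<in> edges G" unfolding edges_between_def by blast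
      then have "(a, b) \<in> S" by (simp add: S_def)
      then show "e \<in> (\<lambda>p. {fst p, snd p}) ` S" by (rule rev_image_eqI) (simp add: ab)
    qed
  qed
  ultimately have "card (edges_between G A B) = card S" using card_image by fastforce
  also have "\<dots> = (\<Sum>x\<in>A. card {y\<in>B. {x, y} \<in> edges G})"
    unfolding S_def using assms by (subst card_SigmaI) auto
  finally show ?thesis .
qed

theorem theorem5p2:
  fixes G :: "'a graph"
  assumes "graph_4_1 G"
    and "regular 6 G"
  shows "\<not> (\<exists>A B. k_edge_cut 6 G A B \<and> (\<exists>S\<in>{A, B}. 9 \<le> card S \<and> card S \<le> 14))"
proof
  interpret critical_graph "verts G" "\<lambda>x y. {x, y} \<in> edges G"
    by (rule critical_graph_of_4_1[OF assms])
  have no: False if "A \<union> B = verts G" "A \<inter> B = {}" "B \<noteq> {}" "card (edges_between G A B) = 6" "9 \<le> card A" "card A \<le> 14" for A B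
  proof -
    have "A \<subseteq> verts G" "A \<noteq> verts G" and B: "verts G - A = B" using that(1-3) by auto
    then have "sum (out A) A \<noteq> 6" using that(5,6) by (intro no_small_shore) auto
    moreover have "finite A" "finite B" using finV that(1) finite_Un[of A B] by simp_all
    then have "sum (out A) A = 6" using card_edges_between[OF _ _ that(2), of G] that(4) unfolding out_def B by simp
    ultimately show False by simp
  qed
  assume "\<exists>A B. k_edge_cut 6 G A B \<and> (\<exists>S\<in>{A, B}. 9 \<le> card S \<and> card S \<le> 14)"
  then obtain A B where AB: "A \<union> B = verts G" "A \<inter> B = {}" "A \<noteq> {}" "B \<noteq> {}" "card (edges_between G A B) = 6"
    and S: "9 \<le> card A \<and> card A \<le> 14 \<or> 9 \<le> card B \<and> card B \<le> 14"
    unfolding k_edge_cut_def vertex_bipartition_def by blast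
  have "edges_between G B A = edges_between G A B" unfolding edges_between_def by (auto simp: insert_commute)
  then show False using S no[OF AB(1,2,4,5)] no[of B A] AB by (auto simp: Un_commute Int_commute)
qed

end
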